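(* The theory $\mathbf{SCOT}$ is a conservative extension of $\mathbf{ZF}c=\mathbf{ZF}+\mathbf{ADC}$; that is, for every sentence $\theta$ in the $\in$-language, if $\mathbf{SCOT}\vdash\theta$ then $\mathbf{ZF}+\mathbf{ADC}\vdash\theta$.
   Context: The $\mathrm{st}$-$\in$-language extends the $\in$-language of set theory by a unary predicate $\mathrm{st}$ ($\mathrm{st}(x)$ reads "$x$ is standard"). An $\in$-formula is a formula not involving $\mathrm{st}$; an $\mathrm{st}$-$\in$-formula may involve it. $\forall^{\mathrm{st}}$ and $\exists^{\mathrm{st}}$ are quantifiers over standard sets. $\mathbf{ZF}$ is Zermelo–Fraenkel set theory without Choice (when part of a theory in the $\mathrm{st}$-$\in$-language, its Separation and Replacement schemas are for $\in$-formulas only). $\mathbb N$ is the set of natural numbers. $\mathbf{SPOT}$ is the theory in the $\mathrm{st}$-$\in$-language with the axioms: - $\mathbf{ZF}$; - Transfer ($\mathbf T$): for each $\in$-formula $\phi$ with standard parameters, $\forall^{\mathrm{st}}x\,\phi(x)\rightarrow\forall x\,\phi(x)$; - Nontriviality ($\mathbf O$): $\exists\nu\in\mathbb N\ \forall^{\mathrm{st}}n\in\mathbb N\ (n\neq\nu)$; - Standard Part ($\mathbf{SP}'$): $\forall A\subseteq\mathbb N\ \exists^{\mathrm{st}}B\subseteq\mathbb N\ \forall^{\mathrm{st}}n\in\mathbb N\ (n\in B\leftrightarrow n\in A)$. $\mathbf{ADC}$ (Axiom of Dependent Choice): if $R$ is a binary relation on a set $A$ such that $\forall a\in A\,\exists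 a'\in A\,(aRa')$, then for every $a\in A$ there is a sequence $\langle a_n\mid n\in\mathbb N\rangle$ with $a_0=a$ and $a_nRa_{n+1}$ for all $n\in\mathbb N$. $\mathbf{SN}$: for each $\mathrm{st}$-$\in$-formula $\phi(v)$ with no parameters, $\forall^{\mathrm{st}}A\ \exists^{\mathrm{st}}S\ \forall^{\mathrm{st}}x\ (x\in S\leftrightarrow x\in A\wedge\phi(x))$. $\mathbf{CC}$ (Countable $\mathrm{st}$-$\in$-Choice): for each $\mathrm{st}$-$\in$-formula $\phi(u,v)$ with arbitrary parameters, $\forall^{\mathrm{st}}n\in\mathbb N\ \exists x\ \phi(n,x)\rightarrow\exists f\,(f\text{ is a function}\wedge\forall^{\mathrm{st}}n\in\mathbb N\ \phi(n,f(n)))$. $\mathbf{SCOT}=\mathbf{SPOT}+\mathbf{ADC}+\mathbf{SN}+\mathbf{CC}$. *)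

theory Defs
  imports Main
begin

(* Formulas of the st-\<in>-language. There are no function symbols, so terms are variables,
   given as de Bruijn indices: under a quantifier, index 0 is the bound variable and
   index Suc k is what index k denotes outside. *)
datatype fm =
    Eq nat nat  (infix \<open>\<^bold>=\<close> 64)
  | Mem nat nat  (infix \<open>\<^bold>\<in>\<close> 64)
  | St nat
  | Fls  (\<open>\<^bold>\<bottom>\<close>)
  | Imp fm fm  (infixr \<open>\<^bold>\<longrightarrow>\<close> 56)
  | Forall fm  (\<open>\<^bold>\<forall>_\<close> [63] 63)

abbreviation Neg :: "fm \<Rightarrow> fm"  (\<open>\<^bold>\<not>_\<close> [63] 63)
  where "\<^bold>\<not>\<phi> \<equiv> \<phi> \<^bold>\<longrightarrow> \<^bold>\<bottom>"

abbreviation Or :: "fm \<Rightarrow> fm \<Rightarrow> fm"  (infixr \<open>\<^bold>\<or>\<close> 57)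
  where "\<phi> \<^bold>\<or> \<psi> \<equiv> \<^bold>\<not>\<phi> \<^bold>\<longrightarrow> \<psi>"

abbreviation And :: "fm \<Rightarrow> fm \<Rightarrow> fm"  (infixr \<open>\<^bold>\<and>\<close> 58)
  where "\<phi> \<^bold>\<and> \<psi> \<equiv> \<^bold>\<not>(\<phi> \<^bold>\<longrightarrow> \<^bold>\<not>\<psi>)"

abbreviation Iff :: "fm \<Rightarrow> fm \<Rightarrow> fm"  (infix \<open>\<^bold>\<longleftrightarrow>\<close> 55)
  where "\<phi> \<^bold>\<longleftrightarrow> \<psi> \<equiv> (\<phi> \<^bold>\<longrightarrow> \<psi>) \<^bold>\<and> (\<psi> \<^bold>\<longrightarrow> \<phi>)"

abbreviation Exists :: "fm \<Rightarrow> fm"  (\<open>\<^bold>\<exists>_\<close> [63] 63)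
  where "\<^bold>\<exists>\<phi> \<equiv> \<^bold>\<not>(\<^bold>\<forall>(\<^bold>\<not>\<phi>))"

abbreviation Forall_st :: "fm \<Rightarrow> fm"  (\<open>\<^bold>\<forall>\<^sup>s\<^sup>t_\<close> [63] 63)
  where "\<^bold>\<forall>\<^sup>s\<^sup>t\<phi> \<equiv> \<^bold>\<forall>(St 0 \<^bold>\<longrightarrow> \<phi>)"

abbreviation Exists_st :: "fm \<Rightarrow> fm"  (\<open>\<^bold>\<exists>\<^sup>s\<^sup>t_\<close> [63] 63)
  where "\<^bold>\<exists>\<^sup>s\<^sup>t\<phi> \<equiv> \<^bold>\<exists>(St 0 \<^bold>\<and> \<phi>)"

primrec fv :: "fm \<Rightarrow> nat set" where
  "fv (x \<^bold>= y) = {x, y}"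
| "fv (x \<^bold>\<in> y) = {x, y}"
| "fv (St x) = {x}"
| "fv \<^bold>\<bottom> = {}"
| "fv (\<phi> \<^bold>\<longrightarrow> \<psi>) = fv \<phi> \<union> fv \<psi>"
| "fv (\<^bold>\<forall>\<phi>) = {k. Suc k \<in> fv \<phi>}"

definition sentence :: "fm \<Rightarrow> bool" where
  "sentence \<phi> \<longleftrightarrow> fv \<phi> = {}"

primrec in_formula :: "fm \<Rightarrow> bool" where
  "in_formula (x \<^bold>= y) = True"
| "in_formula (x \<^bold>\<in> y) = True"
| "in_formula (St x) = False"
| "in_formula \<^bold>\<bottom> = True"
| "in_formula (\<phi> \<^bold>\<longrightarrow> \<psi>) = (in_formula \<phi> \<and> in_formula \<psi>)"
| "in_formula (\<^bold>\<forall>\<phi>) = in_formula \<phi>"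

definition in_lang :: "fm set" where
  "in_lang = {\<phi>. in_formula \<phi>}"

definition st_in_lang :: "fm set" where
  "st_in_lang = UNIV"

primrec rename :: "(nat \<Rightarrow> nat) \<Rightarrow> fm \<Rightarrow> fm" where
  "rename f (x \<^bold>= y) = (f x \<^bold>= f y)"
| "rename f (x \<^bold>\<in> y) = (f x \<^bold>\<in> f y)"
| "rename f (St x) = St (f x)"
| "rename f \<^bold>\<bottom> = \<^bold>\<bottom>"
| "rename f (\<phi> \<^bold>\<longrightarrow> \<psi>) = (rename f \<phi> \<^bold>\<longrightarrow> rename f \<psi>)"
| "rename f (\<^bold>\<forall>\<phi>) = \<^bold>\<forall>(rename (case_nat 0 (\<lambda>k. Suc (f k))) \<phi>)"

(* Read the indices below length xs in phi as its arguments and the remaining ones as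
   parameters. Then inst xs d phi is phi(xs), placed under d further quantifiers that do not
   bind the parameters. *)
definition inst :: "nat list \<Rightarrow> nat \<Rightarrow> fm \<Rightarrow> fm" where
  "inst xs d = rename (\<lambda>i. if i < length xs then xs ! i else i - length xs + d)"

(* Classical natural deduction with equality for the language L (a set of formulas): only
   formulas of L occur in a derivation. The set G of hypotheses may be infinite; in AllI the
   new variable 0 is made fresh for G by shifting G. *)
inductive provable :: "fm set \<Rightarrow> fm set \<Rightarrow> fm \<Rightarrow> bool" for L where
  Assm: "\<phi> \<in> G \<Longrightarrow> \<phi> \<in> L \<Longrightarrow> provable L G \<phi>"
| ImpI: "\<phi> \<in> L \<Longrightarrow> provable L (insert \<phi> G) \<psi> \<Longrightarrow> provable L G (\<phi> \<^bold>\<longrightarrow> \<psi>)"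
| ImpE: "provable L G (\<phi> \<^bold>\<longrightarrow> \<psi>) \<Longrightarrow> provable L G \<phi> \<Longrightarrow> provable L G \<psi>"
| Contr: "\<phi> \<in> L \<Longrightarrow> provable L (insert (\<^bold>\<not>\<phi>) G) \<^bold>\<bottom> \<Longrightarrow> provable L G \<phi>"
| AllI: "provable L (inst [] 1 ` G) \<phi> \<Longrightarrow> provable L G (\<^bold>\<forall>\<phi>)"
| AllE: "provable L G (\<^bold>\<forall>\<phi>) \<Longrightarrow> provable L G (inst [x] 0 \<phi>)"
| EqRefl: "x \<^bold>= x \<in> L \<Longrightarrow> provable L G (x \<^bold>= x)"
| EqSubst: "provable L G (x \<^bold>= y) \<Longrightarrow> provable L G (inst [x] 0 \<phi>) \<Longrightarrow>
    provable L G (inst [y] 0 \<phi>)"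

(* Universal closures: the free variables of an axiom scheme instance are its parameters.
   closures_st quantifies them over standard sets only. *)
definition closures :: "fm \<Rightarrow> fm set" where
  "closures \<phi> = {(Forall ^^ n) \<phi> | n. sentence ((Forall ^^ n) \<phi>)}"

definition closures_st :: "fm \<Rightarrow> fm set" where
  "closures_st \<phi> = {(Forall_st ^^ n) \<phi> | n. sentence ((Forall_st ^^ n) \<phi>)}"

definition subset_fm :: "nat \<Rightarrow> nat \<Rightarrow> fm" where
  "subset_fm x y = \<^bold>\<forall>(0 \<^bold>\<in> x + 1 \<^bold>\<longrightarrow> 0 \<^bold>\<in> y + 1)"

definition empty_fm :: "nat \<Rightarrow> fm" where
  "empty_fm x = \<^bold>\<forall>(\<^bold>\<not>(0 \<^bold>\<in> x + 1))"

(* y is the union of x and {x} *)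
definition succ_fm :: "nat \<Rightarrow> nat \<Rightarrow> fm" where
  "succ_fm y x = \<^bold>\<forall>(0 \<^bold>\<in> y + 1 \<^bold>\<longleftrightarrow> 0 \<^bold>\<in> x + 1 \<^bold>\<or> 0 \<^bold>= x + 1)"

definition inductive_fm :: "nat \<Rightarrow> fm" where
  "inductive_fm I = \<^bold>\<exists>(empty_fm 0 \<^bold>\<and> 0 \<^bold>\<in> I + 1) \<^bold>\<and>
     \<^bold>\<forall>(0 \<^bold>\<in> I + 1 \<^bold>\<longrightarrow> \<^bold>\<exists>(succ_fm 0 1 \<^bold>\<and> 0 \<^bold>\<in> I + 2))"

(* N is the set of natural numbers, as the least inductive set *)
definition Nat_fm :: "nat \<Rightarrow> fm" where
  "Nat_fm N = inductive_fm N \<^bold>\<and> \<^bold>\<forall>(inductive_fm 0 \<^bold>\<longrightarrow> subset_fm (N + 1) 0)"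

(* z = {x, y} *)
definition upair_fm :: "nat \<Rightarrow> nat \<Rightarrow> nat \<Rightarrow> fm" where
  "upair_fm z x y = \<^bold>\<forall>(0 \<^bold>\<in> z + 1 \<^bold>\<longleftrightarrow> 0 \<^bold>= x + 1 \<^bold>\<or> 0 \<^bold>= y + 1)"

(* p = (x, y) = {{x}, {x, y}} *)
definition opair_fm :: "nat \<Rightarrow> nat \<Rightarrow> nat \<Rightarrow> fm" where
  "opair_fm p x y =
     \<^bold>\<forall>(0 \<^bold>\<in> p + 1 \<^bold>\<longleftrightarrow> upair_fm 0 (x + 1) (x + 1) \<^bold>\<or> upair_fm 0 (x + 1) (y + 1))"

(* (x, y) is an element of r *)
definition related_fm :: "nat \<Rightarrow> nat \<Rightarrow> nat \<Rightarrow> fm" where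
  "related_fm r x y = \<^bold>\<exists>(opair_fm 0 (x + 1) (y + 1) \<^bold>\<and> 0 \<^bold>\<in> r + 1)"

definition function_fm :: "nat \<Rightarrow> fm" where
  "function_fm f = \<^bold>\<forall>(0 \<^bold>\<in> f + 1 \<^bold>\<longrightarrow> \<^bold>\<exists>\<^bold>\<exists>(opair_fm 2 1 0)) \<^bold>\<and>
     \<^bold>\<forall>\<^bold>\<forall>\<^bold>\<forall>(related_fm (f + 3) 2 1 \<^bold>\<and> related_fm (f + 3) 2 0 \<^bold>\<longrightarrow> 1 \<^bold>= 0)"

definition relation_on_fm :: "nat \<Rightarrow> nat \<Rightarrow> fm" where
  "relation_on_fm r a =
     \<^bold>\<forall>(0 \<^bold>\<in> r + 1 \<^bold>\<longrightarrow> \<^bold>\<exists>\<^bold>\<exists>(1 \<^bold>\<in> a + 3 \<^bold>\<and> 0 \<^bold>\<in> a + 3 \<^bold>\<and> opair_fm 2 1 0))"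

(* d is the domain of f *)
definition domain_fm :: "nat \<Rightarrow> nat \<Rightarrow> fm" where
  "domain_fm f d = \<^bold>\<forall>(0 \<^bold>\<in> d + 1 \<^bold>\<longleftrightarrow> \<^bold>\<exists>(related_fm (f + 2) 1 0))"

definition Extensionality :: fm where
  "Extensionality = \<^bold>\<forall>\<^bold>\<forall>(\<^bold>\<forall>(0 \<^bold>\<in> 2 \<^bold>\<longleftrightarrow> 0 \<^bold>\<in> 1) \<^bold>\<longrightarrow> 1 \<^bold>= 0)"

definition Foundation :: fm where
  "Foundation = \<^bold>\<forall>(\<^bold>\<exists>(0 \<^bold>\<in> 1) \<^bold>\<longrightarrow> \<^bold>\<exists>(0 \<^bold>\<in> 1 \<^bold>\<and> \<^bold>\<not>(\<^bold>\<exists>(0 \<^bold>\<in> 1 \<^bold>\<and> 0 \<^bold>\<in> 2))))"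

definition Pairing :: fm where
  "Pairing = \<^bold>\<forall>\<^bold>\<forall>\<^bold>\<exists>(upair_fm 0 2 1)"

definition Union :: fm where
  "Union = \<^bold>\<forall>\<^bold>\<exists>\<^bold>\<forall>(0 \<^bold>\<in> 1 \<^bold>\<longleftrightarrow> \<^bold>\<exists>(1 \<^bold>\<in> 0 \<^bold>\<and> 0 \<^bold>\<in> 3))"

definition Power_Set :: fm where
  "Power_Set = \<^bold>\<forall>\<^bold>\<exists>\<^bold>\<forall>(0 \<^bold>\<in> 1 \<^bold>\<longleftrightarrow> subset_fm 0 2)"

definition Infinity :: fm where
  "Infinity = \<^bold>\<exists>(inductive_fm 0)"

(* phi(x), with x at index 0 *)
definition Separation :: "fm \<Rightarrow> fm" where
  "Separation \<phi> = \<^bold>\<forall>\<^bold>\<exists>\<^bold>\<forall>(0 \<^bold>\<in> 1 \<^bold>\<longleftrightarrow> 0 \<^bold>\<in> 2 \<^bold>\<and> inst [0] 3 \<phi>)"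

(* phi(x, y), with x at index 0 and y at index 1 *)
definition Replacement :: "fm \<Rightarrow> fm" where
  "Replacement \<phi> =
     \<^bold>\<forall>\<^bold>\<forall>\<^bold>\<forall>(inst [2, 1] 3 \<phi> \<^bold>\<and> inst [2, 0] 3 \<phi> \<^bold>\<longrightarrow> 1 \<^bold>= 0) \<^bold>\<longrightarrow>
     \<^bold>\<forall>\<^bold>\<exists>\<^bold>\<forall>(0 \<^bold>\<in> 1 \<^bold>\<longleftrightarrow> \<^bold>\<exists>(0 \<^bold>\<in> 3 \<^bold>\<and> inst [0, 1] 4 \<phi>))"

definition ZF :: "fm set" where
  "ZF = {Extensionality, Foundation, Pairing, Union, Power_Set, Infinity} \<union>
     (\<Union>\<phi>\<in>in_lang. closures (Separation \<phi>)) \<union> (\<Union>\<phi>\<in>in_lang. closures (Replacement \<phi>))"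

(* The last conjunct says: s(n) is related to s(n + 1) by R, for all natural numbers n. *)
definition ADC :: fm where
  "ADC = \<^bold>\<forall>\<^bold>\<forall>(relation_on_fm 0 1 \<^bold>\<and> \<^bold>\<forall>(0 \<^bold>\<in> 2 \<^bold>\<longrightarrow> \<^bold>\<exists>(0 \<^bold>\<in> 3 \<^bold>\<and> related_fm 2 1 0)) \<^bold>\<longrightarrow>
     \<^bold>\<forall>(0 \<^bold>\<in> 2 \<^bold>\<longrightarrow> \<^bold>\<forall>(Nat_fm 0 \<^bold>\<longrightarrow>
       \<^bold>\<exists>(function_fm 0 \<^bold>\<and> domain_fm 0 1 \<^bold>\<and>
          \<^bold>\<exists>(empty_fm 0 \<^bold>\<and> related_fm 1 0 3) \<^bold>\<and>
          \<^bold>\<forall>(0 \<^bold>\<in> 2 \<^bold>\<longrightarrow>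
             \<^bold>\<exists>\<^bold>\<exists>\<^bold>\<exists>(succ_fm 2 3 \<^bold>\<and> related_fm 4 3 1 \<^bold>\<and> related_fm 4 2 0 \<^bold>\<and>
                    related_fm 7 1 0))))))"

definition ZFc :: "fm set" where
  "ZFc = insert ADC ZF"

(* phi(x), with x at index 0 *)
definition Transfer :: "fm \<Rightarrow> fm" where
  "Transfer \<phi> = \<^bold>\<forall>\<^sup>s\<^sup>t\<phi> \<^bold>\<longrightarrow> \<^bold>\<forall>\<phi>"

definition Nontriviality :: fm where
  "Nontriviality = \<^bold>\<forall>(Nat_fm 0 \<^bold>\<longrightarrow> \<^bold>\<exists>(0 \<^bold>\<in> 1 \<^bold>\<and> \<^bold>\<forall>\<^sup>s\<^sup>t(0 \<^bold>\<in> 2 \<^bold>\<longrightarrow> \<^bold>\<not>(0 \<^bold>= 1))))"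

definition Standard_Part :: fm where
  "Standard_Part = \<^bold>\<forall>(Nat_fm 0 \<^bold>\<longrightarrow> \<^bold>\<forall>(subset_fm 0 1 \<^bold>\<longrightarrow>
     \<^bold>\<exists>\<^sup>s\<^sup>t(subset_fm 0 2 \<^bold>\<and> \<^bold>\<forall>\<^sup>s\<^sup>t(0 \<^bold>\<in> 3 \<^bold>\<longrightarrow> (0 \<^bold>\<in> 1 \<^bold>\<longleftrightarrow> 0 \<^bold>\<in> 2)))))"

definition SPOT :: "fm set" where
  "SPOT = ZF \<union> (\<Union>\<phi>\<in>in_lang. closures_st (Transfer \<phi>)) \<union> {Nontriviality, Standard_Part}"

(* phi(x), with x at index 0 *)
definition SN :: "fm \<Rightarrow> fm" where
  "SN \<phi> = \<^bold>\<forall>\<^sup>s\<^sup>t\<^bold>\<exists>\<^sup>s\<^sup>t\<^bold>\<forall>\<^sup>s\<^sup>t(0 \<^bold>\<in> 1 \<^bold>\<longleftrightarrow> 0 \<^bold>\<in> 2 \<^bold>\<and> \<phi>)"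

(* phi(n, x), with n at index 0 and x at index 1 *)
definition CC :: "fm \<Rightarrow> fm" where
  "CC \<phi> = \<^bold>\<forall>(Nat_fm 0 \<^bold>\<longrightarrow> \<^bold>\<forall>\<^sup>s\<^sup>t(0 \<^bold>\<in> 1 \<^bold>\<longrightarrow> \<^bold>\<exists>(inst [1, 0] 3 \<phi>)) \<^bold>\<longrightarrow>
     \<^bold>\<exists>(function_fm 0 \<^bold>\<and>
        \<^bold>\<forall>\<^sup>s\<^sup>t(0 \<^bold>\<in> 2 \<^bold>\<longrightarrow> \<^bold>\<exists>(related_fm 2 1 0 \<^bold>\<and> inst [1, 0] 4 \<phi>))))"

definition SCOT :: "fm set" where
  "SCOT = SPOT \<union> {ADC} \<union> {SN \<phi> | \<phi>. \<phi> \<in> st_in_lang \<and> fv \<phi> \<subseteq> {0}} \<union>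
     (\<Union>\<phi>\<in>st_in_lang. closures (CC \<phi>))"

(* T is a theory in the st-\<in>-language, S a theory in the \<in>-language. *)
definition conservative_extension :: "fm set \<Rightarrow> fm set \<Rightarrow> bool" where
  "conservative_extension T S \<longleftrightarrow>
     (\<forall>\<theta>. in_formula \<theta> \<and> sentence \<theta> \<longrightarrow>
        (provable in_lang S \<theta> \<longrightarrow> provable st_in_lang T \<theta>) \<and>
        (provable st_in_lang T \<theta> \<longrightarrow> provable in_lang S \<theta>))"

end

theory Submission
  imports Defs "HOL-Library.Countable" "HOL-Library.Infinite_Set"
begin

text \<open>
  Suppose that \<open>ZFc\<close> does not prove \<open>\<theta>\<close>. By completeness it has a model of \<open>\<not>\<theta>\<close>. Inside that
  model we force with the unbounded subsets of \<open>\<omega>\<close>. The generic object is an ultrafilter on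
  \<open>\<omega>\<close>, and the structure that is forced to satisfy SCOT is the ultrapower of the model by this
  ultrafilter, with the constant functions as its standard elements. A name for an element of the
  ultrapower is simply a function on \<open>\<omega>\<close> in the model, so neither general names nor an actual
  generic filter are needed: forced formulas are closed under provability, and by the theorem of
  Los (which needs countable choice in the model) a condition forces an \<open>\<in>\<close>-formula iff the
  formula holds at all but boundedly many points of the condition. Hence Transfer and the axioms of
  \<open>ZFc\<close> are forced. Dependent choice yields a fusion property, by which the forcing decides
  countably many questions at once; this gives Standard Part and Countable Choice. Finally, \<open>\<omega>\<close>
  embeds into every condition by an increasing function, so all conditions force the same formulas
  about standard elements; this gives SN.
\<close>

subsection \<open>Renaming and semantics\<close>

text \<open>ZF with dependent choice need not have a nonprincipal ultrafilter on
  \<open>omega\<close>, and an arbitrary ultrafilter from outside the model would not do: Standard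
  Part and SN ask for sets of the model, so what holds in the ultrapower has to be definable there.
  Hence truth gives way to forcing, which is definable formula by formula. The unbounded sets are
  countably closed modulo bounded sets; this is the source of fusion, and the reason why no new
  subsets of \<open>omega\<close> appear. SN allows \<open>\<phi>\<close> no parameters, and this is
  what homogeneity tolerates: moving one condition onto another changes general names but fixes
  constant ones. With dependent choice alone, selections must be made from a set, while names form a
  proper class. Hence a collection principle is required; it is derived from replacement by way of a
  cumulative hierarchy. Seen from outside, the countermodel may be ill-founded, so inductions and
  set formations inside it must be accompanied by proofs of definability. The calculus of
  \<open>dfn\<close> and \<open>dft\<close> makes these proofs routine.\<close>

text \<open>The clause for \<open>St\<close> is a dummy: only \<open>\<in>\<close>-formulas are interpreted in the model.\<close>

primrec sat :: "('a \<Rightarrow> 'a \<Rightarrow> bool) \<Rightarrow> (nat \<Rightarrow> 'a) \<Rightarrow> fm \<Rightarrow> bool" where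
  "sat E e (x \<^bold>= y) = (e x = e y)"
| "sat E e (x \<^bold>\<in> y) = E (e x) (e y)"
| "sat E e (St x) = True"
| "sat E e \<^bold>\<bottom> = False"
| "sat E e (\<phi> \<^bold>\<longrightarrow> \<psi>) = (sat E e \<phi> \<longrightarrow> sat E e \<psi>)"
| "sat E e (\<^bold>\<forall>\<phi>) = (\<forall>a. sat E (case_nat a e) \<phi>)"

lemma sat_rename: "sat E e (rename f \<phi>) = sat E (\<lambda>i. e (f i)) \<phi>"
proof (induction \<phi> arbitrary: e f)
  case (Forall \<phi>)
  have "(\<lambda>i. case_nat a e (case_nat 0 (\<lambda>k. Suc (f k)) i)) = case_nat a (\<lambda>i. e (f i))" for a
    by (auto simp: fun_eq_iff split: nat.split)
  then show ?case
    by (simp add: Forall)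
qed auto

lemma rename_rename: "rename f (rename g \<phi>) = rename (\<lambda>i. f (g i)) \<phi>"
proof (induction \<phi> arbitrary: f g)
  case (Forall \<phi>)
  have "(\<lambda>i. case_nat 0 (\<lambda>k. Suc (f k)) (case_nat 0 (\<lambda>k. Suc (g k)) i)) =
      case_nat 0 (\<lambda>k. Suc (f (g k)))"
    by (auto simp: fun_eq_iff split: nat.split)
  then show ?case
    by (simp add: Forall)
qed auto

lemma rename_cong: "(\<And>i. i \<in> fv \<phi> \<Longrightarrow> f i = g i) \<Longrightarrow> rename f \<phi> = rename g \<phi>"
proof (induction \<phi> arbitrary: f g)
  case (Imp \<phi> \<psi>)
  have "rename f \<phi> = rename g \<phi>" "rename f \<psi> = rename g \<psi>"
    by (rule Imp.IH, simp add: Imp.prems)+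
  then show ?case
    by simp
next
  case (Forall \<phi>)
  have "rename (case_nat 0 (\<lambda>k. Suc (f k))) \<phi> = rename (case_nat 0 (\<lambda>k. Suc (g k))) \<phi>"
    by (rule Forall.IH) (use Forall.prems in \<open>auto split: nat.split\<close>)
  then show ?case
    by simp
qed auto

lemma rename_id: "rename (\<lambda>i. i) \<phi> = \<phi>"
proof (induction \<phi>)
  case (Forall \<phi>)
  have "rename (case_nat 0 Suc) \<phi> = rename (\<lambda>i. i) \<phi>"
    by (rule rename_cong) (simp split: nat.split)
  with Forall show ?case
    by simp
qed simp_all

lemma in_formula_rename [simp]: "in_formula (rename f \<phi>) = in_formula \<phi>"
  by (induction \<phi> arbitrary: f) auto

lemma finite_fv: "finite (fv \<phi>)"
proof (induction \<phi>)
  case (Forall \<phi>)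
  have "fv (\<^bold>\<forall>\<phi>) = Suc -` fv \<phi>"
    by auto
  then show ?case
    using finite_vimageI[OF Forall, of Suc] by simp
qed auto

lemma inst_Nil: "inst [] d = rename (\<lambda>i. i + d)"
  by (simp add: inst_def)

lemma inst_single: "inst [x] 0 = rename (case_nat x (\<lambda>i. i))"
proof -
  have "(\<lambda>i. if i < length [x] then [x] ! i else i - length [x] + 0) = case_nat x (\<lambda>i. i)"
    by (auto simp: fun_eq_iff split: nat.split)
  then show ?thesis
    unfolding inst_def by (rule arg_cong)
qed

lemma in_formula_inst [simp]: "in_formula (inst xs d \<phi>) = in_formula \<phi>"
  by (simp add: inst_def)

lemma inst_rename: "inst [f x] 0 (rename (case_nat 0 (\<lambda>k. Suc (f k))) \<phi>) = rename f (inst [x] 0 \<phi>)"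
  unfolding inst_single rename_rename by (rule rename_cong) (simp split: nat.split)

lemma rename_sentence: "sentence \<phi> \<Longrightarrow> rename f \<phi> = \<phi>"
  using rename_cong[of \<phi> f "\<lambda>i. i"] by (simp add: sentence_def rename_id)

lemma fv_Forall_funpow: "fv ((Forall ^^ n) \<phi>) = {k. k + n \<in> fv \<phi>}"
  by (induction n) auto

lemma ex_closure: "\<exists>n. sentence ((Forall ^^ n) \<phi>)"
proof -
  obtain n where "\<forall>k\<in>fv \<phi>. k < n"
    using finite_nat_set_iff_bounded finite_fv by blast
  then have "sentence ((Forall ^^ n) \<phi>)"
    by (force simp: sentence_def fv_Forall_funpow)
  then show ?thesis ..
qed

text \<open>Validity at all assignments is compared, because a quantifier shifts the assignment.
  Hence a closure among the axioms makes the scheme instance true for every choice of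
  parameters.\<close>

lemma sat_Forall_funpow: "(\<forall>e. sat E e ((Forall ^^ n) \<phi>)) \<longleftrightarrow> (\<forall>e. sat E e \<phi>)"
proof (induction n arbitrary: \<phi>)
  case (Suc n)
  have "(\<forall>e. sat E e (\<^bold>\<forall>\<phi>)) \<longleftrightarrow> (\<forall>e. sat E e \<phi>)"
  proof safe
    fix e assume "\<forall>e. sat E e (\<^bold>\<forall>\<phi>)"
    then have "sat E (case_nat (e 0) (\<lambda>i. e (Suc i))) \<phi>"
      by simp
    moreover have "case_nat (e 0) (\<lambda>i. e (Suc i)) = e"
      by (rule ext, rename_tac i, case_tac i) auto
    ultimately show "sat E e \<phi>"
      by simp
  qed simp
  then show ?case
    using Suc[of "\<^bold>\<forall>\<phi>"] by (simp add: funpow_swap1)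
qed simp

subsection \<open>Provability\<close>

lemma provable_mono: "provable L G \<phi> \<Longrightarrow> G \<subseteq> G' \<Longrightarrow> L \<subseteq> L' \<Longrightarrow> provable L' G' \<phi>"
proof (induction arbitrary: G' rule: provable.induct)
  case (Assm \<phi> G)
  then show ?case
    by (meson provable.Assm subsetD)
next
  case (ImpI \<phi> G \<psi>)
  show ?case
    by (rule provable.ImpI, use ImpI in blast) (rule ImpI.IH; use ImpI.prems in blast)
next
  case (ImpE G \<phi> \<psi>)
  show ?case
    by (rule provable.ImpE[OF ImpE.IH]) (rule ImpE.prems)+
next
  case (Contr \<phi> G)
  show ?case
    by (rule provable.Contr, use Contr in blast) (rule Contr.IH; use Contr.prems in blast)
next
  case (AllI G \<phi>)
  show ?case
    by (rule provable.AllI, rule AllI.IH; use AllI.prems in blast)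
next
  case (AllE G \<phi> x)
  show ?case
    by (rule provable.AllE[OF AllE.IH]) (rule AllE.prems)+
next
  case (EqRefl x G)
  then show ?case
    by (meson provable.EqRefl subsetD)
next
  case (EqSubst G x y \<phi>)
  show ?case
    by (rule provable.EqSubst[OF EqSubst.IH]) (rule EqSubst.prems)+
qed

lemma provable_in_formula: "provable in_lang G \<phi> \<Longrightarrow> in_formula \<phi>"
  by (induction rule: provable.induct) (auto simp: in_lang_def)

text \<open>Stated for \<open>in_lang\<close>, which is closed under renaming; an arbitrary language
  need not contain the renamed formulas of a derivation.\<close>

lemma provable_rename: "provable in_lang G \<phi> \<Longrightarrow> provable in_lang (rename f ` G) (rename f \<phi>)"
proof (induction arbitrary: f rule: provable.induct)
  case (Assm \<phi> G)
  then show ?case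
    by (simp add: provable.Assm in_lang_def)
next
  case (ImpI \<phi> G \<psi>)
  then have "provable in_lang (rename f ` G) (rename f \<phi> \<^bold>\<longrightarrow> rename f \<psi>)"
    by (intro provable.ImpI) (auto simp: in_lang_def)
  then show ?case
    by simp
next
  case (ImpE G \<phi> \<psi>)
  then show ?case
    by (metis provable.ImpE rename.simps(5))
next
  case (Contr \<phi> G)
  then show ?case
    by (intro provable.Contr[of "rename f \<phi>"]) (auto simp: in_lang_def)
next
  case (AllI G \<phi>)
  have "rename (case_nat 0 (\<lambda>k. Suc (f k))) ` inst [] 1 ` G = inst [] 1 ` rename f ` G"
    by (simp add: image_image inst_Nil rename_rename)
  with AllI.IH[of "case_nat 0 (\<lambda>k. Suc (f k))"] show ?case
    by (simp add: provable.AllI)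
next
  case (AllE G \<phi> x)
  then show ?case
    by (metis inst_rename provable.AllE rename.simps(6))
next
  case (EqRefl x G)
  then show ?case
    by (simp add: provable.EqRefl in_lang_def)
next
  case (EqSubst G x y \<phi>)
  then show ?case
    by (metis inst_rename provable.EqSubst rename.simps(1))
qed

lemma provable_compact: "provable L G \<phi> \<Longrightarrow> \<exists>F\<subseteq>G. finite F \<and> provable L F \<phi>"
proof (induction rule: provable.induct)
  case (Assm \<phi> G)
  then show ?case
    by (intro exI[of _ "{\<phi>}"]) (simp add: provable.Assm)
next
  case (ImpI \<phi> G \<psi>)
  then obtain F where F: "F \<subseteq> insert \<phi> G" "finite F" "provable L F \<psi>"
    by blast
  then have "provable L (insert \<phi> (F - {\<phi>})) \<psi>"
    by (elim provable_mono) auto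
  with ImpI F show ?case
    by (intro exI[of _ "F - {\<phi>}"]) (auto intro!: provable.ImpI)
next
  case (ImpE G \<phi> \<psi>)
  then obtain F F' where F: "F \<subseteq> G" "finite F" "provable L F (\<phi> \<^bold>\<longrightarrow> \<psi>)"
      "F' \<subseteq> G" "finite F'" "provable L F' \<phi>"
    by blast
  have "provable L (F \<union> F') \<psi>"
    by (rule provable.ImpE[OF F(3,6)[THEN provable_mono]]) simp_all
  with F show ?case
    by (intro exI[of _ "F \<union> F'"]) simp
next
  case (Contr \<phi> G)
  then obtain F where F: "F \<subseteq> insert (\<^bold>\<not>\<phi>) G" "finite F" "provable L F \<^bold>\<bottom>"
    by blast
  then have "provable L (insert (\<^bold>\<not>\<phi>) (F - {\<^bold>\<not>\<phi>})) \<^bold>\<bottom>"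
    by (elim provable_mono) auto
  with Contr F show ?case
    by (intro exI[of _ "F - {\<^bold>\<not>\<phi>}"]) (use provable.Contr in blast)
next
  case (AllI G \<phi>)
  then obtain F where "F \<subseteq> inst [] 1 ` G" "finite F" "provable L F \<phi>"
    by blast
  then show ?case
    by (metis finite_subset_image provable.AllI)
next
  case (AllE G \<phi> x)
  then show ?case
    by (blast intro: provable.AllE)
next
  case (EqRefl x G)
  then show ?case
    by (blast intro: provable.EqRefl)
next
  case (EqSubst G x y \<phi>)
  then obtain F F' where F: "F \<subseteq> G" "finite F" "provable L F (x \<^bold>= y)"
      "F' \<subseteq> G" "finite F'" "provable L F' (inst [x] 0 \<phi>)"
    by blast
  have "provable L (F \<union> F') (inst [y] 0 \<phi>)"
    by (rule provable.EqSubst[OF F(3,6)[THEN provable_mono]]) simp_all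
  with F show ?case
    by (intro exI[of _ "F \<union> F'"]) simp
qed

text \<open>\<open>AllI\<close> generalizes over index 0 after a shift of the hypotheses, whereas
  Henkin witnesses are ordinary variables. The renaming \<open>f\<close> sends \<open>x\<close> to 0
  and moves all other variables up, so it acts on \<open>G\<close> like the shift and undoes the
  substitution of \<open>x\<close>.\<close>

lemma provable_AllI_fresh:
  assumes "provable in_lang G (inst [x] 0 \<phi>)"
    and G: "\<And>\<psi>. \<psi> \<in> G \<Longrightarrow> x \<notin> fv \<psi>" and \<phi>: "x \<notin> fv (\<^bold>\<forall>\<phi>)"
  shows "provable in_lang G (\<^bold>\<forall>\<phi>)"
proof (rule provable.AllI)
  define f where "f i = (if i = x then 0 else Suc i)" for i
  have "rename f \<psi> = inst [] 1 \<psi>" if "\<psi> \<in> G" for \<psi>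
    using G[OF that] unfolding inst_Nil by (intro rename_cong) (auto simp: f_def)
  then have "rename f ` G = inst [] 1 ` G"
    by simp
  moreover have "rename f (inst [x] 0 \<phi>) = rename (\<lambda>i. i) \<phi>"
    unfolding inst_single rename_rename
    by (rule rename_cong) (use \<phi> in \<open>auto simp: f_def split: nat.split\<close>)
  ultimately show "provable in_lang (inst [] 1 ` G) \<phi>"
    using provable_rename[OF assms(1), of f] by (simp add: rename_id)
qed

lemma provable_cut:
  "in_formula \<phi> \<Longrightarrow> provable in_lang (insert \<phi> G) \<psi> \<Longrightarrow> provable in_lang G \<phi> \<Longrightarrow> provable in_lang G \<psi>"
  by (metis in_lang_def mem_Collect_eq provable.ImpE provable.ImpI)

subsection \<open>Henkin sets and completeness\<close>

instance fm :: countable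
  by countable_datatype

text \<open>The variables themselves serve as Henkin constants, so the language stays the same.
  Since the only primitive quantifier is universal, the formulas that ask for a witness are the
  negated universal ones.\<close>

fun witness :: "fm \<Rightarrow> nat \<Rightarrow> fm set" where
  "witness ((\<^bold>\<forall>\<phi>) \<^bold>\<longrightarrow> \<^bold>\<bottom>) x = {\<^bold>\<not>(inst [x] 0 \<phi>)}"
| "witness \<phi> x = {}"

text \<open>By \<open>Contr\<close> and freshness of \<open>x\<close>, a contradiction from the
  witness would prove the universal formula that \<open>\<phi>\<close> negates.\<close>

lemma consistent_witness:
  assumes "\<not> provable in_lang (insert \<phi> G) \<^bold>\<bottom>" "in_formula \<phi>"
    and "\<And>\<psi>. \<psi> \<in> G \<Longrightarrow> x \<notin> fv \<psi>" "x \<notin> fv \<phi>"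
  shows "\<not> provable in_lang (insert \<phi> G \<union> witness \<phi> x) \<^bold>\<bottom>"
proof (cases "(\<phi>, x)" rule: witness.cases)
  case (1 \<psi> y)
  then have \<phi>: "\<phi> = \<^bold>\<not>(\<^bold>\<forall>\<psi>)" "y = x"
    by auto
  show ?thesis
  proof
    assume "provable in_lang (insert \<phi> G \<union> witness \<phi> x) \<^bold>\<bottom>"
    then have "provable in_lang (insert (\<^bold>\<not>(inst [x] 0 \<psi>)) (insert \<phi> G)) \<^bold>\<bottom>"
      using \<phi> by (simp add: insert_commute)
    then have "provable in_lang (insert \<phi> G) (inst [x] 0 \<psi>)"
      using assms(2) \<phi> by (intro provable.Contr[of "inst [x] 0 \<psi>"]) (simp_all add: in_lang_def)
    then have "provable in_lang (insert \<phi> G) (\<^bold>\<forall>\<psi>)"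
      by (rule provable_AllI_fresh) (use assms \<phi> in auto)
    moreover have "provable in_lang (insert \<phi> G) (\<^bold>\<not>(\<^bold>\<forall>\<psi>))"
      using assms(2) \<phi> by (auto intro: provable.Assm simp: in_lang_def)
    ultimately show False
      using assms(1) by (blast intro: provable.ImpE)
  qed
qed (use assms in auto)

context
  fixes T :: "fm set"
  assumes T_in: "T \<subseteq> in_lang" and T_sentence: "\<And>\<phi>. \<phi> \<in> T \<Longrightarrow> sentence \<phi>"
    and T_cons: "\<not> provable in_lang T \<^bold>\<bottom>"
begin

text \<open>\<open>T\<close> consists of sentences and \<open>S\<close> is finite, so a variable
  fresh for all of \<open>T \<union> S\<close> exists although \<open>T\<close> may be infinite. An
  inconsistent \<open>\<phi>\<close> is skipped; its negation is then derivable anyway.\<close>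

definition henkin_step :: "fm set \<Rightarrow> fm \<Rightarrow> fm set" where
  "henkin_step S \<phi> =
     (if in_formula \<phi> \<and> \<not> provable in_lang (insert \<phi> (T \<union> S)) \<^bold>\<bottom>
      then insert \<phi> S \<union> witness \<phi> (SOME x. x \<notin> \<Union> (fv ` insert \<phi> S)) else S)"

lemma finite_henkin_step: "finite S \<Longrightarrow> finite (henkin_step S \<phi>)"
proof -
  have "finite (witness \<phi> x)" for \<phi> x
    by (induction \<phi> x rule: witness.induct) auto
  then show "finite S \<Longrightarrow> finite (henkin_step S \<phi>)"
    by (simp add: henkin_step_def)
qed

lemma subset_henkin_step: "S \<subseteq> henkin_step S \<phi>"
  by (auto simp: henkin_step_def)

lemma henkin_step_witness:
  "in_formula \<phi> \<Longrightarrow> \<not> provable in_lang (insert \<phi> (T \<union> S)) \<^bold>\<bottom> \<Longrightarrow>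
    \<exists>x. insert \<phi> S \<union> witness \<phi> x \<subseteq> henkin_step S \<phi>"
  unfolding henkin_step_def by (subst if_P) (blast, rule exI, rule order_refl)

lemma consistent_henkin_step:
  assumes "finite S" "\<not> provable in_lang (T \<union> S) \<^bold>\<bottom>"
  shows "\<not> provable in_lang (T \<union> henkin_step S \<phi>) \<^bold>\<bottom>"
proof (cases "in_formula \<phi> \<and> \<not> provable in_lang (insert \<phi> (T \<union> S)) \<^bold>\<bottom>")
  case True
  define x where "x = (SOME x. x \<notin> \<Union> (fv ` insert \<phi> S))"
  have "finite (\<Union> (fv ` insert \<phi> S))"
    using assms(1) finite_fv by blast
  then have "\<exists>x. x \<notin> \<Union> (fv ` insert \<phi> S)"
    by (rule ex_new_if_finite[OF infinite_UNIV_nat])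
  then have x: "x \<notin> \<Union> (fv ` insert \<phi> S)"
    unfolding x_def by (rule someI_ex)
  have "\<not> provable in_lang (insert \<phi> (T \<union> S) \<union> witness \<phi> x) \<^bold>\<bottom>"
    by (rule consistent_witness) (use True x T_sentence in \<open>auto simp: sentence_def\<close>)
  moreover have "T \<union> henkin_step S \<phi> = insert \<phi> (T \<union> S) \<union> witness \<phi> x"
    using True by (simp add: henkin_step_def x_def Un_assoc)
  ultimately show ?thesis
    by simp
next
  case False
  then have "henkin_step S \<phi> = S"
    unfolding henkin_step_def by (rule if_not_P)
  with assms show ?thesis
    by simp
qed

primrec henkin_stage :: "nat \<Rightarrow> fm set" where
  "henkin_stage 0 = {}"
| "henkin_stage (Suc n) = henkin_step (henkin_stage n) (from_nat n)"

lemma finite_henkin_stage: "finite (henkin_stage n)"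
  by (induction n) (simp_all add: finite_henkin_step)

lemma consistent_henkin_stage: "\<not> provable in_lang (T \<union> henkin_stage n) \<^bold>\<bottom>"
  by (induction n) (simp_all add: T_cons consistent_henkin_step finite_henkin_stage)

lemma henkin_stage_mono: "m \<le> n \<Longrightarrow> henkin_stage m \<subseteq> henkin_stage n"
  by (rule lift_Suc_mono_le[of henkin_stage]) (simp add: subset_henkin_step)

definition henkin_set :: "fm set" where
  "henkin_set = T \<union> (\<Union>n. henkin_stage n)"

lemma consistent_henkin_set: "\<not> provable in_lang henkin_set \<^bold>\<bottom>"
proof
  assume "provable in_lang henkin_set \<^bold>\<bottom>"
  from provable_compact[OF this]
  obtain F where F: "F \<subseteq> henkin_set" "finite F" "provable in_lang F \<^bold>\<bottom>"
    by blast
  have "\<exists>n. F \<subseteq> T \<union> henkin_stage n"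
    using F(2,1)
  proof (induction F)
    case (insert \<phi> F)
    then obtain m where "F \<subseteq> T \<union> henkin_stage m"
      by blast
    moreover obtain n where "\<phi> \<in> T \<union> henkin_stage n"
      using insert.prems unfolding henkin_set_def by blast
    ultimately have "insert \<phi> F \<subseteq> T \<union> henkin_stage (max m n)"
      using henkin_stage_mono[of m "max m n", OF max.cobounded1]
        henkin_stage_mono[of n "max m n", OF max.cobounded2] by blast
    then show ?case ..
  qed simp
  then obtain n where "F \<subseteq> T \<union> henkin_stage n" ..
  from provable_mono[OF F(3) this subset_refl] consistent_henkin_stage show False
    by blast
qed

text \<open>A formula consistent with the whole set is consistent with the stage at which it is
  enumerated, so it was added there together with its witness.\<close>

lemma in_henkin_set:
  assumes "in_formula \<phi>" "\<not> provable in_lang (insert \<phi> henkin_set) \<^bold>\<bottom>"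
  shows "\<phi> \<in> henkin_set \<and> (\<exists>x. witness \<phi> x \<subseteq> henkin_set)"
proof -
  let ?S = "henkin_stage (to_nat \<phi>)"
  have "insert \<phi> (T \<union> ?S) \<subseteq> insert \<phi> henkin_set"
    by (auto simp: henkin_set_def)
  then have "\<not> provable in_lang (insert \<phi> (T \<union> ?S)) \<^bold>\<bottom>"
    using assms(2) provable_mono[OF _ _ subset_refl] by metis
  then obtain x where "insert \<phi> ?S \<union> witness \<phi> x \<subseteq> henkin_step ?S \<phi>"
    using henkin_step_witness[OF assms(1)] by blast
  moreover have "henkin_step ?S \<phi> = henkin_stage (Suc (to_nat \<phi>))"
    by simp
  moreover have "henkin_stage n \<subseteq> henkin_set" for n
    unfolding henkin_set_def by blast
  ultimately have "insert \<phi> ?S \<union> witness \<phi> x \<subseteq> henkin_set"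
    by (metis order_trans)
  then show ?thesis
    by blast
qed

lemma henkin_set_provable: "provable in_lang henkin_set \<phi> \<Longrightarrow> \<phi> \<in> henkin_set"
  using in_henkin_set provable_in_formula provable_cut consistent_henkin_set by blast

lemma provable_henkin_set: "\<phi> \<in> henkin_set \<Longrightarrow> in_formula \<phi> \<Longrightarrow> provable in_lang henkin_set \<phi>"
  by (simp add: provable.Assm in_lang_def)

lemma henkin_set_Fls: "\<^bold>\<bottom> \<notin> henkin_set"
  using provable_henkin_set consistent_henkin_set by fastforce

lemma henkin_set_Neg:
  assumes "in_formula \<phi>"
  shows "\<^bold>\<not>\<phi> \<in> henkin_set \<longleftrightarrow> \<phi> \<notin> henkin_set"
proof
  assume "\<^bold>\<not>\<phi> \<in> henkin_set"
  then show "\<phi> \<notin> henkin_set"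
    using assms provable_henkin_set consistent_henkin_set provable.ImpE
    by (metis in_formula.simps(4) in_formula.simps(5))
next
  assume "\<phi> \<notin> henkin_set"
  then have "provable in_lang (insert \<phi> henkin_set) \<^bold>\<bottom>"
    using in_henkin_set assms by blast
  then show "\<^bold>\<not>\<phi> \<in> henkin_set"
    using assms by (intro henkin_set_provable provable.ImpI) (auto simp: in_lang_def)
qed

lemma henkin_set_Imp:
  assumes "in_formula \<phi>" "in_formula \<psi>"
  shows "(\<phi> \<^bold>\<longrightarrow> \<psi>) \<in> henkin_set \<longleftrightarrow> (\<phi> \<in> henkin_set \<longrightarrow> \<psi> \<in> henkin_set)"
proof safe
  assume "(\<phi> \<^bold>\<longrightarrow> \<psi>) \<in> henkin_set" "\<phi> \<in> henkin_set"
  then show "\<psi> \<in> henkin_set"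
    using assms by (meson henkin_set_provable in_formula.simps(5) provable.ImpE provable_henkin_set)
next
  assume "\<phi> \<notin> henkin_set"
  then have "provable in_lang (insert \<phi> henkin_set) \<^bold>\<bottom>"
    using in_henkin_set assms by blast
  then have "provable in_lang (insert (\<^bold>\<not>\<psi>) (insert \<phi> henkin_set)) \<^bold>\<bottom>"
    by (rule provable_mono) auto
  then show "(\<phi> \<^bold>\<longrightarrow> \<psi>) \<in> henkin_set"
    using assms
    by (intro henkin_set_provable provable.ImpI provable.Contr[of \<psi>]) (auto simp: in_lang_def)
next
  assume "\<psi> \<in> henkin_set"
  then show "(\<phi> \<^bold>\<longrightarrow> \<psi>) \<in> henkin_set"
    using assms by (intro henkin_set_provable provable.ImpI provable.Assm) (auto simp: in_lang_def)
qed

lemma henkin_set_Forall: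
  assumes "in_formula \<phi>"
  shows "\<^bold>\<forall>\<phi> \<in> henkin_set \<longleftrightarrow> (\<forall>x. inst [x] 0 \<phi> \<in> henkin_set)"
proof
  assume "\<^bold>\<forall>\<phi> \<in> henkin_set"
  then show "\<forall>x. inst [x] 0 \<phi> \<in> henkin_set"
    using assms by (meson henkin_set_provable in_formula.simps(6) provable.AllE provable_henkin_set)
next
  assume *: "\<forall>x. inst [x] 0 \<phi> \<in> henkin_set"
  show "\<^bold>\<forall>\<phi> \<in> henkin_set"
  proof (rule ccontr)
    assume "\<^bold>\<forall>\<phi> \<notin> henkin_set"
    then have "\<^bold>\<not>(\<^bold>\<forall>\<phi>) \<in> henkin_set"
      using assms henkin_set_Neg by simp
    then have "\<not> provable in_lang (insert (\<^bold>\<not>(\<^bold>\<forall>\<phi>)) henkin_set) \<^bold>\<bottom>"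
      using consistent_henkin_set by (simp add: insert_absorb)
    then obtain x where "\<^bold>\<not>(inst [x] 0 \<phi>) \<in> henkin_set"
      using in_henkin_set[of "\<^bold>\<not>(\<^bold>\<forall>\<phi>)"] assms by auto
    then show False
      using * assms henkin_set_Neg by simp
  qed
qed

section \<open>The term model, its equality and its representatives\<close>

definition hsat :: "(nat \<Rightarrow> nat) \<Rightarrow> fm \<Rightarrow> bool" where
  "hsat e \<phi> \<longleftrightarrow> rename e \<phi> \<in> henkin_set"

abbreviation heq :: "nat \<Rightarrow> nat \<Rightarrow> bool" where
  "heq x y \<equiv> (x \<^bold>= y) \<in> henkin_set"

abbreviation hmem :: "nat \<Rightarrow> nat \<Rightarrow> bool" where
  "hmem x y \<equiv> (x \<^bold>\<in> y) \<in> henkin_set"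

text \<open>The truth lemma: \<open>hsat e\<close> obeys the clauses of satisfaction in a structure
  whose elements are the variables, with \<open>heq\<close> as equality and \<open>hmem\<close> as
  membership.\<close>

lemma hsat_simps [simp]:
  "hsat e (x \<^bold>= y) = heq (e x) (e y)"
  "hsat e (x \<^bold>\<in> y) = hmem (e x) (e y)"
  "hsat e \<^bold>\<bottom> = False"
  "in_formula \<phi> \<Longrightarrow> in_formula \<psi> \<Longrightarrow> hsat e (\<phi> \<^bold>\<longrightarrow> \<psi>) = (hsat e \<phi> \<longrightarrow> hsat e \<psi>)"
  "in_formula \<phi> \<Longrightarrow> hsat e (\<^bold>\<forall>\<phi>) = (\<forall>x. hsat (case_nat x e) \<phi>)"
proof -
  have "inst [x] 0 (rename (case_nat 0 (\<lambda>k. Suc (e k))) \<phi>) = rename (case_nat x e) \<phi>" for x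
    unfolding inst_single rename_rename by (rule rename_cong) (simp split: nat.split)
  then show "in_formula \<phi> \<Longrightarrow> hsat e (\<^bold>\<forall>\<phi>) = (\<forall>x. hsat (case_nat x e) \<phi>)"
    by (simp add: hsat_def henkin_set_Forall)
qed (auto simp: hsat_def henkin_set_Fls henkin_set_Imp)

lemma heq_subst:
  assumes "heq x y" "in_formula \<phi>" "inst [x] 0 \<phi> \<in> henkin_set"
  shows "inst [y] 0 \<phi> \<in> henkin_set"
  by (rule henkin_set_provable, rule provable.EqSubst[of _ _ x])
    (use assms in \<open>auto intro: provable_henkin_set\<close>)

lemma heq_refl: "heq x x"
  by (intro henkin_set_provable provable.EqRefl) (simp add: in_lang_def)

text \<open>In the template index 0 marks the place to be replaced, and \<open>Suc x\<close> becomes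
  \<open>x\<close> under the instantiation.\<close>

lemma heq_sym: "heq x y \<Longrightarrow> heq y x"
  using heq_subst[of x y "0 \<^bold>= Suc x"] heq_refl by (simp add: inst_single)

lemma heq_trans: "heq x y \<Longrightarrow> heq y z \<Longrightarrow> heq x z"
  using heq_subst[of y z "Suc x \<^bold>= 0"] by (simp add: inst_single)

lemma hmem_cong: "heq x x' \<Longrightarrow> heq y y' \<Longrightarrow> hmem x y = hmem x' y'"
proof -
  have *: "hmem u' v'" if "heq u u'" "heq v v'" "hmem u v" for u u' v v'
    using heq_subst[of u u' "0 \<^bold>\<in> Suc v"] heq_subst[of v v' "Suc u' \<^bold>\<in> 0"] that
    by (simp add: inst_single)
  show "heq x x' \<Longrightarrow> heq y y' \<Longrightarrow> hmem x y = hmem x' y'"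
    using *[of x x' y y'] *[of x' x y' y] heq_sym[of x x'] heq_sym[of y y'] by argo
qed

text \<open>Terms are numbers, so the least member of a class can represent it.\<close>

definition hrep :: "nat \<Rightarrow> nat" where
  "hrep x = (LEAST y. heq x y)"

lemma heq_hrep: "heq x (hrep x)"
  unfolding hrep_def by (rule LeastI) (rule heq_refl)

lemma hrep_eq_iff: "hrep x = hrep y \<longleftrightarrow> heq x y"
proof
  assume "heq x y"
  then have "heq x z \<longleftrightarrow> heq y z" for z
    using heq_sym heq_trans by blast
  then show "hrep x = hrep y"
    by (simp add: hrep_def)
next
  assume "hrep x = hrep y"
  then show "heq x y"
    using heq_hrep[of x] heq_hrep[of y] heq_sym heq_trans by metis
qed

lemma hrep_hrep: "hrep (hrep x) = hrep x"
  using heq_hrep[of x] by (simp add: hrep_eq_iff[symmetric])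

text \<open>
  A set of representatives that is infinite is in bijection with \<open>nat\<close>, which makes the model a
  structure on a whole type with true equality.
\<close>

lemma infinite_hrep:
  assumes "Pairing \<in> T" "Infinity \<in> T"
  shows "infinite (range hrep)"
proof
  assume fin: "finite (range hrep)"
  have "rename id Pairing \<in> henkin_set" "rename id Infinity \<in> henkin_set"
    using assms T_sentence by (auto simp: henkin_set_def rename_sentence)
  then have P: "hsat id Pairing" and I: "hsat id Infinity"
    by (simp_all add: hsat_def)
  from P have "\<forall>x. \<exists>z. \<forall>w. hmem w z \<longleftrightarrow> heq w x"
    by (simp add: Pairing_def upair_fm_def) blast
  then obtain s where s: "\<And>x w. hmem w (s x) \<longleftrightarrow> heq w x"
    by metis
  from I obtain o' where o': "\<And>y. \<not> hmem y o'"
    by (auto simp: Infinity_def empty_fm_def inductive_fm_def succ_fm_def)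
  \<comment> \<open>Forming singletons is injective on classes and misses the class of the empty set
    \<open>o'\<close>, which is impossible on a finite set.\<close>
  have "inj_on (\<lambda>x. hrep (s x)) (range hrep)"
  proof (rule inj_onI)
    fix x y assume xy: "x \<in> range hrep" "y \<in> range hrep" "hrep (s x) = hrep (s y)"
    then have "heq (s x) (s y)"
      by (simp add: hrep_eq_iff)
    from hmem_cong[OF heq_refl[of x] this] have "heq x y"
      by (simp add: s heq_refl)
    moreover have "hrep x = x" "hrep y = y"
      using xy(1,2) by (auto simp: hrep_hrep)
    ultimately show "x = y"
      using hrep_eq_iff[of x y] by simp
  qed
  then have "(\<lambda>x. hrep (s x)) ` range hrep = range hrep"
    by (intro endo_inj_surj fin) auto
  then obtain x where "hrep (s x) = hrep o'"
    by (metis imageE rangeI)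
  then have "heq (s x) o'"
    by (simp add: hrep_eq_iff)
  from hmem_cong[OF heq_refl[of x] this] show False
    by (simp add: s heq_refl o')
qed

lemma ex_model:
  assumes "Pairing \<in> T" "Infinity \<in> T"
  shows "\<exists>E :: nat \<Rightarrow> nat \<Rightarrow> bool. \<forall>\<phi>\<in>T. \<forall>e. sat E e \<phi>"
proof -
  obtain b :: "nat \<Rightarrow> nat" where b: "bij_betw b UNIV (range hrep)"
    using bij_enumerate[OF infinite_hrep[OF assms]] by blast
  have b_eq: "heq (b i) (b j) \<longleftrightarrow> i = j" for i j
  proof
    assume "heq (b i) (b j)"
    then have "hrep (b i) = hrep (b j)"
      by (simp add: hrep_eq_iff)
    moreover have "hrep (b k) = b k" for k
    proof -
      have "b k \<in> range hrep"
        using b by (auto simp: bij_betw_def)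
      then show ?thesis
        by (auto simp: hrep_hrep)
    qed
    ultimately show "i = j"
      using b by (auto simp: bij_betw_def inj_on_def)
  qed (simp add: heq_refl)
  have hsat_cong: "hsat e \<phi> = hsat e' \<phi>" if "in_formula \<phi>" "\<And>i. heq (e i) (e' i)" for e e' \<phi>
    using that
  proof (induction \<phi> arbitrary: e e')
    case (Eq x y)
    then show ?case
      by (simp add: hrep_eq_iff[symmetric])
  next
    case (Mem x y)
    then show ?case
      using hmem_cong[of "e x" "e' x" "e y" "e' y"] by simp
  next
    case (Imp \<phi> \<psi>)
    have "hsat e \<phi> = hsat e' \<phi>" "hsat e \<psi> = hsat e' \<psi>"
      by (rule Imp.IH; use Imp.prems in simp)+
    with Imp.prems show ?case
      by simp
  next
    case (Forall \<phi>)
    have "hsat (case_nat x e) \<phi> = hsat (case_nat x e') \<phi>" for x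
      by (rule Forall.IH) (use Forall.prems in \<open>auto simp: heq_refl split: nat.split\<close>)
    with Forall show ?case
      by simp
  qed (auto simp: hsat_def)
  define E where "E i j = hmem (b i) (b j)" for i j
  have "sat E e \<phi> = hsat (\<lambda>i. b (e i)) \<phi>" if "in_formula \<phi>" for e \<phi>
    using that
  proof (induction \<phi> arbitrary: e)
    case (Forall \<phi>)
    have cn: "(\<lambda>i. b (case_nat a e i)) = case_nat (b a) (\<lambda>i. b (e i))" for a
      by (auto simp: fun_eq_iff split: nat.split)
    \<comment> \<open>Quantifiers of \<open>hsat\<close> range over all terms, those of
      \<open>sat\<close> only over representatives; every term may be exchanged for its
      representative.\<close>
    have "\<exists>a. hsat (case_nat x (\<lambda>i. b (e i))) \<phi> = hsat (case_nat (b a) (\<lambda>i. b (e i))) \<phi>" for x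
    proof -
      have "hrep x \<in> range b"
        using b by (auto simp: bij_betw_def)
      then obtain a where a: "hrep x = b a"
        by auto
      have "hsat (case_nat x (\<lambda>i. b (e i))) \<phi> = hsat (case_nat (b a) (\<lambda>i. b (e i))) \<phi>"
        by (rule hsat_cong)
          (use Forall.prems heq_hrep[of x] a in \<open>auto simp: heq_refl split: nat.split\<close>)
      then show ?thesis ..
    qed
    with Forall show ?case
      by (simp add: cn) metis
  qed (auto simp: E_def b_eq)
  then have "sat E e \<phi>" if "\<phi> \<in> T" for e \<phi>
    using that T_in T_sentence by (auto simp: hsat_def in_lang_def rename_sentence henkin_set_def)
  then show ?thesis
    by blast
qed

end

section \<open>Completeness applied to \<open>ZFc\<close>\<close>

lemma sentence_closures: "\<psi> \<in> closures \<phi> \<Longrightarrow> sentence \<psi>"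
  by (auto simp: closures_def)

lemma in_formula_Forall_funpow [simp]: "in_formula ((Forall ^^ n) \<phi>) = in_formula \<phi>"
  by (induction n) auto

lemmas fm_defs = Extensionality_def Foundation_def Pairing_def Union_def Power_Set_def Infinity_def
  Separation_def Replacement_def ADC_def Nat_fm_def inductive_fm_def empty_fm_def succ_fm_def
  subset_fm_def relation_on_fm_def function_fm_def domain_fm_def related_fm_def opair_fm_def
  upair_fm_def

lemma in_formula_ZFc: "\<phi> \<in> ZFc \<Longrightarrow> in_formula \<phi>"
  by (auto simp: ZFc_def ZF_def closures_def in_lang_def fm_defs)

lemma sentence_ZFc:
  assumes "\<phi> \<in> ZFc" shows "sentence \<phi>"
proof -
  have "sentence \<phi>" if "\<phi> \<in> {Extensionality, Foundation, Pairing, Union, Power_Set, Infinity}"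
    using that by (auto simp: sentence_def fm_defs)
  moreover have "sentence ADC"
    unfolding sentence_def ADC_def Nat_fm_def inductive_fm_def empty_fm_def succ_fm_def
      subset_fm_def relation_on_fm_def function_fm_def domain_fm_def related_fm_def opair_fm_def
      upair_fm_def by auto
  ultimately show ?thesis
    using assms by (auto simp: ZFc_def ZF_def sentence_closures)
qed

theorem countermodel:
  assumes "in_formula \<theta>" "sentence \<theta>" "\<not> provable in_lang ZFc \<theta>"
  obtains E :: "nat \<Rightarrow> nat \<Rightarrow> bool"
    where "\<And>\<phi> e. \<phi> \<in> ZFc \<Longrightarrow> sat E e \<phi>" "\<And>e. \<not> sat E e \<theta>"
proof -
  have "\<not> provable in_lang (insert (\<^bold>\<not>\<theta>) ZFc) \<^bold>\<bottom>"
  proof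
    assume "provable in_lang (insert (\<^bold>\<not>\<theta>) ZFc) \<^bold>\<bottom>"
    from provable.Contr[OF _ this] assms(1,3) show False
      by (simp add: in_lang_def)
  qed
  moreover have "insert (\<^bold>\<not>\<theta>) ZFc \<subseteq> in_lang"
    using assms(1) in_formula_ZFc by (auto simp: in_lang_def)
  moreover have "sentence \<phi>" if "\<phi> \<in> insert (\<^bold>\<not>\<theta>) ZFc" for \<phi>
    using that assms(2) sentence_ZFc by (auto simp: sentence_def)
  moreover have "Pairing \<in> ZFc" "Infinity \<in> ZFc"
    by (simp_all add: ZFc_def ZF_def)
  ultimately have "\<exists>E :: nat \<Rightarrow> nat \<Rightarrow> bool. \<forall>\<phi>\<in>insert (\<^bold>\<not>\<theta>) ZFc. \<forall>e. sat E e \<phi>"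
    by (intro ex_model) simp_all
  then show ?thesis
    using that by auto
qed

subsection \<open>Definability in a model\<close>

locale ZFc_model =
  fixes mem :: "'a \<Rightarrow> 'a \<Rightarrow> bool"  (infix \<open>\<epsilon>\<close> 50)
  assumes ZFc: "\<phi> \<in> ZFc \<Longrightarrow> sat (\<epsilon>) e \<phi>"
begin

text \<open>
  A definition may use infinitely many parameters \<open>c\<close>. They are interleaved with the variables \<open>e\<close>,
  so that the parameters of two formulas can always be merged.
\<close>

definition params :: "(nat \<Rightarrow> 'a) \<Rightarrow> (nat \<Rightarrow> 'a) \<Rightarrow> nat \<Rightarrow> 'a" where
  "params e c i = (if even i then e (i div 2) else c (i div 2))"

lemma params_even: "params e c (2 * k) = e k"
  by (simp add: params_def)

lemma params_odd: "params e c (Suc (2 * k)) = c k"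
  by (simp add: params_def)

text \<open>Definability is stated for predicates of assignments instead of relations of a fixed
  arity: binding a variable then is a shift of the assignment, and the closure rules can be applied
  syntactically.\<close>

definition dfn :: "((nat \<Rightarrow> 'a) \<Rightarrow> bool) \<Rightarrow> bool" where
  "dfn P \<longleftrightarrow> (\<exists>\<phi> c. in_formula \<phi> \<and> (\<forall>e. P e \<longleftrightarrow> sat (\<epsilon>) (params e c) \<phi>))"

text \<open>The language has no function symbols, so a term counts as definable if its graph is,
  with the value at index 0.\<close>

definition dft :: "((nat \<Rightarrow> 'a) \<Rightarrow> 'a) \<Rightarrow> bool" where
  "dft t \<longleftrightarrow> dfn (\<lambda>e. e 0 = t (\<lambda>i. e (Suc i)))"

named_theorems dfn_intros

lemma dfn_rename: "dfn P \<Longrightarrow> dfn (\<lambda>e. P (\<lambda>i. e (f i)))"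
proof -
  assume "dfn P"
  then obtain \<phi> c where \<phi>: "in_formula \<phi>" "\<And>e. P e \<longleftrightarrow> sat (\<epsilon>) (params e c) \<phi>"
    unfolding dfn_def by blast
  have "params (\<lambda>i. e (f i)) c = (\<lambda>i. params e c (if even i then 2 * f (i div 2) else i))" for e
    by (auto simp: params_def)
  with \<phi> show "dfn (\<lambda>e. P (\<lambda>i. e (f i)))"
    unfolding dfn_def
    by (intro exI[of _ "rename (\<lambda>i. if even i then 2 * f (i div 2) else i) \<phi>"] exI[of _ c])
      (simp add: sat_rename)
qed

lemma dfn_const [dfn_intros]: "dfn (\<lambda>e. b)"
  unfolding dfn_def by (intro exI[of _ "if b then \<^bold>\<not>\<^bold>\<bottom> else \<^bold>\<bottom>"]) simp

lemma dfn_imp [dfn_intros]: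
  assumes "dfn P" "dfn Q"
  shows "dfn (\<lambda>e. P e \<longrightarrow> Q e)"
proof -
  obtain \<phi> c where \<phi>: "in_formula \<phi>" "\<And>e. P e \<longleftrightarrow> sat (\<epsilon>) (params e c) \<phi>"
    using assms(1) unfolding dfn_def by blast
  obtain \<psi> d where \<psi>: "in_formula \<psi>" "\<And>e. Q e \<longleftrightarrow> sat (\<epsilon>) (params e d) \<psi>"
    using assms(2) unfolding dfn_def by blast
  \<comment> \<open>\<open>params c d\<close> interleaves the two parameter sequences. Both
    renamings fix the variables; on parameters \<open>f\<close> selects the even places and
    \<open>g\<close> the odd ones.\<close>
  define f where "f i = (if even i then i else Suc (2 * (2 * (i div 2))))" for i :: nat
  define g where "g i = (if even i then i else Suc (2 * Suc (2 * (i div 2))))" for i :: nat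
  have "params e c i = params e (params c d) (f i) \<and> params e d i = params e (params c d) (g i)"
    for e i
  proof (cases "even i")
    case True
    then show ?thesis
      by (simp add: params_def f_def g_def)
  next
    case False
    then have "f i = Suc (2 * (2 * (i div 2)))" "g i = Suc (2 * Suc (2 * (i div 2)))"
      "i = Suc (2 * (i div 2))"
      by (simp_all add: f_def g_def)
    with False show ?thesis
      by (simp only: params_even params_odd) (simp add: params_def)
  qed
  then have "(\<lambda>i. params e (params c d) (f i)) = params e c"
    "(\<lambda>i. params e (params c d) (g i)) = params e d" for e
    by auto
  with \<phi> \<psi> show ?thesis
    unfolding dfn_def
    by (intro exI[of _ "rename f \<phi> \<^bold>\<longrightarrow> rename g \<psi>"] exI[of _ "params c d"])
      (simp add: sat_rename)
qed

lemma dfn_not [dfn_intros]: "dfn P \<Longrightarrow> dfn (\<lambda>e. \<not> P e)"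
  using dfn_imp[of P "\<lambda>_. False"] dfn_const[of False] by simp

lemma dfn_disj [dfn_intros]: "dfn P \<Longrightarrow> dfn Q \<Longrightarrow> dfn (\<lambda>e. P e \<or> Q e)"
  using dfn_imp[of "\<lambda>e. \<not> P e" Q] dfn_not[of P] by (simp add: disj_imp)

lemma dfn_conj [dfn_intros]: "dfn P \<Longrightarrow> dfn Q \<Longrightarrow> dfn (\<lambda>e. P e \<and> Q e)"
  using dfn_not[OF dfn_imp[of P "\<lambda>e. \<not> Q e"]] dfn_not[of Q] by simp

lemma dfn_iff [dfn_intros]: "dfn P \<Longrightarrow> dfn Q \<Longrightarrow> dfn (\<lambda>e. P e \<longleftrightarrow> Q e)"
  using dfn_conj[OF dfn_imp[of P Q] dfn_imp[of Q P]] by (simp add: iff_conv_conj_imp)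

lemma dfn_all [dfn_intros]:
  assumes "dfn (\<lambda>e. Q (e 0) (\<lambda>i. e (Suc i)))"
  shows "dfn (\<lambda>e. \<forall>x. Q x e)"
proof -
  obtain \<phi> c where \<phi>: "in_formula \<phi>"
      and *: "\<And>e. Q (e 0) (\<lambda>i. e (Suc i)) \<longleftrightarrow> sat (\<epsilon>) (params e c) \<phi>"
    using assms unfolding dfn_def by blast
  \<comment> \<open>The variables sit at even positions. Removing the bound one moves the others
    down by two and the binder moves them up by one; the parameters at odd positions only feel the
    binder.\<close>
  let ?f = "\<lambda>i. if i = 0 then 0 else if even i then i - 1 else Suc i"
  have "params (case_nat x e) c = (\<lambda>i. case_nat x (params e c) (?f i))" for x e
  proof
    fix i :: nat
    have "i = 0 \<or> (\<exists>k. i = Suc (Suc (2 * k))) \<or> (\<exists>k. i = Suc (2 * k))"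
      by presburger
    then show "params (case_nat x e) c i = case_nat x (params e c) (?f i)"
      by (auto simp: params_def)
  qed
  then have "Q x e \<longleftrightarrow> sat (\<epsilon>) (\<lambda>i. case_nat x (params e c) (?f i)) \<phi>" for x e
    using *[of "case_nat x e"] by simp
  with \<phi> show ?thesis
    unfolding dfn_def
    by (intro exI[of _ "\<^bold>\<forall>(rename ?f \<phi>)"] exI[of _ c]) (simp add: sat_rename)
qed

lemma dfn_ex [dfn_intros]:
  "dfn (\<lambda>e. Q (e 0) (\<lambda>i. e (Suc i))) \<Longrightarrow> dfn (\<lambda>e. \<exists>x. Q x e)"
  using dfn_not[OF dfn_all[of "\<lambda>x e. \<not> Q x e"]] dfn_not by simp

lemma dft_var [dfn_intros]: "dft (\<lambda>e. e i)"
  unfolding dft_def dfn_def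
  by (intro exI[of _ "0 \<^bold>= 2 * Suc i"]) (simp add: params_def)

lemma dft_const [dfn_intros]: "dft (\<lambda>e. c)"
  unfolding dft_def dfn_def
  by (intro exI[of _ "0 \<^bold>= 1"] exI[of _ "\<lambda>_. c"]) (simp add: params_def)

lemma dft_weaken: "dft t \<Longrightarrow> dft (\<lambda>e. t (\<lambda>i. e (Suc i)))"
  using dfn_rename[of "\<lambda>e. e 0 = t (\<lambda>i. e (Suc i))" "case_nat 0 (\<lambda>i. Suc (Suc i))"]
  by (simp add: dft_def)

lemma dfn_plug:
  assumes "dft t" "dfn (\<lambda>e. Q (e 0) (\<lambda>i. e (Suc i)))"
  shows "dfn (\<lambda>e. Q (t e) e)"
  using dfn_ex[of "\<lambda>x e. x = t e \<and> Q x e"] dfn_conj assms unfolding dft_def by simp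

lemma dfn_eq [dfn_intros]: "dft s \<Longrightarrow> dft t \<Longrightarrow> dfn (\<lambda>e. s e = t e)"
  by (rule dfn_plug[of s]) (simp_all add: dft_def)

lemma dfn_mem [dfn_intros]:
  assumes "dft s" "dft t"
  shows "dfn (\<lambda>e. s e \<epsilon> t e)"
proof (rule dfn_plug[OF assms(2)], rule dfn_plug[OF dft_weaken[OF assms(1)]])
  show "dfn (\<lambda>e. e 0 \<epsilon> e (Suc 0))"
    unfolding dfn_def by (intro exI[of _ "0 \<^bold>\<in> 2"]) (simp add: params_def)
qed

text \<open>Infinitely many terms are substituted at once. Each atom involves only two of them, so
  parameters have to be merged only finitely often.\<close>

lemma dfn_sat:
  assumes "in_formula \<phi>" "\<And>i. dft (t i)"
  shows "dfn (\<lambda>e. sat (\<epsilon>) (\<lambda>i. t i e) \<phi>)"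
  using assms
proof (induction \<phi> arbitrary: t)
  case (Forall \<phi>)
  define u where "u i = case_nat (\<lambda>e. e 0) (\<lambda>i e. t i (\<lambda>j. e (Suc j))) i" for i
  have "dft (u i)" for i
    by (cases i) (simp_all add: u_def dft_var dft_weaken Forall.prems)
  then have "dfn (\<lambda>e. sat (\<epsilon>) (\<lambda>i. u i e) \<phi>)"
    using Forall by simp
  moreover have "(\<lambda>i. u i e) = case_nat (e 0) (\<lambda>i. t i (\<lambda>j. e (Suc j)))" for e
    by (auto simp: u_def fun_eq_iff split: nat.split)
  ultimately show ?case
    using dfn_all[of "\<lambda>a e. sat (\<epsilon>) (case_nat a (\<lambda>i. t i e)) \<phi>"] by simp
qed (auto intro!: dfn_intros)

lemma dfn_subst:
  assumes "dfn P" "\<And>i. dft (t i)"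
  shows "dfn (\<lambda>e. P (\<lambda>i. t i e))"
proof -
  obtain \<phi> c where \<phi>: "in_formula \<phi>" "\<And>e. P e \<longleftrightarrow> sat (\<epsilon>) (params e c) \<phi>"
    using assms(1) unfolding dfn_def by blast
  have "dfn (\<lambda>e. sat (\<epsilon>) (\<lambda>i. (if even i then t (i div 2) else (\<lambda>_. c (i div 2))) e) \<phi>)"
    by (rule dfn_sat) (use \<phi> assms(2) in \<open>auto intro: dft_const\<close>)
  moreover have "(\<lambda>i. (if even i then t (i div 2) else (\<lambda>_. c (i div 2))) e) = params (\<lambda>i. t i e) c" for e
    by (auto simp: params_def)
  ultimately show ?thesis
    using \<phi> by simp
qed

lemma dft_subst:
  assumes "dft s" "\<And>i. dft (t i)"
  shows "dft (\<lambda>e. s (\<lambda>i. t i e))"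
proof -
  define u where "u i = case_nat (\<lambda>e. e 0) (\<lambda>i e. t i (\<lambda>j. e (Suc j))) i" for i
  have "dft (u i)" for i
    by (cases i) (simp_all add: u_def dft_var dft_weaken assms)
  then show ?thesis
    using dfn_subst[OF assms(1)[unfolded dft_def], of u] by (simp add: dft_def u_def)
qed

abbreviation dfn1 :: "('a \<Rightarrow> bool) \<Rightarrow> bool" where
  "dfn1 P \<equiv> dfn (\<lambda>e. P (e 0))"

abbreviation dfn2 :: "('a \<Rightarrow> 'a \<Rightarrow> bool) \<Rightarrow> bool" where
  "dfn2 P \<equiv> dfn (\<lambda>e. P (e 0) (e 1))"

abbreviation dfn3 :: "('a \<Rightarrow> 'a \<Rightarrow> 'a \<Rightarrow> bool) \<Rightarrow> bool" where
  "dfn3 P \<equiv> dfn (\<lambda>e. P (e 0) (e 1) (e 2))"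

abbreviation dft1 :: "('a \<Rightarrow> 'a) \<Rightarrow> bool" where
  "dft1 F \<equiv> dft (\<lambda>e. F (e 0))"

abbreviation dft2 :: "('a \<Rightarrow> 'a \<Rightarrow> 'a) \<Rightarrow> bool" where
  "dft2 F \<equiv> dft (\<lambda>e. F (e 0) (e 1))"

lemma dfn1_subst: "dfn1 P \<Longrightarrow> dft a \<Longrightarrow> dfn (\<lambda>e. P (a e))"
  using dfn_subst[of "\<lambda>e. P (e 0)" "\<lambda>_. a"] by simp

lemma dfn2_subst: "dfn2 P \<Longrightarrow> dft a \<Longrightarrow> dft b \<Longrightarrow> dfn (\<lambda>e. P (a e) (b e))"
  using dfn_subst[of "\<lambda>e. P (e 0) (e 1)" "\<lambda>i. if i = 0 then a else b"] by simp

lemma dfn3_subst: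
  "dfn3 P \<Longrightarrow> dft a \<Longrightarrow> dft b \<Longrightarrow> dft c \<Longrightarrow> dfn (\<lambda>e. P (a e) (b e) (c e))"
  using dfn_subst[of "\<lambda>e. P (e 0) (e 1) (e 2)" "\<lambda>i. if i = 0 then a else if i = 1 then b else c"]
  by simp

lemma dft1_subst: "dft1 F \<Longrightarrow> dft a \<Longrightarrow> dft (\<lambda>e. F (a e))"
  using dft_subst[of "\<lambda>e. F (e 0)" "\<lambda>_. a"] by simp

lemma dft2_subst: "dft2 F \<Longrightarrow> dft a \<Longrightarrow> dft b \<Longrightarrow> dft (\<lambda>e. F (a e) (b e))"
  using dft_subst[of "\<lambda>e. F (e 0) (e 1)" "\<lambda>i. if i = 0 then a else b"] by simp

lemma dfn1_fm:
  assumes "dfn1 P"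
  obtains \<phi> d where "in_formula \<phi>" "\<And>x. P x \<longleftrightarrow> sat (\<epsilon>) (case_nat x d) \<phi>"
proof -
  obtain \<phi> c where \<phi>: "in_formula \<phi>" "\<And>e. P (e 0) \<longleftrightarrow> sat (\<epsilon>) (params e c) \<phi>"
    using assms unfolding dfn_def by blast
  \<comment> \<open>\<open>P\<close> sees only \<open>e 0\<close>, so the assignment may be taken
    constantly \<open>x\<close>; all variables collapse to index 0, followed by the
    parameters.\<close>
  let ?f = "\<lambda>i. if even i then 0 else Suc (i div 2)"
  have "params (\<lambda>_. x) c = (\<lambda>i. case_nat x c (?f i))" for x
    by (auto simp: params_def)
  then have "P x \<longleftrightarrow> sat (\<epsilon>) (case_nat x c) (rename ?f \<phi>)" for x
    using \<phi>(2)[of "\<lambda>_. x"] by (simp add: sat_rename)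
  with \<phi>(1) show ?thesis
    using that[of "rename ?f \<phi>" c] by simp
qed

lemma dfn2_fm:
  assumes "dfn2 P"
  obtains \<phi> d where "in_formula \<phi>" "\<And>x y. P x y \<longleftrightarrow> sat (\<epsilon>) (case_nat x (case_nat y d)) \<phi>"
proof -
  obtain \<phi> c where \<phi>: "in_formula \<phi>" "\<And>e. P (e 0) (e 1) \<longleftrightarrow> sat (\<epsilon>) (params e c) \<phi>"
    using assms unfolding dfn_def by blast
  let ?f = "\<lambda>i. if i = 0 then 0 else if even i then 1 else Suc (Suc (i div 2))"
  have "params (case_nat x (\<lambda>_. y)) c i = case_nat x (case_nat y c) (?f i)" for x y i
    by (cases "i div 2") (auto simp: params_def elim!: evenE)
  then have "(\<lambda>i. case_nat x (case_nat y c) (?f i)) = params (case_nat x (\<lambda>_. y)) c" for x y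
    by (intro HOL.ext) simp
  then have "P x y \<longleftrightarrow> sat (\<epsilon>) (case_nat x (case_nat y c)) (rename ?f \<phi>)" for x y
    using \<phi>(2)[of "case_nat x (\<lambda>_. y)"] by (simp add: sat_rename)
  with \<phi>(1) show ?thesis
    using that[of "rename ?f \<phi>" c] by simp
qed

subsection \<open>Set formation\<close>

definition ext :: "'a \<Rightarrow> 'a set" where
  "ext a = {x. x \<epsilon> a}"

definition small :: "'a set \<Rightarrow> bool" where
  "small X \<longleftrightarrow> (\<exists>a. ext a = X)"

definition setof :: "'a set \<Rightarrow> 'a" where
  "setof X = (THE a. ext a = X)"

lemma mem_eqI: "(\<And>z. z \<epsilon> x \<longleftrightarrow> z \<epsilon> y) \<Longrightarrow> x = y"
  using ZFc[of Extensionality] by (auto simp: ZFc_def ZF_def Extensionality_def)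

lemma ext_setof: "small X \<Longrightarrow> ext (setof X) = X"
  unfolding small_def setof_def by (erule exE, rule theI) (auto intro: mem_eqI simp: ext_def)

lemma mem_setof: "small X \<Longrightarrow> x \<epsilon> setof X \<longleftrightarrow> x \<in> X"
  using ext_setof by (auto simp: ext_def)

lemma smallI: "(\<And>x. x \<in> X \<longleftrightarrow> x \<epsilon> a) \<Longrightarrow> small X"
  unfolding small_def ext_def by (intro exI[of _ a]) auto

lemma small_Collect: "\<exists>s. \<forall>x. x \<epsilon> s \<longleftrightarrow> P x \<Longrightarrow> small {x. P x}"
  by (auto intro: smallI)

text \<open>Smallness at every assignment turns the description operator into a first-order
  condition: the elements of the value are exactly those satisfying \<open>Q\<close>.\<close>

lemma dft_setof:
  assumes "\<And>e. small {x. Q x e}" "dfn (\<lambda>e. Q (e 0) (\<lambda>i. e (Suc i)))"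
  shows "dft (\<lambda>e. setof {x. Q x e})"
proof -
  have "y = setof {x. Q x e} \<longleftrightarrow> (\<forall>x. x \<epsilon> y \<longleftrightarrow> Q x e)" for y e
    using mem_setof[OF assms(1)] mem_eqI by (metis mem_Collect_eq)
  moreover have "dfn (\<lambda>e. \<forall>x. x \<epsilon> e 0 \<longleftrightarrow> Q x (\<lambda>i. e (Suc i)))"
  proof (intro dfn_intros)
    show "dfn (\<lambda>e. Q (e 0) (\<lambda>i. e (Suc (Suc i))))"
      using dfn_rename[OF assms(2), of "case_nat 0 (\<lambda>i. Suc (Suc i))"] by simp
  qed
  ultimately show ?thesis
    by (simp add: dft_def)
qed

lemma sat_inst: "sat E e (inst xs d \<phi>) =
    sat E (\<lambda>i. e (if i < length xs then xs ! i else i - length xs + d)) \<phi>"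
  by (simp add: inst_def sat_rename)

lemma small_sep:
  assumes "dfn1 P"
  shows "small {x. x \<epsilon> a \<and> P x}"
proof -
  obtain \<phi> d where \<phi>: "in_formula \<phi>" "\<And>x. P x \<longleftrightarrow> sat (\<epsilon>) (case_nat x d) \<phi>"
    using dfn1_fm[OF assms] by blast
  obtain n where "sentence ((Forall ^^ n) (Separation \<phi>))"
    using ex_closure by blast
  then have "(Forall ^^ n) (Separation \<phi>) \<in> ZFc"
    using \<phi>(1) by (auto simp: ZFc_def ZF_def in_lang_def closures_def)
  then have "sat (\<epsilon>) d (Separation \<phi>)"
    using ZFc sat_Forall_funpow by blast
  moreover have "(\<lambda>i. case_nat z (case_nat s (case_nat a d)) (if i < length [0] then [0::nat] ! i else i - length [0::nat] + 3)) =
      case_nat z d" for z s a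
    by (auto simp: fun_eq_iff numeral_3_eq_3 split: nat.split)
  ultimately have "\<exists>s. \<forall>x. x \<epsilon> s \<longleftrightarrow> x \<epsilon> a \<and> P x"
    unfolding Separation_def by (simp add: sat_inst \<phi>(2)) blast
  then show ?thesis
    by (rule small_Collect)
qed

lemma small_replace:
  assumes "dfn2 P" "\<And>x y z. P x y \<Longrightarrow> P x z \<Longrightarrow> y = z"
  shows "small {y. \<exists>x. x \<epsilon> a \<and> P x y}"
proof -
  obtain \<phi> d where \<phi>: "in_formula \<phi>" "\<And>x y. P x y \<longleftrightarrow> sat (\<epsilon>) (case_nat x (case_nat y d)) \<phi>"
    using dfn2_fm[OF assms(1)] by blast
  obtain n where "sentence ((Forall ^^ n) (Replacement \<phi>))"
    using ex_closure by blast
  then have "(Forall ^^ n) (Replacement \<phi>) \<in> ZFc"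
    using \<phi>(1) by (auto simp: ZFc_def ZF_def in_lang_def closures_def)
  then have *: "sat (\<epsilon>) d (Replacement \<phi>)"
    using ZFc sat_Forall_funpow by blast
  have 1: "(\<lambda>i. case_nat z (case_nat y (case_nat x d)) (if i < length [2, 1] then [2, 1::nat] ! i else i - length [2, 1::nat] + 3)) =
      case_nat x (case_nat y d)" for x y z
    by (auto simp: fun_eq_iff numeral_3_eq_3 numeral_2_eq_2 less_Suc_eq split: nat.split)
  have 2: "(\<lambda>i. case_nat z (case_nat y (case_nat x d)) (if i < length [2, 0] then [2, 0::nat] ! i else i - length [2, 0::nat] + 3)) =
      case_nat x (case_nat z d)" for x y z
    by (auto simp: fun_eq_iff numeral_3_eq_3 numeral_2_eq_2 less_Suc_eq split: nat.split)
  have 3: "(\<lambda>i. case_nat x (case_nat y (case_nat s (case_nat a d))) (if i < length [0, 1] then [0, 1::nat] ! i else i - length [0, 1::nat] + 4)) =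
      case_nat x (case_nat y d)" for x y s a
    by (auto simp: fun_eq_iff eval_nat_numeral less_Suc_eq split: nat.split)
  from * have "\<exists>s. \<forall>y. y \<epsilon> s \<longleftrightarrow> (\<exists>x. x \<epsilon> a \<and> P x y)"
    unfolding Replacement_def sat.simps sat_inst 1 2 3 \<phi>(2)[symmetric]
    using assms(2) by simp metis
  then show ?thesis
    by (rule small_Collect)
qed


subsection \<open>Elementary set theory in the model\<close>

lemma small_subset:
  assumes "small X" "dfn1 P" "\<And>x. P x \<Longrightarrow> x \<in> X"
  shows "small {x. P x}"
proof -
  obtain a where a: "ext a = X"
    using assms(1) by (auto simp: small_def)
  then have "{x. P x} = {x. x \<epsilon> a \<and> P x}"
    using assms(3) by (auto simp: ext_def)
  then show ?thesis
    using small_sep[OF assms(2)] by simp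
qed

lemma small_empty: "small {x. False}"
  using small_sep[of "\<lambda>_. False" undefined] dfn_const by simp

lemma small_upair: "small {z. z = x \<or> z = y}"
proof (rule small_Collect)
  show "\<exists>s. \<forall>z. z \<epsilon> s \<longleftrightarrow> z = x \<or> z = y"
    using ZFc[of Pairing] by (simp add: ZFc_def ZF_def Pairing_def upair_fm_def) metis
qed

lemma small_uni: "small {z. \<exists>y. z \<epsilon> y \<and> y \<epsilon> a}"
proof (rule small_Collect)
  show "\<exists>s. \<forall>z. z \<epsilon> s \<longleftrightarrow> (\<exists>y. z \<epsilon> y \<and> y \<epsilon> a)"
    using ZFc[of Union] by (simp add: ZFc_def ZF_def Union_def) metis
qed

definition sub :: "'a \<Rightarrow> 'a \<Rightarrow> bool" where
  "sub x y \<longleftrightarrow> (\<forall>z. z \<epsilon> x \<longrightarrow> z \<epsilon> y)"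

lemma dfn_sub [dfn_intros]: "dft a \<Longrightarrow> dft b \<Longrightarrow> dfn (\<lambda>e. sub (a e) (b e))"
  by (rule dfn2_subst[of sub]) (unfold sub_def, intro dfn_intros)

lemma small_pow: "small {x. sub x a}"
proof (rule small_Collect)
  show "\<exists>s. \<forall>x. x \<epsilon> s \<longleftrightarrow> sub x a"
    using ZFc[of Power_Set]
    by (simp add: ZFc_def ZF_def Power_Set_def subset_fm_def sub_def) metis
qed

definition emp :: 'a where
  "emp = setof {x. False}"

definition upair :: "'a \<Rightarrow> 'a \<Rightarrow> 'a" where
  "upair x y = setof {z. z = x \<or> z = y}"

definition uni :: "'a \<Rightarrow> 'a" where
  "uni a = setof {z. \<exists>y. z \<epsilon> y \<and> y \<epsilon> a}"

definition pow :: "'a \<Rightarrow> 'a" where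
  "pow a = setof {x. sub x a}"

lemma mem_emp [simp]: "\<not> x \<epsilon> emp"
  using mem_setof[OF small_empty] by (simp add: emp_def)

lemma mem_upair [simp]: "z \<epsilon> upair x y \<longleftrightarrow> z = x \<or> z = y"
  using mem_setof[OF small_upair] by (simp add: upair_def)

lemma mem_uni [simp]: "z \<epsilon> uni a \<longleftrightarrow> (\<exists>y. z \<epsilon> y \<and> y \<epsilon> a)"
  using mem_setof[OF small_uni] by (simp add: uni_def)

lemma mem_pow [simp]: "x \<epsilon> pow a \<longleftrightarrow> sub x a"
  using mem_setof[OF small_pow] by (simp add: pow_def)

lemma dft_upair [dfn_intros]: "dft a \<Longrightarrow> dft b \<Longrightarrow> dft (\<lambda>e. upair (a e) (b e))"
  by (rule dft2_subst[of upair]) (unfold upair_def, intro dft_setof small_upair dfn_intros)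

lemma dft_uni [dfn_intros]: "dft a \<Longrightarrow> dft (\<lambda>e. uni (a e))"
  by (rule dft1_subst[of uni]) (unfold uni_def, intro dft_setof small_uni dfn_intros)

lemma small_un: "small {z. z \<epsilon> a \<or> z \<epsilon> b}"
proof (rule small_Collect)
  show "\<exists>s. \<forall>z. z \<epsilon> s \<longleftrightarrow> z \<epsilon> a \<or> z \<epsilon> b"
    by (rule exI[of _ "uni (upair a b)"]) auto
qed

definition suc :: "'a \<Rightarrow> 'a" where
  "suc x = setof {z. z \<epsilon> x \<or> z = x}"

lemma small_suc: "small {z. z \<epsilon> x \<or> z = x}"
  using small_un[of x "upair x x"] by simp

lemma mem_suc [simp]: "z \<epsilon> suc x \<longleftrightarrow> z \<epsilon> x \<or> z = x"
  using mem_setof[OF small_suc] by (simp add: suc_def)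

lemma dft_suc [dfn_intros]: "dft a \<Longrightarrow> dft (\<lambda>e. suc (a e))"
  by (rule dft1_subst[of suc]) (unfold suc_def, intro dft_setof small_suc dfn_intros)

section \<open>Ordered pairs, functions and products\<close>

definition op :: "'a \<Rightarrow> 'a \<Rightarrow> 'a" where
  "op x y = upair (upair x x) (upair x y)"

lemma dft_op [dfn_intros]: "dft a \<Longrightarrow> dft b \<Longrightarrow> dft (\<lambda>e. op (a e) (b e))"
  unfolding op_def by (intro dfn_intros)

lemma ext_upair: "ext (upair x y) = {x, y}"
  by (auto simp: ext_def)

lemma upair_eq_iff: "upair x y = upair x' y' \<longleftrightarrow> x = x' \<and> y = y' \<or> x = y' \<and> y = x'"
proof -
  have "upair x y = upair x' y' \<Longrightarrow> {x, y} = {x', y'}"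
    by (simp only: ext_upair[symmetric])
  then show ?thesis
    by (auto simp: doubleton_eq_iff intro: mem_eqI)
qed

lemma op_eq_iff [simp]: "op x y = op x' y' \<longleftrightarrow> x = x' \<and> y = y'"
  unfolding op_def upair_eq_iff by auto

lemma small_app: "small {z. \<exists>y. z \<epsilon> y \<and> op n y \<epsilon> f}"
proof (rule small_subset)
  \<comment> \<open>The membership chain runs from \<open>z\<close> to \<open>y\<close>, to the
    unordered pair of \<open>n\<close> and \<open>y\<close>, to \<open>op n y\<close>, to
    \<open>f\<close>; three unions bridge it.\<close>
  show "small {z. z \<epsilon> uni (uni (uni f))}"
    by (rule smallI[of _ "uni (uni (uni f))"]) simp
  show "dfn1 (\<lambda>z. \<exists>y. z \<epsilon> y \<and> op n y \<epsilon> f)"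
    by (intro dfn_intros)
  show "\<exists>y. z \<epsilon> y \<and> op n y \<epsilon> f \<Longrightarrow> z \<in> {z. z \<epsilon> uni (uni (uni f))}" for z
    by (auto simp: op_def) (metis mem_upair)
qed

text \<open>
  The value of \<open>f\<close> at \<open>n\<close> is taken to be the union of all \<open>y\<close> with \<open>(n, y) \<in> f\<close>. This makes every
  element of the model a total function, so that no name has to be checked for being a function.
\<close>

definition app :: "'a \<Rightarrow> 'a \<Rightarrow> 'a" where
  "app f n = setof {z. \<exists>y. z \<epsilon> y \<and> op n y \<epsilon> f}"

lemma mem_app: "z \<epsilon> app f n \<longleftrightarrow> (\<exists>y. z \<epsilon> y \<and> op n y \<epsilon> f)"
  using mem_setof[OF small_app] by (simp add: app_def)

lemma dft_app [dfn_intros]: "dft a \<Longrightarrow> dft b \<Longrightarrow> dft (\<lambda>e. app (a e) (b e))"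
  by (rule dft2_subst[of app]) (unfold app_def, intro dft_setof small_app dfn_intros)

lemma app_eq:
  assumes "op n y \<epsilon> f" "\<And>z. op n z \<epsilon> f \<Longrightarrow> z = y"
  shows "app f n = y"
  by (rule mem_eqI, unfold mem_app) (use assms in blast)

definition lam :: "'a \<Rightarrow> ('a \<Rightarrow> 'a) \<Rightarrow> 'a" where
  "lam a F = setof {p. \<exists>n. n \<epsilon> a \<and> p = op n (F n)}"

lemma small_image:
  assumes "dft1 F"
  shows "small {y. \<exists>x. x \<epsilon> a \<and> y = F x}"
  by (rule small_replace, intro dfn_intros dft1_subst[OF assms]) simp

lemma small_lam:
  assumes "dft1 F"
  shows "small {p. \<exists>n. n \<epsilon> a \<and> p = op n (F n)}"
  by (rule small_image[of "\<lambda>n. op n (F n)"]) (intro dfn_intros dft1_subst[OF assms])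

lemma mem_lam: "dft1 F \<Longrightarrow> p \<epsilon> lam a F \<longleftrightarrow> (\<exists>n. n \<epsilon> a \<and> p = op n (F n))"
  using mem_setof[OF small_lam] by (simp add: lam_def)

lemma app_lam: "dft1 F \<Longrightarrow> n \<epsilon> a \<Longrightarrow> app (lam a F) n = F n"
  by (rule app_eq) (auto simp: mem_lam)

lemma small_UN:
  assumes "dft1 F"
  shows "small {z. \<exists>x. x \<epsilon> a \<and> z \<epsilon> F x}"
proof -
  obtain d where d: "ext d = {y. \<exists>x. x \<epsilon> a \<and> y = F x}"
    using small_image[OF assms, of a] unfolding small_def by blast
  have "y \<epsilon> d \<longleftrightarrow> (\<exists>x. x \<epsilon> a \<and> y = F x)" for y
    using d by (auto simp: ext_def set_eq_iff)
  then show ?thesis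
    by (intro smallI[of _ "uni d"]) auto
qed

lemma small_prod: "small {p. \<exists>x y. x \<epsilon> a \<and> y \<epsilon> b \<and> p = op x y}"
proof -
  define F where "F x = setof {p. \<exists>y. y \<epsilon> b \<and> p = op x y}" for x
  have s: "small {p. \<exists>y. y \<epsilon> b \<and> p = op x y}" for x
    by (rule small_image) (intro dfn_intros)
  have "dft1 F"
    unfolding F_def by (intro dft_setof s dfn_intros)
  then have "small {z. \<exists>x. x \<epsilon> a \<and> z \<epsilon> F x}"
    by (rule small_UN)
  moreover have "z \<epsilon> F x \<longleftrightarrow> (\<exists>y. y \<epsilon> b \<and> z = op x y)" for z x
    using mem_setof[OF s] by (simp add: F_def)
  ultimately show ?thesis
    by simp
qed

definition prod :: "'a \<Rightarrow> 'a \<Rightarrow> 'a" where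
  "prod a b = setof {p. \<exists>x y. x \<epsilon> a \<and> y \<epsilon> b \<and> p = op x y}"

lemma mem_prod: "p \<epsilon> prod a b \<longleftrightarrow> (\<exists>x y. x \<epsilon> a \<and> y \<epsilon> b \<and> p = op x y)"
  using mem_setof[OF small_prod] by (simp add: prod_def)

lemma foundation: "x \<epsilon> a \<Longrightarrow> \<exists>m. m \<epsilon> a \<and> (\<forall>y. y \<epsilon> m \<longrightarrow> \<not> y \<epsilon> a)"
  using ZFc[of Foundation] by (simp add: ZFc_def ZF_def Foundation_def) metis

lemma minimal_element:
  assumes "dfn1 P" "x \<epsilon> a" "P x"
  shows "\<exists>m. m \<epsilon> a \<and> P m \<and> (\<forall>y. y \<epsilon> m \<longrightarrow> y \<epsilon> a \<longrightarrow> \<not> P y)"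
proof -
  have s: "y \<epsilon> setof {y. y \<epsilon> a \<and> P y} \<longleftrightarrow> y \<epsilon> a \<and> P y" for y
    using mem_setof[OF small_sep[OF assms(1)]] by simp
  then show ?thesis
    using foundation[of x "setof {y. y \<epsilon> a \<and> P y}"] assms by auto
qed

lemma mem_asym: "x \<epsilon> y \<Longrightarrow> \<not> y \<epsilon> x"
  using foundation[of x "upair x y"] by auto

lemma mem_irrefl: "\<not> x \<epsilon> x"
  using mem_asym by blast

lemma suc_eq_iff: "suc x = suc y \<longleftrightarrow> x = y"
  by (metis mem_asym mem_suc)

subsection \<open>Natural numbers\<close>

definition is_inductive :: "'a \<Rightarrow> bool" where
  "is_inductive J \<longleftrightarrow> emp \<epsilon> J \<and> (\<forall>x. x \<epsilon> J \<longrightarrow> suc x \<epsilon> J)"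

lemma sat_empty_fm [simp]: "sat (\<epsilon>) e (empty_fm x) \<longleftrightarrow> e x = emp"
  using mem_eqI[of "e x" emp] by (auto simp: empty_fm_def)

lemma sat_succ_fm [simp]: "sat (\<epsilon>) e (succ_fm y x) \<longleftrightarrow> e y = suc (e x)"
  using mem_eqI[of "e y" "suc (e x)"] by (auto simp: succ_fm_def)

lemma sat_subset_fm [simp]: "sat (\<epsilon>) e (subset_fm x y) \<longleftrightarrow> sub (e x) (e y)"
  by (simp add: subset_fm_def sub_def)

lemma sat_inductive_fm [simp]: "sat (\<epsilon>) e (inductive_fm I) \<longleftrightarrow> is_inductive (e I)"
  by (auto simp: inductive_fm_def is_inductive_def)

lemma ex_inductive: "\<exists>I. is_inductive I"
  using ZFc[of Infinity] by (simp add: ZFc_def ZF_def Infinity_def)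

lemma dfn_inductive [dfn_intros]: "dft a \<Longrightarrow> dfn (\<lambda>e. is_inductive (a e))"
  by (rule dfn1_subst[of is_inductive]) (unfold is_inductive_def, intro dfn_intros)

definition omega :: 'a where
  "omega = setof {x. \<forall>J. is_inductive J \<longrightarrow> x \<epsilon> J}"

lemma mem_omega: "x \<epsilon> omega \<longleftrightarrow> (\<forall>J. is_inductive J \<longrightarrow> x \<epsilon> J)"
proof -
  obtain I where "is_inductive I"
    using ex_inductive ..
  then have "{x. \<forall>J. is_inductive J \<longrightarrow> x \<epsilon> J} = {x. x \<epsilon> I \<and> (\<forall>J. is_inductive J \<longrightarrow> x \<epsilon> J)}"
    by auto
  moreover have "small {x. x \<epsilon> I \<and> (\<forall>J. is_inductive J \<longrightarrow> x \<epsilon> J)}"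
    by (intro small_sep dfn_intros)
  ultimately show ?thesis
    using mem_setof unfolding omega_def by force
qed

lemma emp_omega [simp]: "emp \<epsilon> omega"
  by (simp add: mem_omega is_inductive_def)

lemma suc_omega [simp]: "x \<epsilon> omega \<Longrightarrow> suc x \<epsilon> omega"
  by (simp add: mem_omega is_inductive_def)

text \<open>The \<open>omega\<close> of the model may have nonstandard elements, so induction is
  available for definable \<open>P\<close> only. This is why every such induction has a case
  \<open>dfn\<close>.\<close>

lemma omega_induct [consumes 1, case_names dfn emp suc]:
  assumes "n \<epsilon> omega" "dfn1 P" "P emp" "\<And>n. n \<epsilon> omega \<Longrightarrow> P n \<Longrightarrow> P (suc n)"
  shows "P n"
proof -
  have s: "x \<epsilon> setof {x. x \<epsilon> omega \<and> P x} \<longleftrightarrow> x \<epsilon> omega \<and> P x" for x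
    using mem_setof[OF small_sep[OF assms(2)]] by simp
  have "is_inductive (setof {x. x \<epsilon> omega \<and> P x})"
    using assms by (simp add: is_inductive_def s)
  then show ?thesis
    using assms(1) s mem_omega by blast
qed

lemma sat_Nat_fm [simp]: "sat (\<epsilon>) e (Nat_fm N) \<longleftrightarrow> e N = omega"
proof -
  have *: "sat (\<epsilon>) e (Nat_fm N) \<longleftrightarrow>
      is_inductive (e N) \<and> (\<forall>J. is_inductive J \<longrightarrow> sub (e N) J)"
    by (simp add: Nat_fm_def)
  have "is_inductive omega"
    by (simp add: is_inductive_def)
  moreover have "sub omega J" if "is_inductive J" for J
    using that mem_omega unfolding sub_def by blast
  moreover have "x = omega" if "sub x omega" "sub omega x" for x
    using that by (intro mem_eqI) (auto simp: sub_def)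
  ultimately show ?thesis
    unfolding * by metis
qed

lemma omega_mem: "n \<epsilon> omega \<Longrightarrow> m \<epsilon> n \<Longrightarrow> m \<epsilon> omega"
proof -
  assume "n \<epsilon> omega"
  then have "\<forall>m. m \<epsilon> n \<longrightarrow> m \<epsilon> omega"
    by (induction rule: omega_induct) (intro dfn_intros, auto)
  then show "m \<epsilon> n \<Longrightarrow> m \<epsilon> omega"
    by blast
qed

lemma omega_trans: "n \<epsilon> omega \<Longrightarrow> k \<epsilon> m \<Longrightarrow> m \<epsilon> n \<Longrightarrow> k \<epsilon> n"
proof -
  assume "n \<epsilon> omega"
  then have "\<forall>m k. m \<epsilon> n \<longrightarrow> k \<epsilon> m \<longrightarrow> k \<epsilon> n"
    by (induction rule: omega_induct) (intro dfn_intros, auto)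
  then show "k \<epsilon> m \<Longrightarrow> m \<epsilon> n \<Longrightarrow> k \<epsilon> n"
    by blast
qed

lemma suc_least: "n \<epsilon> omega \<Longrightarrow> m \<epsilon> n \<Longrightarrow> suc m \<epsilon> n \<or> suc m = n"
proof -
  assume "n \<epsilon> omega"
  then have "\<forall>m. m \<epsilon> n \<longrightarrow> suc m \<epsilon> n \<or> suc m = n"
    by (induction rule: omega_induct) (intro dfn_intros, auto)
  then show "m \<epsilon> n \<Longrightarrow> suc m \<epsilon> n \<or> suc m = n"
    by blast
qed

lemma emp_least: "n \<epsilon> omega \<Longrightarrow> n = emp \<or> emp \<epsilon> n"
  by (induction rule: omega_induct) (intro dfn_intros, auto)

lemma omega_linear: "m \<epsilon> omega \<Longrightarrow> n \<epsilon> omega \<Longrightarrow> m \<epsilon> n \<or> m = n \<or> n \<epsilon> m"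
proof -
  assume "m \<epsilon> omega" "n \<epsilon> omega"
  from this(2) have "\<forall>m. m \<epsilon> omega \<longrightarrow> m \<epsilon> n \<or> m = n \<or> n \<epsilon> m"
  proof (induction rule: omega_induct)
    case (suc n)
    then show ?case
      using suc_least by fastforce
  qed (intro dfn_intros, auto dest: emp_least)
  then show ?thesis
    using \<open>m \<epsilon> omega\<close> by blast
qed


subsection \<open>Levels of the cumulative hierarchy and collection\<close>

lemma ex_set: "small {x. P x} \<Longrightarrow> \<exists>a. \<forall>x. x \<epsilon> a \<longleftrightarrow> P x"
  by (auto simp: small_def ext_def set_eq_iff)

lemma small_inter: "small {z. z \<epsilon> x \<and> z \<epsilon> h}"
  by (intro small_sep dfn_intros)

definition inter :: "'a \<Rightarrow> 'a \<Rightarrow> 'a" where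
  "inter x h = setof {z. z \<epsilon> x \<and> z \<epsilon> h}"

lemma mem_inter [simp]: "z \<epsilon> inter x h \<longleftrightarrow> z \<epsilon> x \<and> z \<epsilon> h"
  using mem_setof[OF small_inter] by (simp add: inter_def)

lemma dft_inter [dfn_intros]: "dft a \<Longrightarrow> dft b \<Longrightarrow> dft (\<lambda>e. inter (a e) (b e))"
  by (rule dft2_subst[of inter]) (unfold inter_def, intro dft_setof small_inter dfn_intros)

lemma small_pot: "small {x. \<exists>c. c \<epsilon> h \<and> sub x c}"
proof (rule small_subset[OF small_pow[of "uni h"]])
  show "dfn1 (\<lambda>x. \<exists>c. c \<epsilon> h \<and> sub x c)"
    by (intro dfn_intros)
qed (auto simp: sub_def)

text \<open>Applied to the set of all levels below a given level, this yields that level, at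
  successors and limits alike.\<close>

definition pot :: "'a \<Rightarrow> 'a" where
  "pot h = setof {x. \<exists>c. c \<epsilon> h \<and> sub x c}"

lemma mem_pot: "x \<epsilon> pot h \<longleftrightarrow> (\<exists>c. c \<epsilon> h \<and> sub x c)"
  using mem_setof[OF small_pot] by (simp add: pot_def)

lemma dft_pot [dfn_intros]: "dft a \<Longrightarrow> dft (\<lambda>e. pot (a e))"
  by (rule dft1_subst[of pot]) (unfold pot_def, intro dft_setof small_pot dfn_intros)

text \<open>
  Histories and levels follow Button's presentation of Scott--Potter level theory, which yields
  the cumulative hierarchy without ordinals or recursion.
\<close>

definition hist :: "'a \<Rightarrow> bool" where
  "hist h \<longleftrightarrow> (\<forall>x. x \<epsilon> h \<longrightarrow> x = pot (inter x h))"

definition lev :: "'a \<Rightarrow> bool" where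
  "lev s \<longleftrightarrow> (\<exists>h. hist h \<and> s = pot h)"

lemma dfn_hist [dfn_intros]: "dft a \<Longrightarrow> dfn (\<lambda>e. hist (a e))"
  by (rule dfn1_subst[of hist]) (unfold hist_def, intro dfn_intros)

lemma dfn_lev [dfn_intros]: "dft a \<Longrightarrow> dfn (\<lambda>e. lev (a e))"
  by (rule dfn1_subst[of lev]) (unfold lev_def, intro dfn_intros)

lemma sub_refl [simp]: "sub x x"
  by (simp add: sub_def)

lemma sub_trans: "sub x y \<Longrightarrow> sub y z \<Longrightarrow> sub x z"
  by (simp add: sub_def)

lemma subD: "sub x y \<Longrightarrow> z \<epsilon> x \<Longrightarrow> z \<epsilon> y"
  by (simp add: sub_def)

lemma mem_hist:
  assumes "hist h" "x \<epsilon> h"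
  shows "y \<epsilon> x \<longleftrightarrow> (\<exists>c. c \<epsilon> x \<and> c \<epsilon> h \<and> sub y c)"
proof -
  have "x = pot (inter x h)"
    using assms unfolding hist_def by blast
  then have "y \<epsilon> x \<longleftrightarrow> y \<epsilon> pot (inter x h)"
    by metis
  then show ?thesis
    by (simp add: mem_pot conj_assoc)
qed

text \<open>In a minimal counterexample \<open>m\<close>, the member \<open>y\<close> lies inside
  some earlier \<open>c\<close>. That \<open>c\<close> is transitive in the required sense, so an
  element \<open>z\<close> of \<open>y\<close> is included in \<open>c\<close> and hence belongs to
  \<open>m\<close>.\<close>

lemma hist_transitive:
  assumes "hist h" "x \<epsilon> h" "y \<epsilon> x"
  shows "sub y x"
proof (rule ccontr)
  assume "\<not> sub y x"
  moreover have "dfn1 (\<lambda>x. \<exists>y. y \<epsilon> x \<and> \<not> sub y x)"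
    by (intro dfn_intros)
  ultimately obtain m where m: "m \<epsilon> h" "\<exists>y. y \<epsilon> m \<and> \<not> sub y m"
      and min: "\<And>x y. x \<epsilon> m \<Longrightarrow> x \<epsilon> h \<Longrightarrow> y \<epsilon> x \<Longrightarrow> sub y x"
    using minimal_element[of "\<lambda>x. \<exists>y. y \<epsilon> x \<and> \<not> sub y x" x h] assms(2,3) by blast
  then obtain y z where y: "y \<epsilon> m" "z \<epsilon> y" "\<not> z \<epsilon> m"
    by (auto simp: sub_def)
  obtain c where c: "c \<epsilon> m" "c \<epsilon> h" "sub y c"
    using mem_hist[OF assms(1) m(1)] y(1) by blast
  then have "sub z c"
    using min y(2) subD by blast
  then show False
    using mem_hist[OF assms(1) m(1)] c y(3) by blast
qed

text \<open>The part of a history below \<open>x\<close> is again a history, because by transitivity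
  nothing is lost when an earlier member is cut down to it.\<close>

lemma hist_lev:
  assumes "hist h" "x \<epsilon> h"
  shows "lev x"
  unfolding lev_def
proof (intro exI conjI)
  show "x = pot (inter x h)"
    using assms unfolding hist_def by blast
  show "hist (inter x h)"
    unfolding hist_def
  proof (intro allI impI)
    fix y assume y: "y \<epsilon> inter x h"
    then have "inter y (inter x h) = inter y h"
      using hist_transitive[OF assms, of y] by (intro mem_eqI) (auto simp: sub_def)
    moreover have "y = pot (inter y h)"
      using y assms(1) unfolding hist_def by simp
    ultimately show "y = pot (inter y (inter x h))"
      by simp
  qed
qed

lemma lev_sub: "lev s \<Longrightarrow> sub x y \<Longrightarrow> y \<epsilon> s \<Longrightarrow> x \<epsilon> s"
  unfolding lev_def using sub_trans by (metis mem_pot)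

lemma lev_transitive: "lev s \<Longrightarrow> y \<epsilon> s \<Longrightarrow> z \<epsilon> y \<Longrightarrow> z \<epsilon> s"
  unfolding lev_def by (metis hist_transitive mem_pot subD)

text \<open>A level is determined by the levels that belong to it. The comparison of levels rests on
  this.\<close>

lemma mem_lev:
  assumes "lev s"
  shows "x \<epsilon> s \<longleftrightarrow> (\<exists>r. r \<epsilon> s \<and> lev r \<and> sub x r)"
proof
  assume "x \<epsilon> s"
  then show "\<exists>r. r \<epsilon> s \<and> lev r \<and> sub x r"
    using assms hist_lev sub_refl unfolding lev_def[of s] by (metis mem_pot)
qed (use assms lev_sub in blast)

lemma lev_minimal:
  assumes "dfn1 P" "lev s" "P s"
  shows "\<exists>m. lev m \<and> P m \<and> (\<forall>r. r \<epsilon> m \<longrightarrow> lev r \<longrightarrow> \<not> P r)"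
proof (cases "\<exists>r. r \<epsilon> s \<and> lev r \<and> P r")
  case True
  moreover have "dfn1 (\<lambda>r. lev r \<and> P r)"
    by (intro dfn_intros assms)
  ultimately obtain m where "m \<epsilon> s" "lev m" "P m" "\<forall>y. y \<epsilon> m \<longrightarrow> y \<epsilon> s \<longrightarrow> \<not> (lev y \<and> P y)"
    using minimal_element[of "\<lambda>r. lev r \<and> P r"] by blast
  then show ?thesis
    using lev_transitive[OF assms(2)] by blast
qed (use assms in blast)

text \<open>Take a minimal \<open>u\<close> that is incomparable to some level, then a minimal
  \<open>v\<close> incomparable to \<open>u\<close>. Minimality gives them the same levels as
  elements, so they are equal after all.\<close>

lemma lev_linear:
  assumes "lev s" "lev t"
  shows "s \<epsilon> t \<or> s = t \<or> t \<epsilon> s"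
proof (rule ccontr)
  define comp where "comp s t \<longleftrightarrow> s \<epsilon> t \<or> s = t \<or> t \<epsilon> s" for s t
  have dc: "dft a \<Longrightarrow> dft b \<Longrightarrow> dfn (\<lambda>e. comp (a e) (b e))" for a b
    unfolding comp_def by (intro dfn_intros)
  assume "\<not> (s \<epsilon> t \<or> s = t \<or> t \<epsilon> s)"
  then have "\<exists>t. lev t \<and> \<not> comp s t"
    using assms(2) by (auto simp: comp_def)
  moreover have "dfn1 (\<lambda>s. \<exists>t. lev t \<and> \<not> comp s t)"
    by (intro dfn_intros dc)
  ultimately obtain u where u: "lev u" "\<exists>t. lev t \<and> \<not> comp u t"
      and umin: "\<And>r t. r \<epsilon> u \<Longrightarrow> lev r \<Longrightarrow> lev t \<Longrightarrow> comp r t"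
    using lev_minimal[of "\<lambda>s. \<exists>t. lev t \<and> \<not> comp s t" s] assms(1) by blast
  have "dfn1 (\<lambda>t. \<not> comp u t)"
    by (intro dfn_intros dc)
  then obtain v where v: "lev v" "\<not> comp u v" and vmin: "\<And>r. r \<epsilon> v \<Longrightarrow> lev r \<Longrightarrow> comp u r"
    using lev_minimal[of "\<lambda>t. \<not> comp u t"] u(2) by blast
  have 1: "r \<epsilon> v" if "r \<epsilon> u" "lev r" for r
    using umin[OF that v(1)] v(2) that lev_transitive[OF u(1), of r v] unfolding comp_def by blast
  have 2: "r \<epsilon> u" if "r \<epsilon> v" "lev r" for r
    using vmin[OF that] v(2) that lev_transitive[OF v(1), of r u] unfolding comp_def by blast
  have "u = v"
    by (rule mem_eqI) (metis 1 2 mem_lev u(1) v(1))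
  then show False
    using v(2) by (simp add: comp_def)
qed

text \<open>Scott's trick: a witness cannot be singled out without choice, but the first level that
  contains one is unique, which is what replacement asks for.\<close>

definition least_lev :: "('a \<Rightarrow> bool) \<Rightarrow> 'a \<Rightarrow> bool" where
  "least_lev P l \<longleftrightarrow> lev l \<and> P l \<and> (\<forall>r. lev r \<longrightarrow> P r \<longrightarrow> l = r \<or> l \<epsilon> r)"

lemma ex_least_lev:
  assumes "dfn1 P" "lev s" "P s"
  shows "\<exists>l. least_lev P l"
proof -
  obtain m where "lev m" "P m" "\<And>r. r \<epsilon> m \<Longrightarrow> lev r \<Longrightarrow> \<not> P r"
    using lev_minimal[of P s] assms by blast
  then have "least_lev P m"
    unfolding least_lev_def using lev_linear by blast
  then show ?thesis ..
qed

lemma least_lev_unique: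
  assumes "least_lev P l" "least_lev P m"
  shows "l = m"
proof -
  have "l = m \<or> l \<epsilon> m" "m = l \<or> m \<epsilon> l"
    using assms unfolding least_lev_def by blast+
  then show ?thesis
    using mem_asym by blast
qed

lemma dfn_least_lev:
  assumes "dfn2 Q"
  shows "dfn2 (\<lambda>x. least_lev (Q x))"
  unfolding least_lev_def by (intro dfn_intros dfn2_subst[OF assms])

lemma small_least_levs:
  assumes "dfn2 Q"
  shows "small {l. \<exists>x. x \<epsilon> a \<and> least_lev (Q x) l}"
  by (rule small_replace[OF dfn_least_lev[OF assms]]) (rule least_lev_unique)

text \<open>The levels inside \<open>s\<close> together with \<open>s\<close> itself form a history,
  and its potentiation is a level that contains every subset of \<open>s\<close>.\<close>

lemma lev_next:
  assumes "lev s" "sub a s"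
  shows "\<exists>t. lev t \<and> a \<epsilon> t"
proof -
  have "small {r. (r \<epsilon> s \<and> lev r) \<or> r = s}"
    by (rule small_subset[OF small_suc[of s]]) (intro dfn_intros, auto)
  from ex_set[OF this] obtain h where h: "\<And>r. r \<epsilon> h \<longleftrightarrow> (r \<epsilon> s \<and> lev r) \<or> r = s"
    by blast
  have "hist h"
    unfolding hist_def
  proof (intro allI impI)
    fix r assume "r \<epsilon> h"
    then have r: "lev r" "r \<epsilon> s \<or> r = s"
      using h assms(1) by auto
    then have q: "q \<epsilon> inter r h \<longleftrightarrow> q \<epsilon> r \<and> lev q" for q
      using h[of q] lev_transitive[OF assms(1), of r q] assms(1) by auto
    show "r = pot (inter r h)"
      by (rule mem_eqI) (unfold mem_pot q conj_assoc, rule mem_lev[OF r(1)])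
  qed
  then have "lev (pot h)"
    by (auto simp: lev_def)
  moreover have "a \<epsilon> pot h"
    using h assms(2) by (auto simp: mem_pot)
  ultimately show ?thesis
    by blast
qed

lemma ex_lev_step:
  assumes "\<And>x. x \<epsilon> a \<Longrightarrow> \<exists>s. lev s \<and> x \<epsilon> s"
  shows "\<exists>s. lev s \<and> a \<epsilon> s"
proof -
  have mem2: "dfn2 (\<lambda>x l. x \<epsilon> l)"
    by (intro dfn_intros)
  obtain d where d: "\<And>l. l \<epsilon> d \<longleftrightarrow> (\<exists>x. x \<epsilon> a \<and> least_lev (\<lambda>l. x \<epsilon> l) l)"
    using ex_set[OF small_least_levs[OF mem2]] by blast
  \<comment> \<open>The least levels collected in \<open>d\<close> need not form a history; adding
    all levels below them gives one.\<close>
  have "small {r. lev r \<and> (r \<epsilon> d \<or> (\<exists>l. r \<epsilon> l \<and> l \<epsilon> d))}"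
  proof (rule small_subset)
    show "small {r. r \<epsilon> d \<or> r \<epsilon> uni d}"
      by (rule small_un)
  qed (intro dfn_intros, auto)
  from ex_set[OF this] obtain h where h: "\<And>r. r \<epsilon> h \<longleftrightarrow> lev r \<and> (r \<epsilon> d \<or> (\<exists>l. r \<epsilon> l \<and> l \<epsilon> d))"
    by blast
  have lev_d: "lev l" if "l \<epsilon> d" for l
    using that d unfolding least_lev_def by blast
  have "hist h"
    unfolding hist_def
  proof (intro allI impI)
    fix r assume r: "r \<epsilon> h"
    then have "lev r"
      using h by blast
    have q: "q \<epsilon> inter r h \<longleftrightarrow> q \<epsilon> r \<and> lev q" for q
      using h[of q] h[of r] r lev_transitive[OF lev_d, of _ r q] by auto
    show "r = pot (inter r h)"
      by (rule mem_eqI) (unfold mem_pot q conj_assoc, rule mem_lev[OF \<open>lev r\<close>])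
  qed
  then have lev: "lev (pot h)"
    by (auto simp: lev_def)
  have "sub a (pot h)"
    unfolding sub_def
  proof (intro allI impI)
    fix x assume x: "x \<epsilon> a"
    then obtain s where s: "lev s" "x \<epsilon> s"
      using assms by blast
    have "dfn1 (\<lambda>l. x \<epsilon> l)"
      by (intro dfn_intros)
    from ex_least_lev[OF this s] obtain l where l: "least_lev (\<lambda>l. x \<epsilon> l) l" ..
    then have "l \<epsilon> h"
      using h d x lev_d by blast
    then have "l \<epsilon> pot h"
      unfolding mem_pot using sub_refl by blast
    moreover have "x \<epsilon> l"
      using l unfolding least_lev_def by blast
    ultimately show "x \<epsilon> pot h"
      using lev lev_transitive by blast
  qed
  then show ?thesis
    using lev_next lev by blast
qed

lemma dft_if [dfn_intros]:
  assumes "dfn P" "dft a" "dft b"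
  shows "dft (\<lambda>e. if P e then a e else b e)"
proof -
  have "dfn (\<lambda>e. P (\<lambda>i. e (Suc i)))"
    using dfn_rename[OF assms(1), of Suc] .
  then have "dfn (\<lambda>e. (P (\<lambda>i. e (Suc i)) \<and> e 0 = a (\<lambda>i. e (Suc i))) \<or>
      (\<not> P (\<lambda>i. e (Suc i)) \<and> e 0 = b (\<lambda>i. e (Suc i))))"
    using assms(2,3) unfolding dft_def by (intro dfn_disj dfn_conj dfn_not)
  then show ?thesis
    unfolding dft_def by (rule back_subst[of dfn]) auto
qed

text \<open>Foundation speaks of sets, so a minimal counterexample to a class statement has to be
  sought inside a transitive set. That set is the union of the iterated unions of the singleton of
  \<open>a\<close>.\<close>

lemma transitive_superset: "\<exists>t. a \<epsilon> t \<and> (\<forall>x y. x \<epsilon> t \<longrightarrow> y \<epsilon> x \<longrightarrow> y \<epsilon> t)"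
proof -
  \<comment> \<open>Recursion through finite approximations. \<open>approx g n\<close> constrains
    the values of \<open>g\<close> up to and including \<open>n\<close> only, so two approximations
    need to agree just in the value at \<open>n\<close>.\<close>
  define approx where "approx g n \<longleftrightarrow> app g emp = upair a a \<and>
    (\<forall>k. k \<epsilon> n \<longrightarrow> app g (suc k) = uni (app g k))" for g n
  have da: "dft s \<Longrightarrow> dft t \<Longrightarrow> dfn (\<lambda>e. approx (s e) (t e))" for s t
    by (rule dfn2_subst[of approx]) (unfold approx_def, intro dfn_intros)
  have ex: "\<exists>g. approx g n" if "n \<epsilon> omega" for n
    using that
  proof (induction rule: omega_induct)
    case dfn
    show ?case
      by (intro dfn_intros da)
  next
    case emp
    have "dft1 (\<lambda>_. upair a a)"
      by (intro dfn_intros)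
    then have "app (lam omega (\<lambda>_. upair a a)) emp = upair a a"
      by (simp add: app_lam)
    then show ?case
      unfolding approx_def by auto
  next
    case (suc n)
    then obtain g where g: "approx g n"
      by blast
    define F where "F k = (if k = suc n then uni (app g n) else app g k)" for k
    have "dft1 F"
      unfolding F_def by (intro dfn_intros)
    then have F: "k \<epsilon> omega \<Longrightarrow> app (lam omega F) k = F k" for k
      by (simp add: app_lam)
    have "approx (lam omega F) (suc n)"
      unfolding approx_def
    proof (intro conjI allI impI)
      have "emp \<noteq> suc n"
        by (metis mem_emp mem_suc)
      then show "app (lam omega F) emp = upair a a"
        using g by (simp add: F F_def approx_def)
    next
      fix k assume k: "k \<epsilon> suc n"
      have "k \<epsilon> omega"
        using suc.hyps omega_mem[of "suc n" k] k by simp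
      moreover have "k \<noteq> suc n"
        using k mem_irrefl by metis
      ultimately show "app (lam omega F) (suc k) = uni (app (lam omega F) k)"
        using g k by (auto simp: F F_def suc_eq_iff approx_def)
    qed
    then show ?case
      by blast
  qed
  have "\<forall>g g'. approx g n \<longrightarrow> approx g' n \<longrightarrow> app g n = app g' n" if "n \<epsilon> omega" for n
    using that
  proof (induction rule: omega_induct)
    case dfn
    show ?case
      by (intro dfn_intros da)
  next
    case (suc n)
    have "approx g n \<and> app g (suc n) = uni (app g n)" if "approx g (suc n)" for g
      using that unfolding approx_def by simp
    with suc.IH show ?case
      by metis
  qed (simp add: approx_def)
  then have uniq: "app g n = app g' n" if "n \<epsilon> omega" "approx g n" "approx g' n" for n g g'
    using that by blast
  have "small {v. \<exists>n. n \<epsilon> omega \<and> (n \<epsilon> omega \<and> (\<exists>g. approx g n \<and> v = app g n))}"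
  proof (rule small_replace)
    show "dfn2 (\<lambda>n v. n \<epsilon> omega \<and> (\<exists>g. approx g n \<and> v = app g n))"
      by (intro dfn_intros da)
  qed (use uniq in blast)
  from ex_set[OF this] obtain t where t: "\<And>v. v \<epsilon> t \<longleftrightarrow> (\<exists>n g. n \<epsilon> omega \<and> approx g n \<and> v = app g n)"
    by blast
  obtain g where g: "approx g emp"
    using ex[OF emp_omega] ..
  then have "a \<epsilon> app g emp"
    by (simp add: approx_def)
  moreover have "app g emp \<epsilon> t"
    using t g emp_omega by blast
  ultimately have "a \<epsilon> uni t"
    unfolding mem_uni by blast
  moreover have "y \<epsilon> uni t" if xt: "x \<epsilon> uni t" and yx: "y \<epsilon> x" for x y
  proof -
    obtain v where v: "x \<epsilon> v" "v \<epsilon> t"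
      using xt unfolding mem_uni by blast
    then obtain n g where n: "n \<epsilon> omega" "approx g n" "x \<epsilon> app g n"
      using t[of v] by metis
    obtain g' where g': "approx g' (suc n)"
      using ex[OF suc_omega[OF n(1)]] ..
    then have "approx g' n"
      unfolding approx_def by simp
    then have "app g' n = app g n"
      using uniq n by blast
    moreover have "app g' (suc n) = uni (app g' n)"
      using g' unfolding approx_def by simp
    ultimately have "y \<epsilon> app g' (suc n)"
      using n(3) yx by auto
    moreover have "app g' (suc n) \<epsilon> t"
      using t g' suc_omega[OF n(1)] by blast
    ultimately show ?thesis
      unfolding mem_uni by blast
  qed
  ultimately show ?thesis
    by blast
qed

text \<open>Membership induction: within a transitive set, a minimal element that escapes all levels
  would have all its elements in levels, contrary to \<open>ex_lev_step\<close>.\<close>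

lemma ex_lev: "\<exists>s. lev s \<and> a \<epsilon> s"
proof (rule ccontr)
  assume a: "\<not> (\<exists>s. lev s \<and> a \<epsilon> s)"
  obtain t where t: "a \<epsilon> t" "\<And>x y. x \<epsilon> t \<Longrightarrow> y \<epsilon> x \<Longrightarrow> y \<epsilon> t"
    using transitive_superset by blast
  have "dfn1 (\<lambda>a. \<not> (\<exists>s. lev s \<and> a \<epsilon> s))"
    by (intro dfn_intros)
  from minimal_element[OF this t(1) a] obtain m
    where "m \<epsilon> t" "\<not> (\<exists>s. lev s \<and> m \<epsilon> s)"
      "\<And>y. y \<epsilon> m \<Longrightarrow> y \<epsilon> t \<Longrightarrow> \<exists>s. lev s \<and> y \<epsilon> s"
    by blast
  then show False
    using ex_lev_step t(2) by blast
qed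

text \<open>Replacement is applied to the least level that holds a witness. The result bounds the
  candidates among which dependent choice may select, as in \<open>countable_choice\<close> and
  \<open>fusion\<close>.\<close>

lemma collection:
  assumes "dfn2 P" "\<And>x. x \<epsilon> a \<Longrightarrow> \<exists>y. P x y"
  shows "\<exists>c. \<forall>x. x \<epsilon> a \<longrightarrow> (\<exists>y. y \<epsilon> c \<and> P x y)"
proof -
  let ?Q = "\<lambda>x l. \<exists>y. y \<epsilon> l \<and> P x y"
  have Q: "dfn2 ?Q"
    by (intro dfn_intros dfn2_subst[OF assms(1)])
  obtain d where d: "\<And>l. l \<epsilon> d \<longleftrightarrow> (\<exists>x. x \<epsilon> a \<and> least_lev (?Q x) l)"
    using ex_set[OF small_least_levs[OF Q]] by blast
  have "\<exists>y. y \<epsilon> uni d \<and> P x y" if x: "x \<epsilon> a" for x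
  proof -
    obtain y where y: "P x y"
      using assms(2) x by blast
    obtain s where "lev s" "y \<epsilon> s"
      using ex_lev by blast
    moreover have "dfn1 (?Q x)"
      by (intro dfn_intros dfn2_subst[OF assms(1)])
    ultimately obtain l where l: "least_lev (?Q x) l"
      using ex_least_lev[of "?Q x" s] y by blast
    then have "l \<epsilon> d"
      using d x by blast
    with l show ?thesis
      unfolding least_lev_def mem_uni by blast
  qed
  then show ?thesis
    by blast
qed

subsection \<open>Dependent choice\<close>

lemma sat_upair_fm [simp]: "sat (\<epsilon>) e (upair_fm z x y) \<longleftrightarrow> e z = upair (e x) (e y)"
  using mem_eqI[of "e z" "upair (e x) (e y)"] by (auto simp: upair_fm_def)

lemma sat_opair_fm [simp]: "sat (\<epsilon>) e (opair_fm p x y) \<longleftrightarrow> e p = op (e x) (e y)"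
  using mem_eqI[of "e p" "op (e x) (e y)"] by (auto simp: opair_fm_def op_def)

lemma sat_related_fm [simp]: "sat (\<epsilon>) e (related_fm r x y) \<longleftrightarrow> op (e x) (e y) \<epsilon> e r"
  by (simp add: related_fm_def)

lemma sat_function_fm [simp]: "sat (\<epsilon>) e (function_fm f) \<longleftrightarrow>
    (\<forall>p. p \<epsilon> e f \<longrightarrow> (\<exists>x y. p = op x y)) \<and>
    (\<forall>x y z. op x y \<epsilon> e f \<longrightarrow> op x z \<epsilon> e f \<longrightarrow> y = z)"
  by (simp add: function_fm_def eval_nat_numeral)

lemma sat_domain_fm [simp]: "sat (\<epsilon>) e (domain_fm f d) \<longleftrightarrow>
    (\<forall>x. x \<epsilon> e d \<longleftrightarrow> (\<exists>y. op x y \<epsilon> e f))"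
  by (simp add: domain_fm_def) blast

lemma sat_relation_on_fm [simp]: "sat (\<epsilon>) e (relation_on_fm r a) \<longleftrightarrow>
    (\<forall>p. p \<epsilon> e r \<longrightarrow> (\<exists>x y. x \<epsilon> e a \<and> y \<epsilon> e a \<and> p = op x y))"
  by (simp add: relation_on_fm_def eval_nat_numeral)

lemma ADC:
  assumes r: "\<And>p. p \<epsilon> r \<Longrightarrow> \<exists>x y. x \<epsilon> a \<and> y \<epsilon> a \<and> p = op x y"
    and total: "\<And>x. x \<epsilon> a \<Longrightarrow> \<exists>y. y \<epsilon> a \<and> op x y \<epsilon> r" and "x \<epsilon> a"
  shows "\<exists>s. app s emp = x \<and> (\<forall>n. n \<epsilon> omega \<longrightarrow> op (app s n) (app s (suc n)) \<epsilon> r)"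
proof -
  have "sat (\<epsilon>) (\<lambda>_. emp) ADC"
    using ZFc by (simp add: ZFc_def)
  then have *: "(\<forall>p. p \<epsilon> r \<longrightarrow> (\<exists>x y. x \<epsilon> a \<and> y \<epsilon> a \<and> p = op x y)) \<and>
      (\<forall>x. x \<epsilon> a \<longrightarrow> (\<exists>y. y \<epsilon> a \<and> op x y \<epsilon> r)) \<longrightarrow>
      (\<forall>x. x \<epsilon> a \<longrightarrow> (\<exists>s. (\<forall>x y z. op x y \<epsilon> s \<longrightarrow> op x z \<epsilon> s \<longrightarrow> y = z) \<and> op emp x \<epsilon> s \<and>
        (\<forall>n. n \<epsilon> omega \<longrightarrow> (\<exists>u v. op n u \<epsilon> s \<and> op (suc n) v \<epsilon> s \<and> op u v \<epsilon> r))))"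
    unfolding ADC_def
    by (simp add: eval_nat_numeral, drule_tac x = a in spec, drule_tac x = r in spec)
      (intro impI allI, drule (1) mp, drule spec, drule (1) mp, elim exE conjE, rule exI,
        intro conjI, assumption, assumption, blast)
  have "\<forall>p. p \<epsilon> r \<longrightarrow> (\<exists>x y. x \<epsilon> a \<and> y \<epsilon> a \<and> p = op x y)"
    "\<forall>x. x \<epsilon> a \<longrightarrow> (\<exists>y. y \<epsilon> a \<and> op x y \<epsilon> r)"
    using r total by blast+
  from *[THEN mp, OF conjI, OF this, THEN spec, THEN mp, OF assms(3)] obtain s
    where s1: "\<forall>x y z. op x y \<epsilon> s \<longrightarrow> op x z \<epsilon> s \<longrightarrow> y = z" and s2: "op emp x \<epsilon> s"
      and s3: "\<forall>n. n \<epsilon> omega \<longrightarrow> (\<exists>u v. op n u \<epsilon> s \<and> op (suc n) v \<epsilon> s \<and> op u v \<epsilon> r)"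
    by (elim exE conjE)
  have eq: "app s n = y" if "op n y \<epsilon> s" for n y
    using app_eq[of n y s] that s1 by blast
  have "op (app s n) (app s (suc n)) \<epsilon> r" if n: "n \<epsilon> omega" for n
  proof -
    obtain u v where "op n u \<epsilon> s" "op (suc n) v \<epsilon> s" "op u v \<epsilon> r"
      using s3 n by blast
    then show ?thesis
      using eq by simp
  qed
  with eq[OF s2] show ?thesis
    by blast
qed

lemma dependent_choice:
  assumes "dfn2 R" "\<And>x. x \<epsilon> a \<Longrightarrow> \<exists>y. y \<epsilon> a \<and> R x y" "x \<epsilon> a"
  shows "\<exists>s. app s emp = x \<and>
    (\<forall>n. n \<epsilon> omega \<longrightarrow> app s n \<epsilon> a \<and> app s (suc n) \<epsilon> a \<and> R (app s n) (app s (suc n)))"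
proof -
  have "small {p. \<exists>x y. x \<epsilon> a \<and> y \<epsilon> a \<and> R x y \<and> p = op x y}"
    by (rule small_subset[OF small_prod[of a a]]) (intro dfn_intros dfn2_subst[OF assms(1)], blast)
  from ex_set[OF this] obtain r where r: "\<And>p. p \<epsilon> r \<longleftrightarrow> (\<exists>x y. x \<epsilon> a \<and> y \<epsilon> a \<and> R x y \<and> p = op x y)"
    by blast
  have r2: "op x y \<epsilon> r \<longleftrightarrow> x \<epsilon> a \<and> y \<epsilon> a \<and> R x y" for x y
    unfolding r by auto
  have "\<exists>s. app s emp = x \<and> (\<forall>n. n \<epsilon> omega \<longrightarrow> op (app s n) (app s (suc n)) \<epsilon> r)"
  proof (rule ADC)
    show "\<exists>x y. x \<epsilon> a \<and> y \<epsilon> a \<and> p = op x y" if "p \<epsilon> r" for p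
      using that unfolding r by blast
    show "\<exists>y. y \<epsilon> a \<and> op x y \<epsilon> r" if "x \<epsilon> a" for x
      using assms(2)[OF that] that unfolding r2 by blast
  qed (rule assms(3))
  then show ?thesis
    unfolding r2 by blast
qed


section \<open>Projections, dependent choice along \<open>omega\<close> and countable choice\<close>

lemma mem_uni_op: "x \<epsilon> uni (op x y)" "y \<epsilon> uni (op x y)"
  unfolding mem_uni op_def by (rule exI[of _ "upair x y"], simp)+

lemma small_fst: "small {w. \<exists>x y. z = op x y \<and> w \<epsilon> x}"
proof (rule small_subset[OF small_uni[of "uni z"]])
  show "w \<in> {v. \<exists>y. v \<epsilon> y \<and> y \<epsilon> uni z}" if "\<exists>x y. z = op x y \<and> w \<epsilon> x" for w
    using that mem_uni_op(1) by blast
qed (intro dfn_intros)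

lemma small_snd: "small {w. \<exists>x y. z = op x y \<and> w \<epsilon> y}"
proof (rule small_subset[OF small_uni[of "uni z"]])
  show "w \<in> {v. \<exists>y. v \<epsilon> y \<and> y \<epsilon> uni z}" if "\<exists>x y. z = op x y \<and> w \<epsilon> y" for w
    using that mem_uni_op(2) by blast
qed (intro dfn_intros)

definition fst :: "'a \<Rightarrow> 'a" where
  "fst z = setof {w. \<exists>x y. z = op x y \<and> w \<epsilon> x}"

definition snd :: "'a \<Rightarrow> 'a" where
  "snd z = setof {w. \<exists>x y. z = op x y \<and> w \<epsilon> y}"

lemma mem_fst: "w \<epsilon> fst z \<longleftrightarrow> (\<exists>x y. z = op x y \<and> w \<epsilon> x)"
  using mem_setof[OF small_fst] by (simp add: fst_def)

lemma mem_snd: "w \<epsilon> snd z \<longleftrightarrow> (\<exists>x y. z = op x y \<and> w \<epsilon> y)"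
  using mem_setof[OF small_snd] by (simp add: snd_def)

lemma fst_op [simp]: "fst (op x y) = x"
  by (rule mem_eqI) (simp add: mem_fst)

lemma snd_op [simp]: "snd (op x y) = y"
  by (rule mem_eqI) (simp add: mem_snd)

lemma dft_fst [dfn_intros]: "dft a \<Longrightarrow> dft (\<lambda>e. fst (a e))"
  by (rule dft1_subst[of fst]) (unfold fst_def, intro dft_setof small_fst dfn_intros)

lemma dft_snd [dfn_intros]: "dft a \<Longrightarrow> dft (\<lambda>e. snd (a e))"
  by (rule dft1_subst[of snd]) (unfold snd_def, intro dft_setof small_snd dfn_intros)

text \<open>The relation in dependent choice does not know how many steps have been made. The stage
  number therefore travels as the first component of a pair and is incremented at each step.\<close>

lemma omega_dependent_choice:
  assumes R: "dfn3 R" and total: "\<And>n x. n \<epsilon> omega \<Longrightarrow> x \<epsilon> a \<Longrightarrow> \<exists>y. y \<epsilon> a \<and> R n x y"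
    and "x \<epsilon> a"
  shows "\<exists>s. app s emp = x \<and> (\<forall>n. n \<epsilon> omega \<longrightarrow> app s n \<epsilon> a \<and> R n (app s n) (app s (suc n)))"
proof -
  define S where "S z w \<longleftrightarrow> (\<exists>n x y. z = op n x \<and> w = op (suc n) y \<and> R n x y)" for z w
  have "dfn2 S"
    unfolding S_def by (intro dfn_intros dfn3_subst[OF R])
  moreover have "\<exists>w. w \<epsilon> prod omega a \<and> S z w" if z: "z \<epsilon> prod omega a" for z
  proof -
    obtain n x where n: "n \<epsilon> omega" "x \<epsilon> a" "z = op n x"
      using z unfolding mem_prod by blast
    then obtain y where "y \<epsilon> a" "R n x y"
      using total by blast
    then have "op (suc n) y \<epsilon> prod omega a" "S z (op (suc n) y)"
      using n suc_omega unfolding mem_prod S_def by blast+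
    then show ?thesis
      by blast
  qed
  moreover have "op emp x \<epsilon> prod omega a"
    using assms(3) emp_omega unfolding mem_prod by blast
  ultimately obtain s where s: "app s emp = op emp x"
      "\<And>n. n \<epsilon> omega \<Longrightarrow> app s n \<epsilon> prod omega a" "\<And>n. n \<epsilon> omega \<Longrightarrow> S (app s n) (app s (suc n))"
    using dependent_choice[of S "prod omega a" "op emp x"] by blast
  have fst_s: "fst (app s n) = n" if "n \<epsilon> omega" for n
    using that
  proof (induction rule: omega_induct)
    case dfn
    show ?case
      by (intro dfn_intros)
  next
    case (suc n)
    then show ?case
      using s(3)[OF suc.hyps] unfolding S_def by auto
  qed (simp add: s(1))
  define t where "t = lam omega (\<lambda>n. snd (app s n))"
  have t: "app t n = snd (app s n)" if "n \<epsilon> omega" for n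
    unfolding t_def by (rule app_lam[OF _ that]) (intro dfn_intros)
  have "app t n \<epsilon> a \<and> R n (app t n) (app t (suc n))" if n: "n \<epsilon> omega" for n
  proof
    obtain m x where "x \<epsilon> a" "app s n = op m x"
      using s(2)[OF n] unfolding mem_prod by blast
    then show "app t n \<epsilon> a"
      using t n by simp
    obtain m x y where "app s n = op m x" "app s (suc n) = op (suc m) y" "R m x y"
      using s(3)[OF n] unfolding S_def by blast
    then show "R n (app t n) (app t (suc n))"
      using t n fst_s[OF n] by simp
  qed
  moreover have "app t emp = x"
    by (simp add: t s(1))
  ultimately show ?thesis
    by blast
qed

lemma countable_choice:
  assumes P: "dfn2 P" and total: "\<And>n. n \<epsilon> omega \<Longrightarrow> \<exists>x. P n x"
  shows "\<exists>f. \<forall>n. n \<epsilon> omega \<longrightarrow> P n (app f n)"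
proof -
  obtain c where c: "\<And>n. n \<epsilon> omega \<Longrightarrow> \<exists>x. x \<epsilon> c \<and> P n x"
    using collection[OF P, of omega] total by blast
  obtain x where x: "x \<epsilon> c"
    using c[OF emp_omega] by blast
  \<comment> \<open>The predecessor is ignored. The start of the sequence is arbitrary, so the value
    chosen for \<open>n\<close> appears at place \<open>suc n\<close>.\<close>
  have R: "dfn3 (\<lambda>n x y. P n y)"
    by (intro dfn2_subst[OF P] dfn_intros)
  obtain s where s: "\<And>n. n \<epsilon> omega \<Longrightarrow> P n (app s (suc n))"
    using omega_dependent_choice[OF R c x] by blast
  have "app (lam omega (\<lambda>n. app s (suc n))) n = app s (suc n)" if "n \<epsilon> omega" for n
    by (rule app_lam[OF _ that]) (intro dfn_intros)
  with s show ?thesis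
    by metis
qed

subsection \<open>Conditions\<close>

definition cond :: "'a \<Rightarrow> bool" where
  "cond p \<longleftrightarrow> sub p omega \<and> (\<forall>n. n \<epsilon> omega \<longrightarrow> (\<exists>m. m \<epsilon> p \<and> n \<epsilon> m))"

definition le :: "'a \<Rightarrow> 'a \<Rightarrow> bool" where
  "le q p \<longleftrightarrow> cond q \<and> sub q p"

text \<open>\<open>aa\<close> is short for "almost all": inclusion of \<open>p\<close> in
  \<open>P\<close> modulo a bounded set.\<close>

definition aa :: "'a \<Rightarrow> ('a \<Rightarrow> bool) \<Rightarrow> bool" where
  "aa p P \<longleftrightarrow> (\<exists>k. k \<epsilon> omega \<and> (\<forall>n. n \<epsilon> p \<longrightarrow> k \<epsilon> n \<longrightarrow> P n))"

lemma dfn_cond [dfn_intros]: "dft a \<Longrightarrow> dfn (\<lambda>e. cond (a e))"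
  by (rule dfn1_subst[of cond]) (unfold cond_def, intro dfn_intros)

lemma dfn_le [dfn_intros]: "dft a \<Longrightarrow> dft b \<Longrightarrow> dfn (\<lambda>e. le (a e) (b e))"
  unfolding le_def by (intro dfn_intros)

lemma dfn_aa [dfn_intros]:
  assumes "dft p" "dfn (\<lambda>e. Q (e 0) (\<lambda>i. e (Suc i)))"
  shows "dfn (\<lambda>e. aa (p e) (\<lambda>n. Q n e))"
proof -
  have 1: "dft (\<lambda>e. p (\<lambda>i. e (Suc (Suc i))))"
    using dft_weaken[OF dft_weaken[OF assms(1)]] by simp
  have 2: "dfn (\<lambda>e. Q (e 0) (\<lambda>i. e (Suc (Suc i))))"
    using dfn_rename[OF assms(2), of "case_nat 0 (\<lambda>i. Suc (Suc i))"] by simp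
  show ?thesis
    unfolding aa_def by (intro dfn_intros 1 2)
qed

lemma le_refl: "cond p \<Longrightarrow> le p p"
  by (simp add: le_def)

lemma le_trans: "le r q \<Longrightarrow> le q p \<Longrightarrow> le r p"
  unfolding le_def using sub_trans by blast

lemma le_cond: "le q p \<Longrightarrow> cond q"
  by (simp add: le_def)

lemma le_mem: "le q p \<Longrightarrow> n \<epsilon> q \<Longrightarrow> n \<epsilon> p"
  by (simp add: le_def sub_def)

lemma cond_mem: "cond p \<Longrightarrow> n \<epsilon> p \<Longrightarrow> n \<epsilon> omega"
  by (simp add: cond_def sub_def)

lemma cond_omega: "cond omega"
proof -
  have "n \<epsilon> suc n" for n
    by simp
  then show ?thesis
    unfolding cond_def using suc_omega sub_refl by blast
qed

lemma le_omega: "cond p \<Longrightarrow> le p omega"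
  by (simp add: le_def cond_def)

lemma ex_max:
  assumes "k \<epsilon> omega" "l \<epsilon> omega"
  obtains m where "m \<epsilon> omega" "\<And>n. n \<epsilon> omega \<Longrightarrow> m \<epsilon> n \<Longrightarrow> k \<epsilon> n \<and> l \<epsilon> n"
proof (cases "k \<epsilon> l")
  case True
  show ?thesis
    by (rule that[OF assms(2)]) (use True omega_trans in blast)
next
  case False
  then have "l \<epsilon> k \<or> l = k"
    using omega_linear assms by blast
  then show ?thesis
    by (intro that[OF assms(1)]) (use omega_trans in blast)
qed

lemma aaI: "(\<And>n. n \<epsilon> p \<Longrightarrow> P n) \<Longrightarrow> aa p P"
  unfolding aa_def using emp_omega by blast

lemma aa_le: "aa p P \<Longrightarrow> le q p \<Longrightarrow> aa q P"
  unfolding aa_def using le_mem by blast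

lemma aa_conj:
  assumes "cond p" "aa p P" "aa p Q" "\<And>n. n \<epsilon> p \<Longrightarrow> P n \<Longrightarrow> Q n \<Longrightarrow> R n"
  shows "aa p R"
proof -
  obtain k where k: "k \<epsilon> omega" "\<And>n. n \<epsilon> p \<Longrightarrow> k \<epsilon> n \<Longrightarrow> P n"
    using assms(2) unfolding aa_def by blast
  obtain l where l: "l \<epsilon> omega" "\<And>n. n \<epsilon> p \<Longrightarrow> l \<epsilon> n \<Longrightarrow> Q n"
    using assms(3) unfolding aa_def by blast
  obtain m where m: "m \<epsilon> omega" "\<And>n. n \<epsilon> omega \<Longrightarrow> m \<epsilon> n \<Longrightarrow> k \<epsilon> n \<and> l \<epsilon> n"
    using ex_max[OF k(1) l(1)] by metis
  have "R n" if "n \<epsilon> p" "m \<epsilon> n" for n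
    using m(2)[OF cond_mem[OF assms(1) that(1)] that(2)] k(2) l(2) assms(4) that(1) by blast
  with m(1) show ?thesis
    unfolding aa_def by blast
qed

lemma aa_weaken: "aa p P \<Longrightarrow> (\<And>n. n \<epsilon> p \<Longrightarrow> P n \<Longrightarrow> Q n) \<Longrightarrow> aa p Q"
  unfolding aa_def by blast

lemma aa_trans:
  assumes "cond q" "aa p P" "aa q (\<lambda>n. n \<epsilon> p)"
  shows "aa q P"
proof -
  obtain k where k: "k \<epsilon> omega" "\<And>n. n \<epsilon> p \<Longrightarrow> k \<epsilon> n \<Longrightarrow> P n"
    using assms(2) unfolding aa_def by blast
  then have "aa q (\<lambda>n. k \<epsilon> n)"
    unfolding aa_def by blast
  from aa_conj[OF assms(1) assms(3) this] k(2) show ?thesis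
    by blast
qed

lemma aa_ex:
  assumes "cond p" "aa p P"
  shows "\<exists>n. n \<epsilon> p \<and> n \<epsilon> omega \<and> P n"
proof -
  obtain k where "k \<epsilon> omega" "\<And>n. n \<epsilon> p \<Longrightarrow> k \<epsilon> n \<Longrightarrow> P n"
    using assms(2) unfolding aa_def by blast
  moreover from this obtain n where "n \<epsilon> p" "k \<epsilon> n"
    using assms(1) unfolding cond_def by blast
  ultimately show ?thesis
    using cond_mem assms(1) by blast
qed

lemma aa_const: "cond p \<Longrightarrow> aa p (\<lambda>_. b) \<longleftrightarrow> b"
  using aa_ex[of p "\<lambda>_. b"] aaI[of p "\<lambda>_. b"] by blast

text \<open>That no bound works means that the points of \<open>p\<close> where \<open>P\<close>
  fails are unbounded; definability of \<open>P\<close> makes them a set of the model, hence a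
  condition.\<close>

lemma not_aa:
  assumes "cond p" "dfn1 P" "\<not> aa p P"
  obtains q where "le q p" "\<And>n. n \<epsilon> q \<Longrightarrow> \<not> P n"
proof -
  have "small {n. n \<epsilon> p \<and> \<not> P n}"
    by (intro small_sep dfn_not assms(2))
  from ex_set[OF this] obtain q where q: "\<And>n. n \<epsilon> q \<longleftrightarrow> n \<epsilon> p \<and> \<not> P n"
    by blast
  have "sub q p"
    using q unfolding sub_def by blast
  moreover have "cond q"
    unfolding cond_def
  proof (intro conjI allI impI)
    show "sub q omega"
      using \<open>sub q p\<close> assms(1) sub_trans unfolding cond_def by blast
    show "\<exists>m. m \<epsilon> q \<and> n \<epsilon> m" if "n \<epsilon> omega" for n
      using assms(3) that q unfolding aa_def by blast
  qed
  ultimately show ?thesis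
    using that q unfolding le_def by blast
qed

text \<open>If \<open>P\<close> failed unboundedly often on \<open>p\<close>, the points of failure
  would form a condition below which \<open>P\<close> can hold almost nowhere. This gives the atomic
  cases of \<open>forces_dense\<close>.\<close>

lemma aa_dense:
  assumes "cond p" "dfn1 P" "\<And>q. le q p \<Longrightarrow> \<exists>r. le r q \<and> aa r P"
  shows "aa p P"
proof (rule ccontr)
  assume "\<not> aa p P"
  then obtain q where q: "le q p" "\<And>n. n \<epsilon> q \<Longrightarrow> \<not> P n"
    using not_aa[OF assms(1,2)] by blast
  then obtain r where r: "le r q" "aa r P"
    using assms(3) by blast
  then show False
    using aa_ex[OF le_cond[OF r(1)] r(2)] q(2) le_mem by blast
qed

text \<open>Diagonalization: \<open>r\<close> consists of the least element of \<open>Q n\<close>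
  above \<open>n\<close>, for all \<open>n\<close>. Taking the least one avoids choice. Points
  chosen at stage \<open>n\<close> or later lie in \<open>Q n\<close> since the sequence decreases,
  and those chosen earlier are bounded, by an induction inside the model.\<close>

lemma pseudo_intersection:
  assumes Q: "dft1 Q" and cond: "\<And>n. n \<epsilon> omega \<Longrightarrow> cond (Q n)"
    and dec: "\<And>n. n \<epsilon> omega \<Longrightarrow> sub (Q (suc n)) (Q n)"
  shows "\<exists>r. le r (Q emp) \<and> (\<forall>n. n \<epsilon> omega \<longrightarrow> aa r (\<lambda>m. m \<epsilon> Q n))"
proof -
  have "\<forall>m. m \<epsilon> n \<longrightarrow> sub (Q n) (Q m)" if "n \<epsilon> omega" for n
    using that
  proof (induction rule: omega_induct)
    case dfn
    show ?case
      by (intro dfn_intros dft1_subst[OF Q])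
  next
    case (suc n)
    then show ?case
      using dec[OF suc.hyps] sub_trans unfolding mem_suc by blast
  qed simp
  then have anti: "sub (Q n) (Q m)" if "n \<epsilon> omega" "m \<epsilon> n" for m n
    using that by blast
  define first where "first n x \<longleftrightarrow> x \<epsilon> Q n \<and> n \<epsilon> x \<and> (\<forall>y. y \<epsilon> x \<longrightarrow> y \<epsilon> Q n \<longrightarrow> \<not> n \<epsilon> y)" for n x
  have dfirst: "dft s \<Longrightarrow> dft t \<Longrightarrow> dfn (\<lambda>e. first (s e) (t e))" for s t
    by (rule dfn2_subst[of first]) (unfold first_def, intro dfn_intros dft1_subst[OF Q])
  have ex_first: "\<exists>x. first n x" if n: "n \<epsilon> omega" for n
  proof -
    obtain x where x: "x \<epsilon> Q n" "n \<epsilon> x"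
      using cond[OF n] n unfolding cond_def by blast
    have "dfn1 (\<lambda>x. n \<epsilon> x)"
      by (intro dfn_intros)
    from minimal_element[OF this x] show ?thesis
      unfolding first_def by blast
  qed
  have first_unique: "x = y" if "n \<epsilon> omega" "first n x" "first n y" for n x y
    using that omega_linear[of x y] cond_mem[OF cond[OF that(1)]] unfolding first_def by blast
  have bound: "\<exists>b. b \<epsilon> omega \<and> (\<forall>m x. m \<epsilon> n \<longrightarrow> first m x \<longrightarrow> x \<epsilon> b)" if "n \<epsilon> omega" for n
    using that
  proof (induction rule: omega_induct)
    case dfn
    show ?case
      by (intro dfn_intros dfirst)
  next
    case emp
    show ?case
      using emp_omega mem_emp by blast
  next
    case (suc n)
    then obtain b where b: "b \<epsilon> omega" "\<And>m x. m \<epsilon> n \<Longrightarrow> first m x \<Longrightarrow> x \<epsilon> b"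
      by blast
    obtain y where y: "first n y"
      using ex_first suc.hyps by blast
    then have "y \<epsilon> omega"
      using cond_mem cond suc.hyps unfolding first_def by blast
    then obtain c where c: "c \<epsilon> omega" "\<And>z. z \<epsilon> omega \<Longrightarrow> c \<epsilon> z \<Longrightarrow> b \<epsilon> z \<and> y \<epsilon> z"
      using ex_max[OF b(1)] by metis
    then have sc: "b \<epsilon> suc c" "y \<epsilon> suc c"
      using c(2)[of "suc c"] suc_omega[OF c(1)] by auto
    have "x \<epsilon> suc c" if "m \<epsilon> suc n" "first m x" for m x
    proof (cases "m = n")
      case True
      then show ?thesis
        using first_unique[OF suc.hyps _ y] that(2) sc(2) by blast
    next
      case False
      then have "x \<epsilon> b"
        using b(2) that by simp
      then show ?thesis
        using omega_trans[OF suc_omega[OF c(1)] _ sc(1)] by blast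
    qed
    then show ?case
      using suc_omega[OF c(1)] by blast
  qed
  have "small {x. x \<epsilon> omega \<and> (\<exists>n. n \<epsilon> omega \<and> first n x)}"
    by (intro small_sep dfn_intros dfirst)
  from ex_set[OF this] obtain r
    where r: "\<And>x. x \<epsilon> r \<longleftrightarrow> x \<epsilon> omega \<and> (\<exists>n. n \<epsilon> omega \<and> first n x)"
    by blast
  have "cond r"
    unfolding cond_def
  proof (intro conjI allI impI)
    show "sub r omega"
      unfolding sub_def r by blast
    fix n assume n: "n \<epsilon> omega"
    obtain x where x: "first n x"
      using ex_first[OF n] ..
    then have "x \<epsilon> r"
      unfolding r using n cond_mem[OF cond[OF n]] unfolding first_def by blast
    then show "\<exists>m. m \<epsilon> r \<and> n \<epsilon> m"
      using x unfolding first_def by blast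
  qed
  moreover have "sub r (Q emp)"
    unfolding sub_def
  proof (intro allI impI)
    fix x assume "x \<epsilon> r"
    then obtain n where "n \<epsilon> omega" "x \<epsilon> Q n"
      unfolding r first_def by blast
    then show "x \<epsilon> Q emp"
      using emp_least[of n] anti[of n emp] subD by blast
  qed
  moreover have "aa r (\<lambda>x. x \<epsilon> Q n)" if n: "n \<epsilon> omega" for n
  proof -
    obtain b where b: "b \<epsilon> omega" "\<And>m x. m \<epsilon> n \<Longrightarrow> first m x \<Longrightarrow> x \<epsilon> b"
      using bound[OF n] by blast
    have "x \<epsilon> Q n" if x: "x \<epsilon> r" "b \<epsilon> x" for x
    proof -
      obtain m where m: "m \<epsilon> omega" "first m x"
        using x(1) unfolding r by blast
      then have "\<not> m \<epsilon> n"
        using b(2) x(2) mem_asym by blast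
      then have "m = n \<or> n \<epsilon> m"
        using omega_linear m(1) n by blast
      then show ?thesis
        using m anti[OF m(1)] subD unfolding first_def by blast
    qed
    with b(1) show ?thesis
      unfolding aa_def by blast
  qed
  ultimately show ?thesis
    unfolding le_def by blast
qed

text \<open>Read \<open>D k r g\<close> as: below \<open>r\<close>, the name \<open>g\<close>
  answers question \<open>k\<close>. A descending sequence answers the questions one by one, and a
  pseudo-intersection of it inherits all answers, since they survive passing to a condition that is
  almost included.\<close>

lemma fusion:
  assumes D: "dfn3 D"
    and mono: "\<And>k q r g. D k r g \<Longrightarrow> cond q \<Longrightarrow> aa q (\<lambda>n. n \<epsilon> r) \<Longrightarrow> D k q g"
    and dense: "\<And>k q. k \<epsilon> omega \<Longrightarrow> le q p \<Longrightarrow> \<exists>r g. le r q \<and> D k r g"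
    and "cond p"
  shows "\<exists>r g. le r p \<and> (\<forall>k. k \<epsilon> omega \<longrightarrow> D k r (app g k))"
proof -
  \<comment> \<open>Question and condition are coded as one pair, because \<open>collection\<close>
    has a single index. For any other \<open>u\<close> the statement holds vacuously.\<close>
  define P where "P u g \<longleftrightarrow> (\<forall>k q. u = op k q \<longrightarrow> k \<epsilon> omega \<longrightarrow> le q p \<longrightarrow> (\<exists>r. le r q \<and> D k r g))"
    for u g
  have "dfn2 P"
    unfolding P_def by (intro dfn_intros dfn3_subst[OF D])
  moreover have "\<exists>g. P u g" for u
  proof (cases "\<exists>k q. u = op k q \<and> k \<epsilon> omega \<and> le q p")
    case True
    then obtain k q where u: "u = op k q" "k \<epsilon> omega" "le q p"
      by blast
    then obtain r g where "le r q" "D k r g"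
      using dense by blast
    then have "P u g"
      unfolding P_def u(1) op_eq_iff by blast
    then show ?thesis ..
  qed (use P_def in blast)
  ultimately obtain c where c: "\<And>u. u \<epsilon> prod omega (pow omega) \<Longrightarrow> \<exists>g. g \<epsilon> c \<and> P u g"
    using collection[of P "prod omega (pow omega)"] by blast
  have c': "\<exists>g r. g \<epsilon> c \<and> le r q \<and> D k r g" if k: "k \<epsilon> omega" and q: "le q p" for k q
  proof -
    have "q \<epsilon> pow omega"
      using le_cond[OF q] by (simp add: cond_def)
    then have "op k q \<epsilon> prod omega (pow omega)"
      using k unfolding mem_prod by blast
    then obtain g where "g \<epsilon> c" "P (op k q) g"
      using c by blast
    then show ?thesis
      unfolding P_def using k q by blast
  qed
  have "small {z. \<exists>q f. le q p \<and> f \<epsilon> c \<and> z = op q f}"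
  proof (rule small_subset[OF small_prod[of "pow omega" c]])
    show "z \<in> {z. \<exists>q f. q \<epsilon> pow omega \<and> f \<epsilon> c \<and> z = op q f}"
      if "\<exists>q f. le q p \<and> f \<epsilon> c \<and> z = op q f" for z
      using that le_omega[OF le_cond] unfolding mem_pow le_def by blast
  qed (intro dfn_intros)
  from ex_set[OF this] obtain a where a: "\<And>z. z \<epsilon> a \<longleftrightarrow> (\<exists>q f. le q p \<and> f \<epsilon> c \<and> z = op q f)"
    by blast
  define R where "R n x y \<longleftrightarrow> (\<exists>q f r g. x = op q f \<and> y = op r g \<and> le r q \<and> D n r g)" for n x y
  have R: "dfn3 R"
    unfolding R_def by (intro dfn_intros dfn3_subst[OF D])
  have total: "\<exists>y. y \<epsilon> a \<and> R n x y" if n: "n \<epsilon> omega" and x: "x \<epsilon> a" for n x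
  proof -
    obtain q f where q: "le q p" "f \<epsilon> c" "x = op q f"
      using x unfolding a by blast
    obtain g r where g: "g \<epsilon> c" "le r q" "D n r g"
      using c'[OF n q(1)] by blast
    then have "op r g \<epsilon> a"
      unfolding a using le_trans[OF g(2) q(1)] by blast
    moreover have "R n x (op r g)"
      unfolding R_def using q g by blast
    ultimately show ?thesis
      by blast
  qed
  obtain f where "f \<epsilon> c"
    using c'[OF emp_omega le_refl[OF assms(4)]] by blast
  then have start: "op p f \<epsilon> a"
    unfolding a using le_refl[OF assms(4)] by blast
  obtain s where s: "app s emp = op p f" "\<And>n. n \<epsilon> omega \<Longrightarrow> app s n \<epsilon> a"
      "\<And>n. n \<epsilon> omega \<Longrightarrow> R n (app s n) (app s (suc n))"
    using omega_dependent_choice[OF R total start] by blast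
  define Q where "Q n = fst (app s n)" for n
  have Q: "dft1 Q"
    unfolding Q_def by (intro dfn_intros)
  have step: "le (Q (suc n)) (Q n) \<and> D n (Q (suc n)) (snd (app s (suc n)))" if n: "n \<epsilon> omega" for n
  proof -
    obtain q f r g where "app s n = op q f" "app s (suc n) = op r g" "le r q" "D n r g"
      using s(3)[OF n] unfolding R_def by blast
    then show ?thesis
      by (simp add: Q_def)
  qed
  have condQ: "cond (Q n)" if n: "n \<epsilon> omega" for n
  proof -
    obtain q f where "le q p" "app s n = op q f"
      using s(2)[OF n] unfolding a by blast
    then show ?thesis
      by (simp add: Q_def le_def)
  qed
  have "Q emp = p"
    by (simp add: Q_def s(1))
  then obtain r where r: "le r p" "\<And>n. n \<epsilon> omega \<Longrightarrow> aa r (\<lambda>m. m \<epsilon> Q n)"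
    using pseudo_intersection[OF Q condQ] step unfolding le_def by metis
  \<comment> \<open>Question \<open>n\<close> is answered in the step from \<open>n\<close> to
    \<open>suc n\<close>; hence the shift by one.\<close>
  have "app (lam omega (\<lambda>n. snd (app s (suc n)))) n = snd (app s (suc n))" if "n \<epsilon> omega" for n
    by (rule app_lam[OF _ that]) (intro dfn_intros)
  then have "D n r (app (lam omega (\<lambda>n. snd (app s (suc n)))) n)" if "n \<epsilon> omega" for n
    using mono[OF _ le_cond[OF r(1)] r(2)[OF suc_omega[OF that]]] step[OF that] that by simp
  with r(1) show ?thesis
    by blast
qed


subsection \<open>The forcing relation\<close>

text \<open>
  The names in \<open>e\<close> denote the classes of the functions \<open>app (e x)\<close> in the generic ultrapower. Being
  standard means to agree with a constant function on a set of the ultrafilter, whence the density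
  condition in the clause for \<open>St\<close>.
\<close>

primrec forces :: "fm \<Rightarrow> 'a \<Rightarrow> (nat \<Rightarrow> 'a) \<Rightarrow> bool" where
  "forces (x \<^bold>= y) p e = aa p (\<lambda>n. app (e x) n = app (e y) n)"
| "forces (x \<^bold>\<in> y) p e = aa p (\<lambda>n. app (e x) n \<epsilon> app (e y) n)"
| "forces (St x) p e = (\<forall>q. le q p \<longrightarrow> (\<exists>r. le r q \<and> (\<exists>a. aa r (\<lambda>n. app (e x) n = a))))"
| "forces \<^bold>\<bottom> p e = False"
| "forces (\<phi> \<^bold>\<longrightarrow> \<psi>) p e = (\<forall>q. le q p \<longrightarrow> forces \<phi> q e \<longrightarrow> forces \<psi> q e)"
| "forces (\<^bold>\<forall>\<phi>) p e = (\<forall>f. forces \<phi> p (case_nat f e))"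

text \<open>The induction on \<open>\<phi>\<close> takes place outside the model, but each clause
  quantifies over elements of the model only. Thus separation, fusion and the rest apply to forcing
  of any fixed formula.\<close>

lemma dfn_forces: "dfn (\<lambda>e. forces \<phi> (e 0) (\<lambda>i. e (Suc i)))"
proof (induction \<phi>)
  case (Imp \<phi> \<psi>)
  have "dfn (\<lambda>e. forces \<phi> (e 0) (\<lambda>i. e (Suc (Suc i))))"
    "dfn (\<lambda>e. forces \<psi> (e 0) (\<lambda>i. e (Suc (Suc i))))"
    using dfn_rename[OF Imp(1), of "case_nat 0 (\<lambda>i. Suc (Suc i))"]
      dfn_rename[OF Imp(2), of "case_nat 0 (\<lambda>i. Suc (Suc i))"] by simp_all
  then show ?case
    unfolding forces.simps by (intro dfn_intros)
next
  case (Forall \<phi>)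
  have "(\<lambda>i. e (case_nat 0 (\<lambda>i. Suc (Suc i)) i)) = case_nat (e 0) (\<lambda>i. e (Suc (Suc i)))"
    for e :: "nat \<Rightarrow> 'a"
    by (auto simp: fun_eq_iff split: nat.split)
  then have "dfn (\<lambda>e. forces \<phi> (e (Suc 0)) (case_nat (e 0) (\<lambda>i. e (Suc (Suc i)))))"
    using dfn_rename[OF Forall, of "case_nat (Suc 0) (case_nat 0 (\<lambda>i. Suc (Suc i)))"] by simp
  then show ?case
    unfolding forces.simps by (intro dfn_all)
qed (unfold forces.simps, (intro dfn_intros)+)

lemma dfn_forces_subst:
  assumes "dft p" "\<And>i. dft (t i)"
  shows "dfn (\<lambda>e. forces \<phi> (p e) (\<lambda>i. t i e))"
proof -
  have "dft (case_nat p t i)" for i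
    using assms by (cases i) simp_all
  from dfn_subst[OF dfn_forces[of \<phi>], of "case_nat p t", OF this] show ?thesis
    by simp
qed

lemma forces_mono: "forces \<phi> p e \<Longrightarrow> le q p \<Longrightarrow> forces \<phi> q e"
proof (induction \<phi> arbitrary: p q e)
  case (St x)
  then show ?case
    using le_trans unfolding forces.simps by blast
next
  case (Imp \<phi> \<psi>)
  then show ?case
    using le_trans unfolding forces.simps by blast
qed (auto intro: aa_le)

lemma dfn_app_atoms:
  "dfn1 (\<lambda>n. app f n = app g n)" "dfn1 (\<lambda>n. app f n \<epsilon> app g n)"
  by (intro dfn_intros)+

text \<open>All connectives are negative, so their clauses inherit the property from the parts. The
  atoms rely on \<open>aa_dense\<close>, and the clause for \<open>St\<close> has density built
  in.\<close>

lemma forces_dense: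
  "cond p \<Longrightarrow> (\<And>q. le q p \<Longrightarrow> \<exists>r. le r q \<and> forces \<phi> r e) \<Longrightarrow> forces \<phi> p e"
proof (induction \<phi> arbitrary: p e)
  case (Eq x y)
  then show ?case
    unfolding forces.simps by (intro aa_dense dfn_app_atoms)
next
  case (Mem x y)
  then show ?case
    unfolding forces.simps by (intro aa_dense dfn_app_atoms)
next
  case (St x)
  show ?case
    unfolding forces.simps
  proof (intro allI impI)
    fix q assume "le q p"
    then obtain r where r: "le r q" "forces (St x) r e"
      using St.prems(2) by blast
    then obtain s where "le s r" "\<exists>a. aa s (\<lambda>n. app (e x) n = a)"
      using le_refl[OF le_cond] unfolding forces.simps by blast
    then show "\<exists>r. le r q \<and> (\<exists>a. aa r (\<lambda>n. app (e x) n = a))"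
      using le_trans r(1) by blast
  qed
next
  case Fls
  then show ?case
    using le_refl unfolding forces.simps by blast
next
  case (Imp \<phi> \<psi>)
  show ?case
    unfolding forces.simps
  proof (intro allI impI)
    fix q assume q: "le q p" "forces \<phi> q e"
    show "forces \<psi> q e"
    proof (rule Imp.IH(2)[OF le_cond[OF q(1)]])
      fix r assume r: "le r q"
      then obtain s where s: "le s r" "forces (\<phi> \<^bold>\<longrightarrow> \<psi>) s e"
        using Imp.prems(2) le_trans q(1) by blast
      moreover have "forces \<phi> s e"
        using forces_mono q(2) le_trans[OF s(1) r] by blast
      ultimately show "\<exists>s. le s r \<and> forces \<psi> s e"
        using le_refl[OF le_cond] unfolding forces.simps by blast
    qed
  qed
next
  case (Forall \<phi>)
  show ?case
    unfolding forces.simps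
  proof
    fix f
    show "forces \<phi> p (case_nat f e)"
      by (rule Forall.IH[OF Forall.prems(1)]) (use Forall.prems(2) in \<open>auto simp: Forall\<close>)
  qed
qed

text \<open>Below \<open>q\<close>, every condition \<open>r\<close> meets \<open>p\<close> in a
  condition that lies below both, so the set of conditions forcing \<open>\<phi>\<close> is dense
  below \<open>q\<close>.\<close>

lemma forces_almost:
  assumes "cond q" "forces \<phi> p e" "aa q (\<lambda>n. n \<epsilon> p)"
  shows "forces \<phi> q e"
proof (rule forces_dense[OF assms(1)])
  fix r assume r: "le r q"
  have "small {n. n \<epsilon> r \<and> n \<epsilon> p}"
    by (intro small_sep dfn_intros)
  from ex_set[OF this] obtain s where s: "\<And>n. n \<epsilon> s \<longleftrightarrow> n \<epsilon> r \<and> n \<epsilon> p"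
    by blast
  have aa: "aa r (\<lambda>n. n \<epsilon> p)"
    using aa_le assms(3) r by blast
  have "cond s"
    unfolding cond_def
  proof (intro conjI allI impI)
    show "sub s omega"
      using s cond_mem le_cond[OF r] unfolding sub_def by blast
    fix n assume n: "n \<epsilon> omega"
    obtain k where k: "k \<epsilon> omega" "\<And>n. n \<epsilon> r \<Longrightarrow> k \<epsilon> n \<Longrightarrow> n \<epsilon> p"
      using aa unfolding aa_def by blast
    obtain m where m: "m \<epsilon> omega" "\<And>z. z \<epsilon> omega \<Longrightarrow> m \<epsilon> z \<Longrightarrow> n \<epsilon> z \<and> k \<epsilon> z"
      using ex_max[OF n k(1)] by metis
    obtain z where z: "z \<epsilon> r" "m \<epsilon> z"
      using le_cond[OF r] m(1) unfolding cond_def by blast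
    then show "\<exists>m. m \<epsilon> s \<and> n \<epsilon> m"
      using m(2) cond_mem[OF le_cond[OF r]] k(2) s by blast
  qed
  then have "le s r" "le s p"
    using s unfolding le_def sub_def by blast+
  then show "\<exists>s. le s r \<and> forces \<phi> s e"
    using forces_mono assms(2) by blast
qed

lemma forces_rename: "forces (rename f \<phi>) p e = forces \<phi> p (\<lambda>i. e (f i))"
proof (induction \<phi> arbitrary: p e f)
  case (Forall \<phi>)
  have "(\<lambda>i. case_nat a e (case_nat 0 (\<lambda>k. Suc (f k)) i)) = case_nat a (\<lambda>i. e (f i))" for a
    by (auto simp: fun_eq_iff split: nat.split)
  then show ?case
    by (simp add: Forall)
qed auto

lemma forces_inst_single: "forces (inst [x] 0 \<phi>) p e = forces \<phi> p (case_nat (e x) e)"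
proof -
  have "(\<lambda>i. e (case_nat x (\<lambda>i. i) i)) = case_nat (e x) e"
    by (auto simp: fun_eq_iff split: nat.split)
  then show ?thesis
    by (simp add: inst_single forces_rename)
qed

text \<open>Names that agree almost everywhere on \<open>p\<close> denote the same element below
  \<open>p\<close>. This is the soundness of the equality rule.\<close>

lemma forces_cong:
  "cond p \<Longrightarrow> (\<And>i. i \<in> fv \<phi> \<Longrightarrow> aa p (\<lambda>n. app (e i) n = app (e' i) n)) \<Longrightarrow>
    forces \<phi> p e = forces \<phi> p e'"
proof (induction \<phi> arbitrary: p e e')
  case (Eq x y)
  then have *: "aa p (\<lambda>n. app (e x) n = app (e' x) n \<and> app (e y) n = app (e' y) n)"
    by (intro aa_conj[OF Eq.prems(1) Eq.prems(2)[of x] Eq.prems(2)[of y]]) auto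
  show ?case
    unfolding forces.simps by (rule iffI; erule aa_conj[OF Eq.prems(1) *]) auto
next
  case (Mem x y)
  then have *: "aa p (\<lambda>n. app (e x) n = app (e' x) n \<and> app (e y) n = app (e' y) n)"
    by (intro aa_conj[OF Mem.prems(1) Mem.prems(2)[of x] Mem.prems(2)[of y]]) auto
  show ?case
    unfolding forces.simps by (rule iffI; erule aa_conj[OF Mem.prems(1) *]) auto
next
  case (St x)
  have "aa r (\<lambda>n. app (e x) n = a) \<longleftrightarrow> aa r (\<lambda>n. app (e' x) n = a)" if r: "le r p" for r a
  proof -
    have *: "aa r (\<lambda>n. app (e x) n = app (e' x) n)"
      using aa_le[OF St.prems(2) r] by simp
    show ?thesis
      by (rule iffI; erule aa_conj[OF le_cond[OF r] *]) auto
  qed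
  then show ?case
    unfolding forces.simps using le_trans by metis
next
  case (Imp \<phi> \<psi>)
  have "forces \<phi> q e = forces \<phi> q e'" "forces \<psi> q e = forces \<psi> q e'" if q: "le q p" for q
    by (rule Imp.IH[OF le_cond[OF q]], rule aa_le[OF Imp.prems(2) q], simp)+
  then show ?case
    unfolding forces.simps by blast
next
  case (Forall \<phi>)
  have "forces \<phi> p (case_nat f e) = forces \<phi> p (case_nat f e')" for f
    by (rule Forall.IH[OF Forall.prems(1)])
      (use Forall.prems(2) in \<open>auto intro: aaI split: nat.split\<close>)
  then show ?case
    unfolding forces.simps by blast
qed simp

theorem forces_sound:
  "provable L G \<phi> \<Longrightarrow> cond p \<Longrightarrow> (\<And>\<psi>. \<psi> \<in> G \<Longrightarrow> forces \<psi> p e) \<Longrightarrow> forces \<phi> p e"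
proof (induction arbitrary: p e rule: provable.induct)
  case (ImpI \<phi> G \<psi>)
  show ?case
    unfolding forces.simps
  proof (intro allI impI)
    fix q assume q: "le q p" "forces \<phi> q e"
    show "forces \<psi> q e"
      by (rule ImpI.IH[OF le_cond[OF q(1)]]) (use q ImpI.prems(2) forces_mono in blast)
  qed
next
  case (ImpE G \<phi> \<psi>)
  then have "forces (\<phi> \<^bold>\<longrightarrow> \<psi>) p e" "forces \<phi> p e"
    by blast+
  then show ?case
    using le_refl[OF ImpE.prems(1)] unfolding forces.simps by blast
next
  case (Contr \<phi> G)
  show ?case
  proof (rule forces_dense[OF Contr.prems(1)])
    fix q assume q: "le q p"
    \<comment> \<open>Classical reductio is where density enters: no \<open>q\<close> below
      \<open>p\<close> forces the negation, so each has an extension forcing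
      \<open>\<phi>\<close>.\<close>
    have "\<not> forces (\<^bold>\<not>\<phi>) q e"
    proof
      assume n: "forces (\<^bold>\<not>\<phi>) q e"
      have "forces \<^bold>\<bottom> q e"
        by (rule Contr.IH[OF le_cond[OF q]]) (use n forces_mono[OF Contr.prems(2) q] in blast)
      then show False
        by simp
    qed
    then show "\<exists>r. le r q \<and> forces \<phi> r e"
      unfolding forces.simps by blast
  qed
next
  case (AllI G \<phi>)
  show ?case
    unfolding forces.simps
  proof
    fix f
    show "forces \<phi> p (case_nat f e)"
    proof (rule AllI.IH[OF AllI.prems(1)])
      fix \<psi> assume "\<psi> \<in> inst [] 1 ` G"
      then obtain \<chi> where "\<chi> \<in> G" "\<psi> = inst [] 1 \<chi>"
        by blast
      then show "forces \<psi> p (case_nat f e)"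
        using AllI.prems(2) by (simp add: inst_Nil forces_rename)
    qed
  qed
next
  case (AllE G \<phi> x)
  then have "forces (\<^bold>\<forall>\<phi>) p e"
    by blast
  then show ?case
    by (simp add: forces_inst_single)
next
  case (EqRefl x G)
  show ?case
    by (simp add: aaI)
next
  case (EqSubst G x y \<phi>)
  then have xy: "aa p (\<lambda>n. app (e x) n = app (e y) n)" and \<phi>: "forces \<phi> p (case_nat (e x) e)"
    by (auto simp: forces_inst_single)
  have "forces \<phi> p (case_nat (e x) e) = forces \<phi> p (case_nat (e y) e)"
    by (rule forces_cong[OF EqSubst.prems(1)]) (use xy in \<open>auto intro: aaI split: nat.split\<close>)
  with \<phi> show ?case
    by (simp add: forces_inst_single)
qed blast

lemma forces_ImpI:
  "(\<And>q. le q p \<Longrightarrow> forces \<phi> q e \<Longrightarrow> forces \<psi> q e) \<Longrightarrow> forces (\<phi> \<^bold>\<longrightarrow> \<psi>) p e"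
  by simp

lemma forces_ImpD: "forces (\<phi> \<^bold>\<longrightarrow> \<psi>) p e \<Longrightarrow> forces \<phi> p e \<Longrightarrow> cond p \<Longrightarrow> forces \<psi> p e"
  using le_refl by simp

lemma forces_AllI: "(\<And>f. forces \<phi> p (case_nat f e)) \<Longrightarrow> forces (\<^bold>\<forall>\<phi>) p e"
  by simp

lemma forces_Exists:
  "forces (\<^bold>\<exists>\<phi>) p e \<longleftrightarrow> (\<forall>q. le q p \<longrightarrow> (\<exists>r f. le r q \<and> forces \<phi> r (case_nat f e)))"
  unfolding forces.simps by blast

lemma forces_And:
  assumes "cond p"
  shows "forces (\<phi> \<^bold>\<and> \<psi>) p e \<longleftrightarrow> forces \<phi> p e \<and> forces \<psi> p e"
proof
  assume *: "forces (\<phi> \<^bold>\<and> \<psi>) p e"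
  have "\<exists>r. le r q \<and> forces \<phi> r e \<and> forces \<psi> r e" if q: "le q p" for q
  proof -
    obtain r where r: "le r q" "forces \<phi> r e" "\<not> forces (\<^bold>\<not>\<psi>) r e"
      using * q unfolding forces.simps by blast
    then obtain s where s: "le s r" "forces \<psi> s e"
      unfolding forces.simps by blast
    then show ?thesis
      using forces_mono[OF r(2) s(1)] le_trans[OF s(1) r(1)] by blast
  qed
  then show "forces \<phi> p e \<and> forces \<psi> p e"
    using forces_dense[OF assms] by meson
next
  assume *: "forces \<phi> p e \<and> forces \<psi> p e"
  show "forces (\<phi> \<^bold>\<and> \<psi>) p e"
    unfolding forces.simps
  proof (intro allI impI)
    fix q assume q: "le q p" "\<forall>r. le r q \<longrightarrow> forces \<phi> r e \<longrightarrow> (\<forall>s. le s r \<longrightarrow> forces \<psi> s e \<longrightarrow> False)"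
    then show False
      using * forces_mono le_refl[OF le_cond] by blast
  qed
qed

section \<open>Constant names, standard quantifiers and the theorem of Los\<close>

definition cn :: "'a \<Rightarrow> 'a" where
  "cn x = lam omega (\<lambda>_. x)"

lemma app_cn [simp]: "n \<epsilon> omega \<Longrightarrow> app (cn x) n = x"
  unfolding cn_def by (rule app_lam) (intro dfn_intros)

lemma dft_cn [dfn_intros]: "dft a \<Longrightarrow> dft (\<lambda>e. cn (a e))"
  by (rule dft1_subst[of cn])
    (unfold cn_def lam_def, intro dft_setof small_lam[of "\<lambda>_. x" for x] dfn_intros)

lemma aa_cn: "cond p \<Longrightarrow> aa p (\<lambda>n. app (cn x) n = x)"
  by (rule aaI) (simp add: cond_mem)

lemma forces_St_cn: "cond p \<Longrightarrow> e i = cn x \<Longrightarrow> forces (St i) p e"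
  using aa_cn le_cond le_refl unfolding forces.simps by metis

text \<open>A name forced to be standard coincides, on densely many conditions, with a constant one.
  By density it suffices to let the quantifier range over constant names.\<close>

lemma forces_Forall_st:
  assumes "cond p"
  shows "forces (\<^bold>\<forall>\<^sup>s\<^sup>t\<phi>) p e \<longleftrightarrow> (\<forall>x. forces \<phi> p (case_nat (cn x) e))"
proof
  assume *: "forces (\<^bold>\<forall>\<^sup>s\<^sup>t\<phi>) p e"
  show "\<forall>x. forces \<phi> p (case_nat (cn x) e)"
  proof
    fix x
    have "forces (St 0 \<^bold>\<longrightarrow> \<phi>) p (case_nat (cn x) e)"
      using * unfolding forces.simps(6) ..
    then show "forces \<phi> p (case_nat (cn x) e)"
      using forces_ImpD forces_St_cn assms by (metis old.nat.simps(4))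
  qed
next
  assume *: "\<forall>x. forces \<phi> p (case_nat (cn x) e)"
  show "forces (\<^bold>\<forall>\<^sup>s\<^sup>t\<phi>) p e"
  proof (intro forces_AllI forces_ImpI)
    fix f q assume q: "le q p" "forces (St 0) q (case_nat f e)"
    show "forces \<phi> q (case_nat f e)"
    proof (rule forces_dense[OF le_cond[OF q(1)]])
      fix r assume r: "le r q"
      then obtain s a where s: "le s r" "aa s (\<lambda>n. app f n = a)"
        using q(2) by auto
      have cs: "cond s"
        using s(1) by (rule le_cond)
      have "aa s (\<lambda>n. app (cn a) n = app f n)"
        by (rule aa_conj[OF cs s(2) aa_cn[OF cs]]) simp
      then have "forces \<phi> s (case_nat (cn a) e) = forces \<phi> s (case_nat f e)"
        by (intro forces_cong[OF cs]) (auto intro: aaI split: nat.split)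
      moreover have "forces \<phi> s (case_nat (cn a) e)"
        using * forces_mono le_trans q(1) r s(1) by blast
      ultimately show "\<exists>s. le s r \<and> forces \<phi> s (case_nat f e)"
        using s(1) by blast
    qed
  qed
qed

lemma forces_Exists_stI:
  assumes "cond p" "\<And>q. le q p \<Longrightarrow> \<exists>r x. le r q \<and> forces \<phi> r (case_nat (cn x) e)"
  shows "forces (\<^bold>\<exists>\<^sup>s\<^sup>t\<phi>) p e"
  unfolding forces_Exists
proof (intro allI impI)
  fix q assume "le q p"
  then obtain r x where r: "le r q" "forces \<phi> r (case_nat (cn x) e)"
    using assms(2) by blast
  have "forces (St 0 \<^bold>\<and> \<phi>) r (case_nat (cn x) e)"
    unfolding forces_And[OF le_cond[OF r(1)]]
    using r(2) forces_St_cn[OF le_cond[OF r(1)]] by simp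
  then show "\<exists>r f. le r q \<and> forces (St 0 \<^bold>\<and> \<phi>) r (case_nat f e)"
    using r(1) by blast
qed

lemma dfn_sat_app: "in_formula \<phi> \<Longrightarrow> dfn1 (\<lambda>n. sat (\<epsilon>) (\<lambda>i. app (e i) n) \<phi>)"
  by (rule dfn_sat[of \<phi> "\<lambda>i env. app (e i) (env 0)"]) (simp, intro dfn_intros)

text \<open>An implication or a universal formula that fails at unboundedly many points of
  \<open>p\<close> fails throughout some condition below \<open>p\<close>. Passing to this condition
  replaces the decision of an ultrafilter.\<close>

theorem los:
  "in_formula \<phi> \<Longrightarrow> cond p \<Longrightarrow> forces \<phi> p e \<longleftrightarrow> aa p (\<lambda>n. sat (\<epsilon>) (\<lambda>i. app (e i) n) \<phi>)"
proof (induction \<phi> arbitrary: p e)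
  case Fls
  then show ?case
    using aa_const[of p False] by simp
next
  case (Imp \<phi> \<psi>)
  let ?\<phi> = "\<lambda>n. sat (\<epsilon>) (\<lambda>i. app (e i) n) \<phi>" and ?\<psi> = "\<lambda>n. sat (\<epsilon>) (\<lambda>i. app (e i) n) \<psi>"
  have IH: "forces \<phi> q e \<longleftrightarrow> aa q ?\<phi>" "forces \<psi> q e \<longleftrightarrow> aa q ?\<psi>" if "cond q" for q
    using Imp that by simp_all
  show ?case
    unfolding sat.simps
  proof
    assume *: "forces (\<phi> \<^bold>\<longrightarrow> \<psi>) p e"
    show "aa p (\<lambda>n. ?\<phi> n \<longrightarrow> ?\<psi> n)"
    proof (rule ccontr)
      assume n: "\<not> aa p (\<lambda>n. ?\<phi> n \<longrightarrow> ?\<psi> n)"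
      have "dfn1 (\<lambda>n. ?\<phi> n \<longrightarrow> ?\<psi> n)"
        using Imp.prems(1) by (intro dfn_imp dfn_sat_app) simp_all
      then obtain q where q: "le q p" "\<And>n. n \<epsilon> q \<Longrightarrow> \<not> (?\<phi> n \<longrightarrow> ?\<psi> n)"
        using not_aa[OF Imp.prems(2) _ n] by metis
      have "aa q ?\<phi>"
        by (rule aaI) (use q(2) in simp)
      then have "forces \<phi> q e"
        using IH(1)[OF le_cond[OF q(1)]] by simp
      then have "aa q ?\<psi>"
        using * q(1) IH(2)[OF le_cond[OF q(1)]] by simp
      from aa_ex[OF le_cond[OF q(1)] this] obtain n where "n \<epsilon> q" "?\<psi> n"
        by blast
      then show False
        using q(2)[of n] by simp
    qed
  next
    assume *: "aa p (\<lambda>n. ?\<phi> n \<longrightarrow> ?\<psi> n)"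
    show "forces (\<phi> \<^bold>\<longrightarrow> \<psi>) p e"
    proof (rule forces_ImpI)
      fix q assume q: "le q p" "forces \<phi> q e"
      note cq = le_cond[OF q(1)]
      have "aa q ?\<phi>"
        using IH(1)[OF cq] q(2) by simp
      then have "aa q ?\<psi>"
        using aa_conj[OF cq _ aa_le[OF * q(1)], of ?\<phi> ?\<psi>] by blast
      then show "forces \<psi> q e"
        using IH(2)[OF cq] by simp
    qed
  qed
next
  case (Forall \<phi>)
  have case_app: "(\<lambda>i. app (case_nat f e i) n) = case_nat (app f n) (\<lambda>i. app (e i) n)" for f n
    by (auto simp: fun_eq_iff split: nat.split)
  let ?P = "\<lambda>n x. sat (\<epsilon>) (case_nat x (\<lambda>i. app (e i) n)) \<phi>"
  have P: "dfn2 ?P"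
  proof -
    have t: "dft (case_nat (\<lambda>env. env 1) (\<lambda>i env. app (e i) (env 0)) i)" for i
      by (cases i) (simp_all, (intro dfn_intros)+)
    have "(\<lambda>i. case_nat (\<lambda>env. env 1) (\<lambda>i env. app (e i) (env 0)) i env) =
        case_nat (env 1) (\<lambda>i. app (e i) (env 0))" for env :: "nat \<Rightarrow> 'a"
      by (auto simp: fun_eq_iff split: nat.split)
    with dfn_sat[of \<phi> "case_nat (\<lambda>env. env 1) (\<lambda>i env. app (e i) (env 0))"] t Forall.prems(1)
    show ?thesis
      by simp
  qed
  have "forces (\<^bold>\<forall>\<phi>) p e \<longleftrightarrow> (\<forall>f. aa p (\<lambda>n. ?P n (app f n)))"
    using Forall by (simp add: case_app)
  also have "\<dots> \<longleftrightarrow> aa p (\<lambda>n. \<forall>x. ?P n x)"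
  proof
    assume *: "\<forall>f. aa p (\<lambda>n. ?P n (app f n))"
    show "aa p (\<lambda>n. \<forall>x. ?P n x)"
    proof (rule ccontr)
      assume n: "\<not> aa p (\<lambda>n. \<forall>x. ?P n x)"
      have "dfn1 (\<lambda>n. \<forall>x. ?P n x)"
        by (intro dfn_intros dfn2_subst[OF P])
      then obtain q where q: "le q p" "\<And>n. n \<epsilon> q \<Longrightarrow> \<not> (\<forall>x. ?P n x)"
        using not_aa[OF Forall.prems(2) _ n] by metis
      \<comment> \<open>The name \<open>f\<close> picks a counterexample at each point of
        \<open>q\<close>; the premise \<open>n \<epsilon> q\<close> lets any value serve elsewhere,
        so that the choice is total on \<open>omega\<close>.\<close>
      have "dfn2 (\<lambda>n x. n \<epsilon> q \<longrightarrow> \<not> ?P n x)"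
        by (intro dfn_intros dfn2_subst[OF P])
      moreover have "\<exists>x. n \<epsilon> q \<longrightarrow> \<not> ?P n x" for n
        using q(2)[of n] by auto
      ultimately obtain f where f: "\<And>n. n \<epsilon> omega \<Longrightarrow> n \<epsilon> q \<Longrightarrow> \<not> ?P n (app f n)"
        using countable_choice[of "\<lambda>n x. n \<epsilon> q \<longrightarrow> \<not> ?P n x"] by metis
      have "aa q (\<lambda>n. ?P n (app f n))"
        using *[rule_format, of f] aa_le[OF _ q(1)] by simp
      from aa_ex[OF le_cond[OF q(1)] this] show False
        using f by auto
    qed
  next
    assume *: "aa p (\<lambda>n. \<forall>x. ?P n x)"
    show "\<forall>f. aa p (\<lambda>n. ?P n (app f n))"
      by (rule allI, rule aa_weaken[OF *]) simp
  qed
  finally show ?case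
    by simp
qed auto


subsection \<open>Homogeneity\<close>

lemma aa_cong: "(\<And>n. n \<epsilon> p \<Longrightarrow> P n \<longleftrightarrow> Q n) \<Longrightarrow> aa p P \<longleftrightarrow> aa p Q"
  unfolding aa_def by blast

definition im :: "'a \<Rightarrow> 'a \<Rightarrow> 'a" where
  "im h q = setof {m. \<exists>n. n \<epsilon> q \<and> m = app h n}"

lemma mem_im: "m \<epsilon> im h q \<longleftrightarrow> (\<exists>n. n \<epsilon> q \<and> m = app h n)"
proof -
  have "small {m. \<exists>n. n \<epsilon> q \<and> m = app h n}"
    by (rule small_image) (intro dfn_intros)
  from mem_setof[OF this] show ?thesis
    by (simp add: im_def)
qed

context
  fixes h
  assumes range: "\<And>n. n \<epsilon> omega \<Longrightarrow> app h n \<epsilon> omega"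
    and increasing: "\<And>m n. n \<epsilon> omega \<Longrightarrow> m \<epsilon> n \<Longrightarrow> app h m \<epsilon> app h n"
begin

text \<open>Lying above the identity, \<open>h\<close> takes unbounded sets to unbounded sets, so
  images of conditions are conditions.\<close>

lemma above: "n \<epsilon> omega \<Longrightarrow> n = app h n \<or> n \<epsilon> app h n"
proof (induction rule: omega_induct)
  case dfn
  show ?case
    by (intro dfn_intros)
next
  case emp
  then show ?case
    using emp_least[OF range[OF emp_omega]] by auto
next
  case (suc n)
  have r: "app h (suc n) \<epsilon> omega"
    using range suc_omega suc.hyps by blast
  have "app h n \<epsilon> app h (suc n)"
    using increasing[OF suc_omega[OF suc.hyps], of n] by simp
  then have "n \<epsilon> app h (suc n)"
    using suc.IH omega_trans[OF r] by metis
  then show ?case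
    using suc_least[OF r] by auto
qed

lemma above_trans: "n \<epsilon> omega \<Longrightarrow> k \<epsilon> n \<Longrightarrow> k \<epsilon> app h n"
  using above omega_trans range by metis

lemma reflects: "m \<epsilon> omega \<Longrightarrow> n \<epsilon> omega \<Longrightarrow> app h m \<epsilon> app h n \<Longrightarrow> m \<epsilon> n"
  using omega_linear[of m n] increasing[of m n] mem_asym mem_irrefl by metis

lemma inj_h: "m \<epsilon> omega \<Longrightarrow> n \<epsilon> omega \<Longrightarrow> app h m = app h n \<Longrightarrow> m = n"
  using omega_linear[of m n] increasing mem_irrefl by metis

lemma cond_im_iff:
  assumes "sub q omega"
  shows "cond (im h q) \<longleftrightarrow> cond q"
proof
  have q: "n \<epsilon> omega" if "n \<epsilon> q" for n
    using assms that by (rule subD)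
  assume *: "cond (im h q)"
  have "\<exists>m. m \<epsilon> q \<and> n \<epsilon> m" if n: "n \<epsilon> omega" for n
  proof -
    obtain z where "z \<epsilon> im h q" "app h n \<epsilon> z"
      using * range[OF n] unfolding cond_def by blast
    then obtain m where "m \<epsilon> q" "app h n \<epsilon> app h m"
      unfolding mem_im by blast
    then show ?thesis
      using reflects[OF n q] by blast
  qed
  with assms show "cond q"
    unfolding cond_def by blast
next
  have q: "n \<epsilon> omega" if "n \<epsilon> q" for n
    using assms that by (rule subD)
  assume *: "cond q"
  have "\<exists>z. z \<epsilon> im h q \<and> n \<epsilon> z" if n: "n \<epsilon> omega" for n
  proof -
    obtain m where "m \<epsilon> q" "n \<epsilon> m"
      using * n unfolding cond_def by blast
    then have "app h m \<epsilon> im h q" "n \<epsilon> app h m"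
      using above_trans[OF q] unfolding mem_im by blast+
    then show ?thesis
      by blast
  qed
  moreover have "sub (im h q) omega"
    using range q unfolding sub_def mem_im by blast
  ultimately show "cond (im h q)"
    unfolding cond_def by blast
qed

lemma le_im:
  assumes "le r q"
  shows "le (im h r) (im h q)"
proof -
  have "cond r" "sub r q"
    using assms unfolding le_def by blast+
  then have "cond (im h r)"
    using cond_im_iff unfolding cond_def by blast
  moreover have "sub (im h r) (im h q)"
    using subD[OF \<open>sub r q\<close>] unfolding sub_def mem_im by blast
  ultimately show ?thesis
    unfolding le_def by blast
qed

text \<open>Preimages under \<open>h\<close> show that every condition below \<open>im h q\<close>
  is itself an image. Quantifiers over conditions can then be transported in both
  directions.\<close>

lemma le_im_obtain:
  assumes q: "cond q" and q': "le q' (im h q)"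
  obtains r where "le r q" "q' = im h r"
proof -
  have "small {n. n \<epsilon> q \<and> app h n \<epsilon> q'}"
    by (intro small_sep dfn_intros)
  from ex_set[OF this] obtain r where r: "\<And>n. n \<epsilon> r \<longleftrightarrow> n \<epsilon> q \<and> app h n \<epsilon> q'"
    by blast
  have "z \<epsilon> q' \<longleftrightarrow> z \<epsilon> im h r" for z
    using le_mem[OF q', of z] unfolding mem_im r by auto
  then have eq: "q' = im h r"
    by (rule mem_eqI)
  have "sub r q"
    using r unfolding sub_def by blast
  moreover from this have "sub r omega"
    using q sub_trans unfolding cond_def by blast
  then have "cond r"
    using cond_im_iff le_cond[OF q'] eq by blast
  ultimately show ?thesis
    using that eq unfolding le_def by blast
qed

lemma all_le_im: "cond q \<Longrightarrow> (\<forall>r. le r (im h q) \<longrightarrow> P r) \<longleftrightarrow> (\<forall>r. le r q \<longrightarrow> P (im h r))"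
  using le_im le_im_obtain by metis

lemma ex_le_im: "cond q \<Longrightarrow> (\<exists>r. le r (im h q) \<and> P r) \<longleftrightarrow> (\<exists>r. le r q \<and> P (im h r))"
  using le_im le_im_obtain by metis

text \<open>Towards the image a bound \<open>k\<close> becomes \<open>app h k\<close>; in the other
  direction \<open>k\<close> itself remains a bound, because \<open>h\<close> lies above the
  identity.\<close>

lemma aa_im:
  assumes "cond q"
  shows "aa (im h q) P \<longleftrightarrow> aa q (\<lambda>n. P (app h n))"
proof
  assume "aa (im h q) P"
  then obtain k where k: "k \<epsilon> omega" "\<And>z. z \<epsilon> im h q \<Longrightarrow> k \<epsilon> z \<Longrightarrow> P z"
    unfolding aa_def by blast
  have "P (app h n)" if "n \<epsilon> q" "k \<epsilon> n" for n
    using k(2)[of "app h n"] above_trans[OF cond_mem[OF assms that(1)] that(2)] that(1) mem_im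
    by blast
  with k(1) show "aa q (\<lambda>n. P (app h n))"
    unfolding aa_def by blast
next
  assume "aa q (\<lambda>n. P (app h n))"
  then obtain k where k: "k \<epsilon> omega" "\<And>n. n \<epsilon> q \<Longrightarrow> k \<epsilon> n \<Longrightarrow> P (app h n)"
    unfolding aa_def by blast
  have "P z" if z: "z \<epsilon> im h q" "app h k \<epsilon> z" for z
  proof -
    obtain n where n: "n \<epsilon> q" "z = app h n"
      using z(1) unfolding mem_im by blast
    then have "k \<epsilon> n"
      using reflects[OF k(1) cond_mem[OF assms n(1)]] z(2) by simp
    then show ?thesis
      using k(2) n by simp
  qed
  with range[OF k(1)] show "aa (im h q) P"
    unfolding aa_def by blast
qed

text \<open>Precomposing names with \<open>h\<close> is an isomorphism of the forcing below \<open>im h q\<close> with that below \<open>q\<close>.\<close>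

lemma forces_im:
  "cond q \<Longrightarrow> (\<And>i n. n \<epsilon> omega \<Longrightarrow> app (e' i) n = app (e i) (app h n)) \<Longrightarrow>
    forces \<phi> (im h q) e \<longleftrightarrow> forces \<phi> q e'"
proof (induction \<phi> arbitrary: q e e')
  case (Eq x y)
  show ?case
    unfolding forces.simps aa_im[OF Eq.prems(1)]
    by (rule aa_cong) (simp add: Eq.prems(2) cond_mem[OF Eq.prems(1)])
next
  case (Mem x y)
  show ?case
    unfolding forces.simps aa_im[OF Mem.prems(1)]
    by (rule aa_cong) (simp add: Mem.prems(2) cond_mem[OF Mem.prems(1)])
next
  case (St x)
  have "aa (im h r) (\<lambda>n. app (e x) n = a) \<longleftrightarrow> aa r (\<lambda>n. app (e' x) n = a)" if r: "cond r" for r a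
    unfolding aa_im[OF r] by (rule aa_cong) (simp add: St.prems(2) cond_mem[OF r])
  then have "(\<exists>r. le r (im h s) \<and> (\<exists>a. aa r (\<lambda>n. app (e x) n = a))) \<longleftrightarrow>
      (\<exists>r. le r s \<and> (\<exists>a. aa r (\<lambda>n. app (e' x) n = a)))" if s: "cond s" for s
    unfolding ex_le_im[OF s] using le_cond by blast
  then show ?case
    unfolding forces.simps all_le_im[OF St.prems(1)] using le_cond by blast
next
  case (Imp \<phi> \<psi>)
  have "forces \<phi> (im h r) e \<longleftrightarrow> forces \<phi> r e'" "forces \<psi> (im h r) e \<longleftrightarrow> forces \<psi> r e'"
    if r: "cond r" for r
    by (rule Imp.IH[OF r Imp.prems(2)]; assumption)+
  then show ?case
    unfolding forces.simps all_le_im[OF Imp.prems(1)] using le_cond by blast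
next
  case (Forall \<phi>)
  have *: "forces \<phi> (im h q) (case_nat f e) \<longleftrightarrow> forces \<phi> q (case_nat f' e')"
    if "\<And>n. n \<epsilon> omega \<Longrightarrow> app f' n = app f (app h n)" for f f'
    by (rule Forall.IH[OF Forall.prems(1)])
      (use that Forall.prems(2) in \<open>auto split: nat.split\<close>)
  \<comment> \<open>Names have to correspond in both directions. From \<open>f'\<close> a name on
    the range of \<open>h\<close> is built, which is well defined by injectivity; from
    \<open>f\<close> one obtains \<open>f'\<close> by composition.\<close>
  have 1: "\<exists>f. \<forall>n. n \<epsilon> omega \<longrightarrow> app f' n = app f (app h n)" for f'
  proof -
    have "small {p. \<exists>n. n \<epsilon> omega \<and> p = op (app h n) (app f' n)}"
      by (rule small_image[of "\<lambda>n. op (app h n) (app f' n)"]) (intro dfn_intros)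
    from ex_set[OF this] obtain f
      where f: "\<And>p. p \<epsilon> f \<longleftrightarrow> (\<exists>n. n \<epsilon> omega \<and> p = op (app h n) (app f' n))"
      by blast
    have "app f (app h n) = app f' n" if n: "n \<epsilon> omega" for n
    proof (rule app_eq)
      show "op (app h n) (app f' n) \<epsilon> f"
        unfolding f using n by blast
      show "z = app f' n" if "op (app h n) z \<epsilon> f" for z
        using that inj_h n unfolding f op_eq_iff by metis
    qed
    then show ?thesis
      by metis
  qed
  have 2: "\<exists>f'. \<forall>n. n \<epsilon> omega \<longrightarrow> app f' n = app f (app h n)" for f
  proof -
    have "dft1 (\<lambda>n. app f (app h n))"
      by (intro dfn_intros)
    from app_lam[OF this] show ?thesis
      by blast
  qed
  show ?case
    unfolding forces.simps using * 1 2 by metis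
qed simp

end

lemma ex_increasing:
  assumes "cond p"
  shows "\<exists>h. (\<forall>n. n \<epsilon> omega \<longrightarrow> app h n \<epsilon> p) \<and>
    (\<forall>m n. n \<epsilon> omega \<longrightarrow> m \<epsilon> n \<longrightarrow> app h m \<epsilon> app h n)"
proof -
  have above: "\<exists>y. y \<epsilon> p \<and> x \<epsilon> y" if "x \<epsilon> omega" for x
    using assms that unfolding cond_def by blast
  obtain x where x: "x \<epsilon> p"
    using above[OF emp_omega] by blast
  have d: "dfn2 (\<epsilon>)"
    by (intro dfn_intros)
  have "\<exists>y. y \<epsilon> p \<and> x \<epsilon> y" if "x \<epsilon> p" for x
    using above cond_mem[OF assms that] by blast
  from dependent_choice[OF d this x] obtain h
    where h: "\<And>n. n \<epsilon> omega \<Longrightarrow> app h n \<epsilon> p" "\<And>n. n \<epsilon> omega \<Longrightarrow> app h n \<epsilon> app h (suc n)"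
    by blast
  have "\<forall>m. m \<epsilon> n \<longrightarrow> app h m \<epsilon> app h n" if "n \<epsilon> omega" for n
    using that
  proof (induction rule: omega_induct)
    case dfn
    show ?case
      by (intro dfn_intros)
  next
    case (suc n)
    have "app h (suc n) \<epsilon> omega"
      using cond_mem[OF assms h(1)[OF suc_omega[OF suc.hyps]]] .
    from omega_trans[OF this _ h(2)[OF suc.hyps]] show ?case
      using suc.IH h(2)[OF suc.hyps] unfolding mem_suc by blast
  qed simp
  with h(1) show ?thesis
    by blast
qed

text \<open>Precomposition with an increasing map into \<open>p\<close> leaves constant names
  unchanged, so what holds on the image of \<open>omega\<close>, a condition below \<open>p\<close>,
  already holds on \<open>omega\<close>.\<close>

lemma forces_homogeneous:
  assumes "cond p" "forces \<phi> p (\<lambda>i. cn (a i))"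
  shows "forces \<phi> omega (\<lambda>i. cn (a i))"
proof -
  obtain h where h: "\<And>n. n \<epsilon> omega \<Longrightarrow> app h n \<epsilon> p"
    "\<And>m n. n \<epsilon> omega \<Longrightarrow> m \<epsilon> n \<Longrightarrow> app h m \<epsilon> app h n"
    using ex_increasing[OF assms(1)] by blast
  have r: "app h n \<epsilon> omega" if "n \<epsilon> omega" for n
    using cond_mem[OF assms(1) h(1)[OF that]] .
  have "cond (im h omega)"
    using cond_im_iff[OF r h(2) sub_refl] cond_omega by blast
  moreover have "sub (im h omega) p"
    using h(1) unfolding sub_def mem_im by blast
  ultimately have "forces \<phi> (im h omega) (\<lambda>i. cn (a i))"
    using forces_mono[OF assms(2)] unfolding le_def by blast
  moreover have "forces \<phi> (im h omega) (\<lambda>i. cn (a i)) \<longleftrightarrow> forces \<phi> omega (\<lambda>i. cn (a i))"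
    by (rule forces_im[OF r h(2) cond_omega]) (simp_all add: r)
  ultimately show ?thesis
    by blast
qed

subsection \<open>The axioms of SCOT are forced\<close>

lemma forces_mem_cn: "cond p \<Longrightarrow> aa p (\<lambda>n. app (cn x) n \<epsilon> app (cn y) n) \<longleftrightarrow> x \<epsilon> y"
  using aa_cong[of p "\<lambda>n. app (cn x) n \<epsilon> app (cn y) n" "\<lambda>_. x \<epsilon> y"] aa_const[of p "x \<epsilon> y"]
  by (simp add: cond_mem)

lemma forces_ZFc: "\<phi> \<in> ZFc \<Longrightarrow> cond p \<Longrightarrow> forces \<phi> p e"
  using los[OF in_formula_ZFc] ZFc aaI by metis

lemma forces_closures:
  assumes "\<And>p e. cond p \<Longrightarrow> forces \<phi> p e" "\<psi> \<in> closures \<phi>" "cond p"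
  shows "forces \<psi> p e"
proof -
  have "forces ((Forall ^^ n) \<phi>) p e" for n
    by (induction n arbitrary: e) (simp_all add: assms)
  with assms(2) show ?thesis
    by (auto simp: closures_def)
qed

lemma forces_Forall_st_funpow:
  assumes "cond p"
    and "\<And>e'. (\<And>i. i < n \<Longrightarrow> \<exists>x. e' i = cn x) \<Longrightarrow> (\<And>i. e' (i + n) = e i) \<Longrightarrow> forces \<phi> p e'"
  shows "forces ((Forall_st ^^ n) \<phi>) p e"
  using assms(2)
proof (induction n arbitrary: e)
  case (Suc n)
  have "forces ((Forall_st ^^ n) \<phi>) p (case_nat (cn x) e)" for x
  proof (rule Suc.IH)
    fix e' assume e': "\<And>i. i < n \<Longrightarrow> \<exists>x. e' i = cn x" "\<And>i. e' (i + n) = case_nat (cn x) e i"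
    show "forces \<phi> p e'"
    proof (rule Suc.prems)
      show "\<exists>x. e' i = cn x" if "i < Suc n" for i
        using e'(1)[of i] e'(2)[of 0] that by (cases "i = n") auto
      show "e' (i + Suc n) = e i" for i
        using e'(2)[of "Suc i"] by simp
    qed
  qed
  then show ?case
    using forces_Forall_st[OF assms(1)] by simp
qed simp

text \<open>By the theorem of Los, forcing an \<open>\<in>\<close>-formula at constant names amounts
  to its truth in the model. The premise thus gives truth for all \<open>x\<close>, and hence
  pointwise for every name.\<close>

lemma forces_Transfer:
  assumes "in_formula \<phi>" "cond p"
  shows "forces (Transfer \<phi>) p (\<lambda>i. cn (d i))"
  unfolding Transfer_def
proof (intro forces_ImpI forces_AllI)
  fix q f assume q: "le q p" "forces (\<^bold>\<forall>\<^sup>s\<^sup>t\<phi>) q (\<lambda>i. cn (d i))"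
  note cq = le_cond[OF q(1)]
  have env: "(\<lambda>i. app (case_nat f (\<lambda>i. cn (d i)) i) n) = case_nat (app f n) d" if "n \<epsilon> omega" for f n
    using that by (auto simp: fun_eq_iff split: nat.split)
  have "sat (\<epsilon>) (case_nat x d) \<phi>" for x
  proof -
    have "forces \<phi> q (case_nat (cn x) (\<lambda>i. cn (d i)))"
      using q(2) forces_Forall_st[OF cq] by blast
    then have "aa q (\<lambda>n. sat (\<epsilon>) (\<lambda>i. app (case_nat (cn x) (\<lambda>i. cn (d i)) i) n) \<phi>)"
      using los[OF assms(1) cq] by blast
    from aa_ex[OF cq this] show ?thesis
      by (auto simp: env)
  qed
  then have "aa q (\<lambda>n. sat (\<epsilon>) (\<lambda>i. app (case_nat f (\<lambda>i. cn (d i)) i) n) \<phi>)"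
    by (intro aaI) (simp add: env cond_mem[OF cq])
  then show "forces \<phi> q (case_nat f (\<lambda>i. cn (d i)))"
    using los[OF assms(1) cq] by blast
qed

lemma fv_Forall_st_funpow: "fv ((Forall_st ^^ n) \<phi>) = {k. k + n \<in> fv \<phi>}"
  by (induction n) auto

lemma forces_closures_st_Transfer:
  assumes "in_formula \<phi>" "\<psi> \<in> closures_st (Transfer \<phi>)" "cond p"
  shows "forces \<psi> p e"
proof -
  obtain n where n: "\<psi> = (Forall_st ^^ n) (Transfer \<phi>)" "sentence \<psi>"
    using assms(2) by (auto simp: closures_st_def)
  show ?thesis
    unfolding n(1)
  proof (rule forces_Forall_st_funpow[OF assms(3)])
    fix e' assume e': "\<And>i. i < n \<Longrightarrow> \<exists>x. e' i = cn x"
    then obtain d where d: "\<And>i. i < n \<Longrightarrow> e' i = cn (d i)"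
      by metis
    have "i < n" if "i \<in> fv (Transfer \<phi>)" for i
    proof (rule ccontr)
      assume "\<not> i < n"
      then have "i - n \<in> fv ((Forall_st ^^ n) (Transfer \<phi>))"
        using that unfolding fv_Forall_st_funpow by simp
      with n show False
        by (simp add: sentence_def)
    qed
    \<comment> \<open>The closure is a sentence, so only the indices bound by its standard
      quantifiers occur in the matrix; all other entries may be replaced by constant names.\<close>
    then have "forces (Transfer \<phi>) p e' = forces (Transfer \<phi>) p (\<lambda>i. cn (d i))"
      using d by (intro forces_cong[OF assms(3)] aaI) simp
    with forces_Transfer[OF assms(1,3)] show "forces (Transfer \<phi>) p e'"
      by blast
  qed
qed

section \<open>Nontriviality, Standard Part, SN and countable choice\<close>

lemma forces_Nat_fm:
  assumes "cond p"
  shows "forces (Nat_fm i) p e \<longleftrightarrow> aa p (\<lambda>n. app (e i) n = omega)"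
proof -
  have "in_formula (Nat_fm i)"
    by (simp add: Nat_fm_def inductive_fm_def empty_fm_def succ_fm_def subset_fm_def)
  from los[OF this assms] show ?thesis
    by simp
qed

lemma forces_subset_fm:
  assumes "cond p"
  shows "forces (subset_fm i j) p e \<longleftrightarrow> aa p (\<lambda>n. sub (app (e i) n) (app (e j) n))"
proof -
  have "in_formula (subset_fm i j)"
    by (simp add: subset_fm_def)
  from los[OF this assms] show ?thesis
    by simp
qed

lemma forces_Nontriviality: "cond p \<Longrightarrow> forces Nontriviality p e"
  unfolding Nontriviality_def
proof (rule forces_AllI, rule forces_ImpI)
  fix N q
  assume q: "le q p" "forces (Nat_fm 0) q (case_nat N e)"
  \<comment> \<open>The identity function agrees with a given constant in at most one point, so it
    names a nonstandard natural number.\<close>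
  define nu where "nu = lam omega (\<lambda>n. n)"
  have nu: "app nu n = n" if "n \<epsilon> omega" for n
    unfolding nu_def by (rule app_lam[OF _ that]) (intro dfn_intros)
  have N: "aa q (\<lambda>n. app N n = omega)"
    using q(2) forces_Nat_fm[OF le_cond[OF q(1)]] by simp
  show "forces (\<^bold>\<exists>(0 \<^bold>\<in> 1 \<^bold>\<and> \<^bold>\<forall>\<^sup>s\<^sup>t(0 \<^bold>\<in> 2 \<^bold>\<longrightarrow> \<^bold>\<not>(0 \<^bold>= 1)))) q (case_nat N e)"
    unfolding forces_Exists
  proof (intro allI impI)
    fix r assume r: "le r q"
    note cr = le_cond[OF r]
    have 1: "forces (0 \<^bold>\<in> 1) r (case_nat nu (case_nat N e))"
      using aa_weaken[OF aa_le[OF N r]] cond_mem[OF cr] by (simp add: nu)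
    have 2: "forces (\<^bold>\<forall>\<^sup>s\<^sup>t(0 \<^bold>\<in> 2 \<^bold>\<longrightarrow> \<^bold>\<not>(0 \<^bold>= 1))) r (case_nat nu (case_nat N e))"
      unfolding forces_Forall_st[OF cr]
    proof
      fix x
      have "aa r (\<lambda>n. x \<noteq> n)"
      proof (cases "x \<epsilon> omega")
        case True
        then show ?thesis
          unfolding aa_def using mem_irrefl by blast
      next
        case False
        then show ?thesis
          using cond_mem[OF cr] by (intro aaI) blast
      qed
      then have "aa r (\<lambda>n. sat (\<epsilon>) (\<lambda>i. app (case_nat (cn x) (case_nat nu (case_nat N e)) i) n)
          (0 \<^bold>\<in> 2 \<^bold>\<longrightarrow> \<^bold>\<not>(0 \<^bold>= 1)))"
        by (rule aa_weaken) (simp add: nu cond_mem[OF cr])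
      then show "forces (0 \<^bold>\<in> 2 \<^bold>\<longrightarrow> \<^bold>\<not>(0 \<^bold>= 1)) r (case_nat (cn x) (case_nat nu (case_nat N e)))"
        by (subst los[OF _ cr]) simp_all
    qed
    show "\<exists>s f. le s r \<and> forces (0 \<^bold>\<in> 1 \<^bold>\<and> \<^bold>\<forall>\<^sup>s\<^sup>t(0 \<^bold>\<in> 2 \<^bold>\<longrightarrow> \<^bold>\<not>(0 \<^bold>= 1))) s (case_nat f (case_nat N e))"
      using 1 2 le_refl[OF cr] forces_And[OF cr] by blast
  qed
qed

lemma forces_Standard_Part: "cond p \<Longrightarrow> forces Standard_Part p e"
  unfolding Standard_Part_def
proof (rule forces_AllI, rule forces_ImpI, rule forces_AllI, rule forces_ImpI)
  fix N q A r
  assume q: "le q p" "forces (Nat_fm 0) q (case_nat N e)"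
    and r: "le r q" "forces (subset_fm 0 1) r (case_nat A (case_nat N e))"
  have N: "aa r (\<lambda>n. app N n = omega)"
    using q(2) aa_le[OF _ r(1)] forces_Nat_fm[OF le_cond[OF q(1)]] by simp
  \<comment> \<open>\<open>emp\<close> and \<open>suc emp\<close> code the two truth values of
    "\<open>k\<close> belongs to \<open>A\<close>". Fusion decides them for all \<open>k\<close>
    below one condition, and the standard set \<open>B\<close> is read off from the resulting
    sequence of answers.\<close>
  define D where "D k s g \<longleftrightarrow> (g = emp \<and> aa s (\<lambda>n. \<not> k \<epsilon> app A n)) \<or>
      (g = suc emp \<and> aa s (\<lambda>n. k \<epsilon> app A n))" for k s g
  have D: "dfn3 D"
    unfolding D_def by (intro dfn_intros)
  have D_mono: "D k t g" if "D k s g" "cond t" "aa t (\<lambda>n. n \<epsilon> s)" for k s t g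
    using that aa_trans unfolding D_def by blast
  have D_dense: "\<exists>t g. le t s \<and> D k t g" if s: "cond s" for k s
  proof (cases "aa s (\<lambda>n. \<not> k \<epsilon> app A n)")
    case True
    then show ?thesis
      using le_refl[OF s] unfolding D_def by blast
  next
    case False
    have "dfn1 (\<lambda>n. \<not> k \<epsilon> app A n)"
      by (intro dfn_intros)
    then obtain t where t: "le t s" "\<And>n. n \<epsilon> t \<Longrightarrow> \<not> \<not> k \<epsilon> app A n"
      using not_aa[OF s _ False] by metis
    then have "aa t (\<lambda>n. k \<epsilon> app A n)"
      by (intro aaI) blast
    then show ?thesis
      using t(1) unfolding D_def by blast
  qed
  show "forces (\<^bold>\<exists>\<^sup>s\<^sup>t(subset_fm 0 2 \<^bold>\<and> \<^bold>\<forall>\<^sup>s\<^sup>t(0 \<^bold>\<in> 3 \<^bold>\<longrightarrow> (0 \<^bold>\<in> 1 \<^bold>\<longleftrightarrow> 0 \<^bold>\<in> 2)))) r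
      (case_nat A (case_nat N e))"
  proof (rule forces_Exists_stI[OF le_cond[OF r(1)]])
    fix s assume s: "le s r"
    have "\<exists>t g. le t s \<and> (\<forall>k. k \<epsilon> omega \<longrightarrow> D k t (app g k))"
      by (rule fusion[OF D D_mono _ le_cond[OF s]]) (use D_dense le_cond in blast)+
    then obtain t g where t: "le t s" and g: "\<And>k. k \<epsilon> omega \<Longrightarrow> D k t (app g k)"
      by blast
    note ct = le_cond[OF t]
    have Nt: "aa t (\<lambda>n. app N n = omega)"
      using aa_le[OF aa_le[OF N s] t] .
    have "small {k. k \<epsilon> omega \<and> app g k = suc emp}"
      by (intro small_sep dfn_intros)
    from ex_set[OF this] obtain B where B: "\<And>k. k \<epsilon> B \<longleftrightarrow> k \<epsilon> omega \<and> app g k = suc emp"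
      by blast
    let ?e = "case_nat (cn B) (case_nat A (case_nat N e))"
    have "sub B omega"
      using B unfolding sub_def by blast
    then have 1: "forces (subset_fm 0 2) t ?e"
      unfolding forces_subset_fm[OF ct]
      by (intro aa_weaken[OF Nt]) (simp add: cond_mem[OF ct])
    have 2: "forces (\<^bold>\<forall>\<^sup>s\<^sup>t(0 \<^bold>\<in> 3 \<^bold>\<longrightarrow> (0 \<^bold>\<in> 1 \<^bold>\<longleftrightarrow> 0 \<^bold>\<in> 2))) t ?e"
      unfolding forces_Forall_st[OF ct]
    proof
      fix x
      have "aa t (\<lambda>n. x \<epsilon> app N n \<longrightarrow> (x \<epsilon> B \<longleftrightarrow> x \<epsilon> app A n))"
      proof (cases "x \<epsilon> omega")
        case True
        have "suc emp \<noteq> emp"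
          by (metis mem_emp mem_suc)
        then have xB: "x \<epsilon> B \<longleftrightarrow> app g x \<noteq> emp"
          using B[of x] g[OF True] True unfolding D_def by auto
        from g[OF True] show ?thesis
          unfolding D_def
        proof (elim disjE conjE)
          assume "app g x = emp" and *: "aa t (\<lambda>n. \<not> x \<epsilon> app A n)"
          then show ?thesis
            by (intro aa_weaken[OF *]) (simp add: xB)
        next
          assume "app g x = suc emp" and *: "aa t (\<lambda>n. x \<epsilon> app A n)"
          then show ?thesis
            using \<open>suc emp \<noteq> emp\<close> by (intro aa_weaken[OF *]) (simp add: xB)
        qed
      next
        case False
        then show ?thesis
          by (intro aa_weaken[OF Nt]) simp
      qed
      then have "aa t (\<lambda>n. sat (\<epsilon>) (\<lambda>i. app (case_nat (cn x) ?e i) n)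
          (0 \<^bold>\<in> 3 \<^bold>\<longrightarrow> (0 \<^bold>\<in> 1 \<^bold>\<longleftrightarrow> 0 \<^bold>\<in> 2)))"
        by (rule aa_weaken) (auto simp: cond_mem[OF ct] eval_nat_numeral)
      then show "forces (0 \<^bold>\<in> 3 \<^bold>\<longrightarrow> (0 \<^bold>\<in> 1 \<^bold>\<longleftrightarrow> 0 \<^bold>\<in> 2)) t (case_nat (cn x) ?e)"
        by (subst los[OF _ ct]) simp_all
    qed
    show "\<exists>t x. le t s \<and> forces (subset_fm 0 2 \<^bold>\<and> \<^bold>\<forall>\<^sup>s\<^sup>t(0 \<^bold>\<in> 3 \<^bold>\<longrightarrow> (0 \<^bold>\<in> 1 \<^bold>\<longleftrightarrow> 0 \<^bold>\<in> 2))) t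
        (case_nat (cn x) (case_nat A (case_nat N e)))"
      using 1 2 t forces_And[OF ct] by blast
  qed
qed

lemma forces_SN:
  assumes "fv \<phi> \<subseteq> {0}" "cond p"
  shows "forces (SN \<phi>) p e"
  unfolding SN_def forces_Forall_st[OF assms(2)]
proof (intro allI forces_Exists_stI[OF assms(2)])
  fix a q assume q: "le q p"
  note cq = le_cond[OF q]
  \<comment> \<open>\<open>S\<close> is separated with the weakest condition \<open>omega\<close>.
    By homogeneity a stronger condition forces nothing more about \<open>cn x\<close>, so the same
    \<open>S\<close> works below every \<open>q\<close>.\<close>
  have "dfn1 (\<lambda>x. forces \<phi> omega (\<lambda>_. cn x))"
    using dfn_forces_subst[of "\<lambda>_. omega" "\<lambda>_ e. cn (e 0)" \<phi>] dft_const dft_cn dft_var by simp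
  then have "small {x. x \<epsilon> a \<and> forces \<phi> omega (\<lambda>_. cn x)}"
    by (rule small_sep)
  from ex_set[OF this] obtain S where S: "\<And>x. x \<epsilon> S \<longleftrightarrow> x \<epsilon> a \<and> forces \<phi> omega (\<lambda>_. cn x)"
    by blast
  have "forces (0 \<^bold>\<in> 1 \<^bold>\<longleftrightarrow> 0 \<^bold>\<in> 2 \<^bold>\<and> \<phi>) q (case_nat (cn x) (case_nat (cn S) (case_nat (cn a) e)))"
    (is "forces _ _ ?e") for x
  proof -
    \<comment> \<open>Only variable 0 may be free in \<open>\<phi>\<close>, so the whole assignment
      can be made constant, as homogeneity requires.\<close>
    have \<phi>: "forces \<phi> r ?e = forces \<phi> r (\<lambda>_. cn x)" if "cond r" for r
      using assms(1) by (intro forces_cong[OF that] aaI) auto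
    have 1: "forces (0 \<^bold>\<in> 1) r ?e \<longleftrightarrow> x \<epsilon> S" and 2: "forces (0 \<^bold>\<in> 2) r ?e \<longleftrightarrow> x \<epsilon> a"
      if "cond r" for r
      using forces_mem_cn[OF that] by simp_all
    show ?thesis
      unfolding forces_And[OF cq]
    proof (rule conjI; rule forces_ImpI)
      fix r assume r: "le r q" "forces (0 \<^bold>\<in> 1) r ?e"
      note cr = le_cond[OF r(1)]
      have "x \<epsilon> S"
        using 1[OF cr] r(2) by blast
      then have "x \<epsilon> a" "forces \<phi> r (\<lambda>_. cn x)"
        using S forces_mono le_omega[OF cr] by blast+
      then show "forces (0 \<^bold>\<in> 2 \<^bold>\<and> \<phi>) r ?e"
        using forces_And[OF cr] 2[OF cr] \<phi>[OF cr] by blast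
    next
      fix r assume r: "le r q" "forces (0 \<^bold>\<in> 2 \<^bold>\<and> \<phi>) r ?e"
      note cr = le_cond[OF r(1)]
      have "x \<epsilon> a" "forces \<phi> r (\<lambda>_. cn x)"
        using r(2) forces_And[OF cr] 2[OF cr] \<phi>[OF cr] by blast+
      then have "x \<epsilon> S"
        using S forces_homogeneous[OF cr, of \<phi> "\<lambda>_. x"] by blast
      then show "forces (0 \<^bold>\<in> 1) r ?e"
        using 1[OF cr] by blast
    qed
  qed
  then show "\<exists>r S. le r q \<and> forces (\<^bold>\<forall>\<^sup>s\<^sup>t(0 \<^bold>\<in> 1 \<^bold>\<longleftrightarrow> 0 \<^bold>\<in> 2 \<^bold>\<and> \<phi>)) r (case_nat (cn S) (case_nat (cn a) e))"
    using le_refl[OF cq] forces_Forall_st[OF cq] by blast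
qed

lemma forces_inst_pair:
  assumes "\<And>i. e (i + d) = e' i"
  shows "forces (inst [x, y] d \<phi>) p e = forces \<phi> p (case_nat (e x) (case_nat (e y) e'))"
proof -
  have "(\<lambda>i. e (if i < length [x, y] then [x, y] ! i else i - length [x, y] + d)) =
      case_nat (e x) (case_nat (e y) e')"
    using assms by (auto simp: fun_eq_iff less_Suc_eq split: nat.split)
  then show ?thesis
    by (simp only: inst_def forces_rename)
qed

text \<open>For each standard \<open>k\<close> witnesses are forced to exist only densely, and they
  vary with the condition. Fusion yields a sequence of names in the model whose member at
  \<open>k\<close> is a witness for \<open>k\<close>, all below one condition.\<close>

lemma forces_CC: "cond p \<Longrightarrow> forces (CC \<phi>) p e"
  unfolding CC_def
proof (rule forces_AllI, rule forces_ImpI, rule forces_ImpI)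
  fix N q r
  assume q: "le q p" "forces (Nat_fm 0) q (case_nat N e)"
    and r: "le r q" "forces (\<^bold>\<forall>\<^sup>s\<^sup>t(0 \<^bold>\<in> 1 \<^bold>\<longrightarrow> \<^bold>\<exists>(inst [1, 0] 3 \<phi>))) r (case_nat N e)"
  have N: "aa r (\<lambda>n. app N n = omega)"
    using q(2) aa_le[OF _ r(1)] forces_Nat_fm[OF le_cond[OF q(1)]] by simp
  define D where "D k s g \<longleftrightarrow> forces \<phi> s (case_nat (cn k) (case_nat g e))" for k s g
  have "(\<lambda>i. case_nat (\<lambda>e. cn (e 0)) (case_nat (\<lambda>e. e 2) (\<lambda>i _. e i)) i env) =
      case_nat (cn (env 0)) (case_nat (env 2) e)" for env :: "nat \<Rightarrow> 'a"
    by (auto simp: fun_eq_iff split: nat.split)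
  moreover have "dft (case_nat (\<lambda>e. cn (e 0)) (case_nat (\<lambda>e. e 2) (\<lambda>i _. e i)) i)" for i
    by (cases i; cases "i - 1") (simp_all, (intro dfn_intros)+)
  ultimately have D: "dfn3 D"
    using dfn_forces_subst[of "\<lambda>e. e 1"
        "case_nat (\<lambda>e. cn (e 0)) (case_nat (\<lambda>e. e 2) (\<lambda>i _. e i))" \<phi>] dft_var[of 1]
    unfolding D_def by simp
  have D_mono: "D k t g" if "D k s g" "cond t" "aa t (\<lambda>n. n \<epsilon> s)" for k s t g
    using that forces_almost unfolding D_def by blast
  have D_dense: "\<exists>u g. le u t \<and> D k u g" if k: "k \<epsilon> omega" and s: "le s r" and t: "le t s" for k s t
  proof -
    have tr: "le t r"
      using le_trans[OF t s] .
    note ct = le_cond[OF t]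
    have "forces (0 \<^bold>\<in> 1 \<^bold>\<longrightarrow> \<^bold>\<exists>(inst [1, 0] 3 \<phi>)) r (case_nat (cn k) (case_nat N e))"
      using r(2) forces_Forall_st[OF le_cond[OF r(1)]] by blast
    moreover have "forces (0 \<^bold>\<in> 1) t (case_nat (cn k) (case_nat N e))"
      using aa_weaken[OF aa_le[OF N tr]] k by (simp add: cond_mem[OF ct])
    ultimately have "forces (\<^bold>\<exists>(inst [1, 0] 3 \<phi>)) t (case_nat (cn k) (case_nat N e))"
      using tr unfolding forces.simps(5)[of "0 \<^bold>\<in> 1"] by blast
    then obtain u g where u: "le u t"
        "forces (inst [1, 0] 3 \<phi>) u (case_nat g (case_nat (cn k) (case_nat N e)))"
      using le_refl[OF ct] unfolding forces_Exists by blast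
    have "case_nat g (case_nat (cn k) (case_nat N e)) (i + 3) = e i" for i
      by (simp add: numeral_3_eq_3)
    from forces_inst_pair[of _ 3 e, OF this] have "D k u g"
      using u(2) unfolding D_def by simp
    with u(1) show ?thesis
      by blast
  qed
  show "forces (\<^bold>\<exists>(function_fm 0 \<^bold>\<and>
      \<^bold>\<forall>\<^sup>s\<^sup>t(0 \<^bold>\<in> 2 \<^bold>\<longrightarrow> \<^bold>\<exists>(related_fm 2 1 0 \<^bold>\<and> inst [1, 0] 4 \<phi>)))) r (case_nat N e)"
    unfolding forces_Exists
  proof (intro allI impI)
    fix s assume s: "le s r"
    have "\<exists>t g. le t s \<and> (\<forall>k. k \<epsilon> omega \<longrightarrow> D k t (app g k))"
      by (rule fusion[OF D D_mono D_dense le_cond[OF s]]) (use s in blast)+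
    then obtain t g where t: "le t s" and g: "\<And>k. k \<epsilon> omega \<Longrightarrow> D k t (app g k)"
      by blast
    note ct = le_cond[OF t]
    \<comment> \<open>Exchange of arguments: the sequence of names becomes a name for a sequence,
      whose value at \<open>m\<close> is the function taking \<open>k\<close> to the value at
      \<open>m\<close> of the name chosen for \<open>k\<close>.\<close>
    define F where "F m = setof {z. \<exists>k. k \<epsilon> omega \<and> z = op k (app (app g k) m)}" for m
    have small_F: "small {z. \<exists>k. k \<epsilon> omega \<and> z = op k (app (app g k) m)}" for m
      by (rule small_image[of "\<lambda>k. op k (app (app g k) m)"]) (intro dfn_intros)
    have "dft1 F"
      unfolding F_def by (intro dft_setof small_F dfn_intros)
    define f where "f = lam omega F"
    have f: "z \<epsilon> app f m \<longleftrightarrow> (\<exists>k. k \<epsilon> omega \<and> z = op k (app (app g k) m))" if "m \<epsilon> omega" for m z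
      unfolding f_def app_lam[OF \<open>dft1 F\<close> that] unfolding F_def
      by (simp add: mem_setof[OF small_F])
    let ?e = "case_nat f (case_nat N e)"
    have 1: "forces (function_fm 0) t ?e"
    proof (subst los[OF _ ct])
      show "in_formula (function_fm 0)"
        by (simp add: function_fm_def related_fm_def opair_fm_def upair_fm_def)
      show "aa t (\<lambda>n. sat (\<epsilon>) (\<lambda>i. app (?e i) n) (function_fm 0))"
        by (rule aaI) (auto simp: f cond_mem[OF ct])
    qed
    have 2: "forces (\<^bold>\<forall>\<^sup>s\<^sup>t(0 \<^bold>\<in> 2 \<^bold>\<longrightarrow> \<^bold>\<exists>(related_fm 2 1 0 \<^bold>\<and> inst [1, 0] 4 \<phi>))) t ?e"
      unfolding forces_Forall_st[OF ct]
    proof (rule allI, rule forces_ImpI)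
      fix k u assume u: "le u t" "forces (0 \<^bold>\<in> 2) u (case_nat (cn k) ?e)"
      note cu = le_cond[OF u(1)]
      have "aa u (\<lambda>n. app (cn k) n \<epsilon> app N n)"
        using u(2) by simp
      from aa_conj[OF cu this aa_le[OF aa_le[OF aa_le[OF N s] t] u(1)]]
      have "aa u (\<lambda>n. app (cn k) n \<epsilon> omega)"
        by auto
      \<comment> \<open>A constant that lies in \<open>omega\<close> at a single point of
        \<open>u\<close> lies in it outright.\<close>
      from aa_ex[OF cu this] have k: "k \<epsilon> omega"
        by auto
      let ?e' = "case_nat (app g k) (case_nat (cn k) ?e)"
      show "forces (\<^bold>\<exists>(related_fm 2 1 0 \<^bold>\<and> inst [1, 0] 4 \<phi>)) u (case_nat (cn k) ?e)"
        unfolding forces_Exists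
      proof (intro allI impI)
        fix v assume v: "le v u"
        note cv = le_cond[OF v]
        have "forces (related_fm 2 1 0) v ?e'"
        proof (subst los[OF _ cv])
          show "in_formula (related_fm 2 1 0)"
            by (simp add: related_fm_def opair_fm_def upair_fm_def)
          show "aa v (\<lambda>n. sat (\<epsilon>) (\<lambda>i. app (?e' i) n) (related_fm 2 1 0))"
            by (rule aaI) (auto simp: f cond_mem[OF cv] k)
        qed
        moreover have "?e' (i + 4) = e i" for i
          by (simp add: eval_nat_numeral)
        from forces_inst_pair[of _ 4 e, OF this] have "forces (inst [1, 0] 4 \<phi>) v ?e'"
          using forces_mono[OF g[OF k, unfolded D_def] le_trans[OF v u(1)]] by simp
        ultimately show "\<exists>w x. le w v \<and> forces (related_fm 2 1 0 \<^bold>\<and> inst [1, 0] 4 \<phi>) w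
            (case_nat x (case_nat (cn k) ?e))"
          using forces_And[OF cv] le_refl[OF cv] by blast
      qed
    qed
    show "\<exists>t f. le t s \<and> forces (function_fm 0 \<^bold>\<and>
      \<^bold>\<forall>\<^sup>s\<^sup>t(0 \<^bold>\<in> 2 \<^bold>\<longrightarrow> \<^bold>\<exists>(related_fm 2 1 0 \<^bold>\<and> inst [1, 0] 4 \<phi>))) t (case_nat f (case_nat N e))"
      using 1 2 t forces_And[OF ct] by blast
  qed
qed

theorem forces_SCOT:
  assumes "\<psi> \<in> SCOT" "cond p"
  shows "forces \<psi> p e"
proof -
  have "\<psi> \<in> ZFc \<or> (\<exists>\<phi>. in_formula \<phi> \<and> \<psi> \<in> closures_st (Transfer \<phi>)) \<or>
      \<psi> = Nontriviality \<or> \<psi> = Standard_Part \<or> (\<exists>\<phi>. fv \<phi> \<subseteq> {0} \<and> \<psi> = SN \<phi>) \<or>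
      (\<exists>\<phi>. \<psi> \<in> closures (CC \<phi>))"
    using assms(1) by (auto simp: SCOT_def SPOT_def ZFc_def in_lang_def)
  then show ?thesis
    using forces_ZFc forces_closures_st_Transfer forces_Nontriviality forces_Standard_Part
      forces_SN forces_closures[OF forces_CC] assms(2) by metis
qed

end

theorem theoremD: "conservative_extension SCOT ZFc"
  unfolding conservative_extension_def
proof (intro allI impI conjI)
  fix \<theta> assume "in_formula \<theta> \<and> sentence \<theta>" "provable in_lang ZFc \<theta>"
  then show "provable st_in_lang SCOT \<theta>"
    by (elim provable_mono) (auto simp: ZFc_def SCOT_def SPOT_def st_in_lang_def)
next
  fix \<theta> assume \<theta>: "in_formula \<theta> \<and> sentence \<theta>" and SCOT: "provable st_in_lang SCOT \<theta>"
  show "provable in_lang ZFc \<theta>"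
  proof (rule ccontr)
    assume "\<not> provable in_lang ZFc \<theta>"
    then obtain E :: "nat \<Rightarrow> nat \<Rightarrow> bool"
      where E: "\<And>\<phi> e. \<phi> \<in> ZFc \<Longrightarrow> sat E e \<phi>" and not: "\<And>e. \<not> sat E e \<theta>"
      using countermodel \<theta> by metis
    interpret ZFc_model E
      by unfold_locales (rule E)
    \<comment> \<open>\<open>\<theta>\<close> fails in the model at every assignment, so any choice
      of names leads to the contradiction.\<close>
    have "forces \<theta> omega undefined"
      by (rule forces_sound[OF SCOT cond_omega]) (rule forces_SCOT[OF _ cond_omega])
    then have "aa omega (\<lambda>n. sat E (\<lambda>i. app (undefined i) n) \<theta>)"
      using los \<theta> cond_omega by blast
    from aa_ex[OF cond_omega this] not show False
      by blast
  qed
qed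

end
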